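(* Let $\mathcal{H}$ be a Hopf algebra with bijective antipode, let $\mathcal{A}$ and $\mathcal{A}'$ be right $\mathcal{H}$-comodule algebras, and let $V$ be a finite-dimensional left $\mathcal{H}$-comodule. Denote by $\mathcal{B}$ and $\mathcal{B}'$ the respective coaction-invariant subalgebras. Assume that $\mathcal{A}$ is principal and that there exists an $\mathcal{H}$-equivariant (right $\mathcal{H}$-colinear) algebra homomorphism $f\colon\mathcal{A}\to\mathcal{A}'$. Then the restriction-corestriction of $f$ to $\mathcal{B}\to\mathcal{B}'$ makes $\mathcal{B}'$ a $(\mathcal{B}'-\mathcal{B})$-bimodule such that the associated left $\mathcal{B}'$-modules $\mathcal{B}'\otimes_{\mathcal{B}}(\mathcal{A}\,\Box^{\mathcal{H}}V)$ and $\mathcal{A}'\,\Box^{\mathcal{H}}V$ are isomorphic. In particular, the induced map $f_*\colon K_0(\mathcal{B})\to K_0(\mathcal{B}')$ satisfies $f_*([\mathcal{A}\,\Box^{\mathcal{H}}V])=[\mathcal{A}'\,\Box^{\mathcal{H}}V]$.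
   Context: Algebras, coalgebras and vector spaces are over $\mathbb{C}$; algebras and algebra homomorphisms are unital; unadorned $\otimes$ is over $\mathbb{C}$. $S$, $\Delta$, $\varepsilon$ denote the antipode, comultiplication and counit of $\mathcal{H}$. For a right $\mathcal{H}$-comodule $(M,\delta_M)$ and a left $\mathcal{H}$-comodule $(N,{}_N\delta)$, the cotensor product is $M\,\Box^{\mathcal{H}}N:=\ker(\delta_M\otimes\mathrm{id}-\mathrm{id}\otimes{}_N\delta)\subseteq M\otimes N$. For a right $\mathcal{H}$-comodule algebra $\mathcal{A}$ with coaction $\delta_{\mathcal{A}}\colon\mathcal{A}\to\mathcal{A}\otimes\mathcal{H}$ (an algebra homomorphism), the coaction-invariant subalgebra is $\{b\in\mathcal{A}\mid\delta_{\mathcal{A}}(b)=b\otimes1\}$. $\mathcal{A}$ is called principal if there exists a strong connection, i.e. a unital linear map $\ell\colon\mathcal{H}\to\mathcal{A}\otimes\mathcal{A}$ ($\ell(1)=1\otimes1$) such that (1) $(\mathrm{id}\otimes\delta_{\mathcal{A}})\circ\ell=(\ell\otimes\mathrm{id})\circ\Delta$ and $\big(((S^{-1}\otimes\mathrm{id})\circ\mathrm{flip}\circ\delta_{\mathcal{A}})\otimes\mathrm{id}\big)\circ\ell=(\mathrm{id}\otimes\ell)\circ\Delta$; (2) $m\circ\ell=\varepsilon$ (i.e. $m(\ell(h))=\varepsilon(h)1$), where $m\colon\mathcal{A}\otimes\mathcal{A}\to\mathcal{A}$ is the multiplication. The left $\mathcal{B}$-module structure on $\mathcal{A}\,\Box^{\mathcal{H}}V$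 is by left multiplication on $\mathcal{A}$ (and similarly for $\mathcal{A}'$); $\mathcal{B}'$ is a right $\mathcal{B}$-module via $b'\cdot b:=b'f(b)$. The induced map on $K_0$ (classes of finitely generated projective left modules) is $[P]\mapsto[\mathcal{B}'\otimes_{\mathcal{B}}P]$. *)

theory Defs
  imports Complex_Main "HOL-Algebra.Free_Abelian_Groups" "HOL-Algebra.Module"
begin

section \<open>Modules over noncommutative rings\<close>

text \<open>
  The library locale \<open>module\<close> requires a commutative ring; the coaction-invariant subalgebras are
  noncommutative.  The record type \<open>module\<close> is reused; its fields \<open>mult\<close> and \<open>one\<close> are irrelevant
  for a module that is not an algebra and are set to \<open>undefined\<close> below.
\<close>

locale left_module = R?: ring R + M?: abelian_group M for R (structure) and M (structure) +
  assumes lsmult_closed: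
      "\<lbrakk>r \<in> carrier R; x \<in> carrier M\<rbrakk> \<Longrightarrow> r \<odot>\<^bsub>M\<^esub> x \<in> carrier M"
    and lsmult_l_distr:
      "\<lbrakk>r \<in> carrier R; s \<in> carrier R; x \<in> carrier M\<rbrakk> \<Longrightarrow>
        (r \<oplus> s) \<odot>\<^bsub>M\<^esub> x = r \<odot>\<^bsub>M\<^esub> x \<oplus>\<^bsub>M\<^esub> s \<odot>\<^bsub>M\<^esub> x"
    and lsmult_r_distr:
      "\<lbrakk>r \<in> carrier R; x \<in> carrier M; y \<in> carrier M\<rbrakk> \<Longrightarrow>
        r \<odot>\<^bsub>M\<^esub> (x \<oplus>\<^bsub>M\<^esub> y) = r \<odot>\<^bsub>M\<^esub> x \<oplus>\<^bsub>M\<^esub> r \<odot>\<^bsub>M\<^esub> y"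
    and lsmult_assoc:
      "\<lbrakk>r \<in> carrier R; s \<in> carrier R; x \<in> carrier M\<rbrakk> \<Longrightarrow>
        (r \<otimes> s) \<odot>\<^bsub>M\<^esub> x = r \<odot>\<^bsub>M\<^esub> (s \<odot>\<^bsub>M\<^esub> x)"
    and lsmult_one: "x \<in> carrier M \<Longrightarrow> \<one> \<odot>\<^bsub>M\<^esub> x = x"

text \<open>An \<open>(S, R)\<close>-bimodule: the left action is the field \<open>smult\<close>, the right action is \<open>act\<close>.\<close>

locale bimodule = left_module S M + R: ring R
  for S (structure) and R (structure) and M (structure) and act :: "'m \<Rightarrow> 'r \<Rightarrow> 'm" +
  assumes act_closed: "\<lbrakk>x \<in> carrier M; r \<in> carrier R\<rbrakk> \<Longrightarrow> act x r \<in> carrier M"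
    and act_l_distr:
      "\<lbrakk>x \<in> carrier M; y \<in> carrier M; r \<in> carrier R\<rbrakk> \<Longrightarrow> act (x \<oplus>\<^bsub>M\<^esub> y) r = act x r \<oplus>\<^bsub>M\<^esub> act y r"
    and act_r_distr:
      "\<lbrakk>x \<in> carrier M; r \<in> carrier R; s \<in> carrier R\<rbrakk> \<Longrightarrow>
        act x (r \<oplus>\<^bsub>R\<^esub> s) = act x r \<oplus>\<^bsub>M\<^esub> act x s"
    and act_assoc:
      "\<lbrakk>x \<in> carrier M; r \<in> carrier R; s \<in> carrier R\<rbrakk> \<Longrightarrow> act x (r \<otimes>\<^bsub>R\<^esub> s) = act (act x r) s"
    and act_one: "x \<in> carrier M \<Longrightarrow> act x \<one>\<^bsub>R\<^esub> = x"
    and act_smult: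
      "\<lbrakk>a \<in> carrier S; x \<in> carrier M; r \<in> carrier R\<rbrakk> \<Longrightarrow> act (a \<odot>\<^bsub>M\<^esub> x) r = a \<odot>\<^bsub>M\<^esub> act x r"

definition module_homs ::
  "('r, 'c) ring_scheme \<Rightarrow> ('r, 'm, 'd) module_scheme \<Rightarrow> ('r, 'n, 'e) module_scheme \<Rightarrow> ('m \<Rightarrow> 'n) set"
  where "module_homs R M N = {h \<in> carrier M \<rightarrow> carrier N.
    (\<forall>x\<in>carrier M. \<forall>y\<in>carrier M. h (x \<oplus>\<^bsub>M\<^esub> y) = h x \<oplus>\<^bsub>N\<^esub> h y) \<and>
    (\<forall>r\<in>carrier R. \<forall>x\<in>carrier M. h (r \<odot>\<^bsub>M\<^esub> x) = r \<odot>\<^bsub>N\<^esub> h x)}"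

definition module_isomorphic ::
  "('r, 'c) ring_scheme \<Rightarrow> ('r, 'm, 'd) module_scheme \<Rightarrow> ('r, 'n, 'e) module_scheme \<Rightarrow> bool"
  where "module_isomorphic R M N \<longleftrightarrow> left_module R M \<and> left_module R N \<and>
    (\<exists>h\<in>module_homs R M N. bij_betw h (carrier M) (carrier N))"

definition regular_module :: "('r, 'c) ring_scheme \<Rightarrow> ('r, 'r) module"
  where "regular_module R = \<lparr>carrier = carrier R, mult = mult R, one = \<one>\<^bsub>R\<^esub>,
    zero = \<zero>\<^bsub>R\<^esub>, add = add R, smult = mult R\<rparr>"

definition module_sum :: "('r, 'm) module \<Rightarrow> ('r, 'n) module \<Rightarrow> ('r, 'm \<times> 'n) module"
  where "module_sum M N = \<lparr>carrier = carrier M \<times> carrier N, mult = undefined, one = undefined,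
    zero = (\<zero>\<^bsub>M\<^esub>, \<zero>\<^bsub>N\<^esub>), add = (\<lambda>(x, y) (x', y'). (x \<oplus>\<^bsub>M\<^esub> x', y \<oplus>\<^bsub>N\<^esub> y')),
    smult = (\<lambda>r (x, y). (r \<odot>\<^bsub>M\<^esub> x, r \<odot>\<^bsub>N\<^esub> y))\<rparr>"

section \<open>Tensor products\<close>

text \<open>
  For a right \<open>R\<close>-module \<open>M\<close> (with right action \<open>act\<close>) and a left \<open>R\<close>-module \<open>N\<close>, the tensor
  product over \<open>R\<close> is the free abelian group on \<open>M \<times> N\<close> modulo the usual relations, so its elements
  are cosets of formal integer combinations of pairs.
\<close>

type_synonym ('m, 'n) tens = "('m \<times> 'n \<Rightarrow>\<^sub>0 int) set"

definition tensor_relations ::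
  "('r, 'c) ring_scheme \<Rightarrow> ('m, 'd) ring_scheme \<Rightarrow> ('m \<Rightarrow> 'r \<Rightarrow> 'm) \<Rightarrow> ('r, 'n, 'e) module_scheme
    \<Rightarrow> ('m, 'n) tens"
  where "tensor_relations R M act N =
    {frag_of (x \<oplus>\<^bsub>M\<^esub> x', y) - frag_of (x, y) - frag_of (x', y) | x x' y.
      x \<in> carrier M \<and> x' \<in> carrier M \<and> y \<in> carrier N} \<union>
    {frag_of (x, y \<oplus>\<^bsub>N\<^esub> y') - frag_of (x, y) - frag_of (x, y') | x y y'.
      x \<in> carrier M \<and> y \<in> carrier N \<and> y' \<in> carrier N} \<union>
    {frag_of (act x r, y) - frag_of (x, r \<odot>\<^bsub>N\<^esub> y) | x r y.
      x \<in> carrier M \<and> r \<in> carrier R \<and> y \<in> carrier N}"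

definition tensor_kernel ::
  "('r, 'c) ring_scheme \<Rightarrow> ('m, 'd) ring_scheme \<Rightarrow> ('m \<Rightarrow> 'r \<Rightarrow> 'm) \<Rightarrow> ('r, 'n, 'e) module_scheme
    \<Rightarrow> ('m, 'n) tens"
  where "tensor_kernel R M act N =
    generate (free_Abelian_group (carrier M \<times> carrier N)) (tensor_relations R M act N)"

definition pure_tensor ::
  "('r, 'c) ring_scheme \<Rightarrow> ('m, 'd) ring_scheme \<Rightarrow> ('m \<Rightarrow> 'r \<Rightarrow> 'm) \<Rightarrow> ('r, 'n, 'e) module_scheme
    \<Rightarrow> 'm \<Rightarrow> 'n \<Rightarrow> ('m, 'n) tens"
  where "pure_tensor R M act N x y =
    tensor_kernel R M act N #>\<^bsub>free_Abelian_group (carrier M \<times> carrier N)\<^esub> frag_of (x, y)"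

definition tensor_group ::
  "('r, 'c) ring_scheme \<Rightarrow> ('m, 'd) ring_scheme \<Rightarrow> ('m \<Rightarrow> 'r \<Rightarrow> 'm) \<Rightarrow> ('r, 'n, 'e) module_scheme
    \<Rightarrow> ('m, 'n) tens ring"
  where "tensor_group R M act N =
    (let Q = free_Abelian_group (carrier M \<times> carrier N) Mod tensor_kernel R M act N
     in \<lparr>carrier = carrier Q, mult = undefined, one = undefined,
         zero = \<one>\<^bsub>Q\<^esub>, add = mult Q\<rparr>)"

text \<open>
  For a balanced biadditive map \<open>\<phi>\<close> with values in the abelian group \<open>G\<close>, \<open>tensor_lift G \<phi>\<close> is the
  induced homomorphism, sending the class of \<open>x \<otimes> y\<close> to \<open>\<phi> x y\<close>: the image of a coset is the common
  value on all its representatives.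
\<close>

definition tensor_lift :: "('g, 'c) ring_scheme \<Rightarrow> ('m \<Rightarrow> 'n \<Rightarrow> 'g) \<Rightarrow> ('m, 'n) tens \<Rightarrow> 'g"
  where "tensor_lift G \<phi> X = the_elem
    ((\<lambda>c. \<Oplus>\<^bsub>G\<^esub>p\<in>Poly_Mapping.keys c. [Poly_Mapping.lookup c p] \<cdot>\<^bsub>G\<^esub> \<phi> (fst p) (snd p)) ` X)"

text \<open>If \<open>M\<close> also carries a left action commuting with \<open>act\<close>, so does the tensor product.\<close>

definition tensor_module ::
  "('r, 'c) ring_scheme \<Rightarrow> ('s, 'm, 'd) module_scheme \<Rightarrow> ('m \<Rightarrow> 'r \<Rightarrow> 'm) \<Rightarrow> ('r, 'n, 'e) module_scheme
    \<Rightarrow> ('s, ('m, 'n) tens) module"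
  where "tensor_module R M act N =
    (let T = tensor_group R M act N
     in \<lparr>carrier = carrier T, mult = undefined, one = undefined, zero = \<zero>\<^bsub>T\<^esub>, add = add T,
         smult = (\<lambda>s. tensor_lift T (\<lambda>x y. pure_tensor R M act N (s \<odot>\<^bsub>M\<^esub> x) y))\<rparr>)"

text \<open>\<open>S \<otimes>\<^sub>R P\<close>, where \<open>S\<close> is a right \<open>R\<close>-module via \<open>s \<cdot> r = s f(r)\<close>.\<close>

definition base_change ::
  "('r, 'c) ring_scheme \<Rightarrow> ('s, 'd) ring_scheme \<Rightarrow> ('r \<Rightarrow> 's) \<Rightarrow> ('r, 'p, 'e) module_scheme
    \<Rightarrow> ('s, ('s, 'p) tens) module"
  where "base_change R S f P = tensor_module R (regular_module S) (\<lambda>s r. s \<otimes>\<^bsub>S\<^esub> f r) P"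

section \<open>The group \<open>K\<^sub>0\<close>\<close>

definition finitely_generated :: "('r, 'c) ring_scheme \<Rightarrow> ('r, 'p) module \<Rightarrow> bool"
  where "finitely_generated R P \<longleftrightarrow> (\<exists>X. finite X \<and> X \<subseteq> carrier P \<and>
    (\<forall>p\<in>carrier P. \<exists>c\<in>X \<rightarrow> carrier R. p = (\<Oplus>\<^bsub>P\<^esub>x\<in>X. c x \<odot>\<^bsub>P\<^esub> x)))"

text \<open>
  The lifting property against surjections \<open>g : M \<rightarrow> N\<close>.  HOL cannot quantify over all types here;
  the types chosen for \<open>M\<close> and \<open>N\<close> accommodate the free module on the elements of \<open>P\<close> (finitely
  supported functions \<open>'p \<Rightarrow> 'r\<close>) and \<open>P\<close> itself, so \<open>P\<close> is then a direct summand of that free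
  module and the lifting property holds for \<open>M\<close> and \<open>N\<close> of arbitrary type.
\<close>

definition projective :: "('r, 'c) ring_scheme \<Rightarrow> ('r, 'p) module \<Rightarrow> bool"
  where "projective R P \<longleftrightarrow>
    (\<forall>(M :: ('r, 'p \<Rightarrow> 'r) module) (N :: ('r, 'p) module) g h.
      left_module R M \<and> left_module R N \<and> g \<in> module_homs R M N \<and> g ` carrier M = carrier N \<and>
      h \<in> module_homs R P N \<longrightarrow>
      (\<exists>k\<in>module_homs R P M. \<forall>p\<in>carrier P. g (k p) = h p))"

definition fg_projective :: "('r, 'c) ring_scheme \<Rightarrow> ('r, 'p) module \<Rightarrow> bool"
  where "fg_projective R P \<longleftrightarrow> left_module R P \<and> finitely_generated R P \<and> projective R P"

text \<open>
  Every finitely generated projective \<open>R\<close>-module is isomorphic to a direct summand of some \<open>R\<^sup>n\<close>,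
  hence to a module whose elements are functions \<open>nat \<Rightarrow> 'r\<close>.  The isomorphism class of a module
  (of any type) is represented by the modules of that type isomorphic to it.
\<close>

definition iso_class :: "('r, 'c) ring_scheme \<Rightarrow> ('r, 'p) module \<Rightarrow> ('r, nat \<Rightarrow> 'r) module set"
  where "iso_class R P = {Q. module_isomorphic R P Q}"

definition fgp_classes :: "('r, 'c) ring_scheme \<Rightarrow> ('r, nat \<Rightarrow> 'r) module set set"
  where "fgp_classes R = {iso_class R P | P :: ('r, nat \<Rightarrow> 'r) module. fg_projective R P}"

definition K0_relations ::
  "('r, 'c) ring_scheme \<Rightarrow> (('r, nat \<Rightarrow> 'r) module set \<Rightarrow>\<^sub>0 int) set"
  where "K0_relations R =
    {frag_of (iso_class R T) - frag_of (iso_class R P) - frag_of (iso_class R Q) |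
      (T :: ('r, nat \<Rightarrow> 'r) module) (P :: ('r, nat \<Rightarrow> 'r) module) (Q :: ('r, nat \<Rightarrow> 'r) module).
      fg_projective R T \<and> fg_projective R P \<and> fg_projective R Q \<and>
      module_isomorphic R T (module_sum P Q)}"

definition K0_kernel ::
  "('r, 'c) ring_scheme \<Rightarrow> (('r, nat \<Rightarrow> 'r) module set \<Rightarrow>\<^sub>0 int) set"
  where "K0_kernel R = generate (free_Abelian_group (fgp_classes R)) (K0_relations R)"

text \<open>The abelian group \<open>K\<^sub>0(R)\<close>, written multiplicatively as a library quotient group.\<close>

definition K0 ::
  "('r, 'c) ring_scheme \<Rightarrow> (('r, nat \<Rightarrow> 'r) module set \<Rightarrow>\<^sub>0 int) set monoid"
  where "K0 R = free_Abelian_group (fgp_classes R) Mod K0_kernel R"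

text \<open>The class \<open>[P]\<close>, for a finitely generated projective module \<open>P\<close>.\<close>

definition K0_class ::
  "('r, 'c) ring_scheme \<Rightarrow> ('r, 'p) module \<Rightarrow> (('r, nat \<Rightarrow> 'r) module set \<Rightarrow>\<^sub>0 int) set"
  where "K0_class R P =
    K0_kernel R #>\<^bsub>free_Abelian_group (fgp_classes R)\<^esub> frag_of (iso_class R P)"

text \<open>
  \<open>F\<close> is the homomorphism \<open>[P] \<mapsto> [S \<otimes>\<^sub>R P]\<close>; the classes \<open>[P]\<close> generate \<open>K\<^sub>0(R)\<close>, so at most one
  such \<open>F\<close> exists on the carrier.
\<close>

definition is_K0_map ::
  "('r, 'c) ring_scheme \<Rightarrow> ('s, 'd) ring_scheme \<Rightarrow> ('r \<Rightarrow> 's) \<Rightarrow>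
    ((('r, nat \<Rightarrow> 'r) module set \<Rightarrow>\<^sub>0 int) set \<Rightarrow> (('s, nat \<Rightarrow> 's) module set \<Rightarrow>\<^sub>0 int) set) \<Rightarrow> bool"
  where "is_K0_map R S f F \<longleftrightarrow>
    F \<in> hom (K0 R) (K0 S) \<and> F \<in> extensional (carrier (K0 R)) \<and>
    (\<forall>P :: ('r, nat \<Rightarrow> 'r) module. fg_projective R P \<longrightarrow>
      fg_projective S (base_change R S f P) \<and>
      F (K0_class R P) = K0_class S (base_change R S f P))"

definition K0_map ::
  "('r, 'c) ring_scheme \<Rightarrow> ('s, 'd) ring_scheme \<Rightarrow> ('r \<Rightarrow> 's) \<Rightarrow>
    (('r, nat \<Rightarrow> 'r) module set \<Rightarrow>\<^sub>0 int) set \<Rightarrow> (('s, nat \<Rightarrow> 's) module set \<Rightarrow>\<^sub>0 int) set"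
  where "K0_map R S f = (THE F. is_K0_map R S f F)"

section \<open>Vector spaces and algebras over the complex numbers\<close>

definition complex_ring :: "complex ring"
  where "complex_ring = \<lparr>carrier = UNIV, mult = (*), one = 1, zero = 0, add = (+)\<rparr>"

abbreviation complex_space :: "(complex, 'v, 'c) module_scheme \<Rightarrow> bool"
  where "complex_space V \<equiv> module complex_ring V"

abbreviation linear_maps ::
  "(complex, 'v, 'c) module_scheme \<Rightarrow> (complex, 'w, 'd) module_scheme \<Rightarrow> ('v \<Rightarrow> 'w) set"
  where "linear_maps \<equiv> module_homs complex_ring"

definition finite_dimensional :: "(complex, 'v, 'c) module_scheme \<Rightarrow> bool"
  where "finite_dimensional V \<longleftrightarrow> (\<exists>X. finite X \<and> X \<subseteq> carrier V \<and>
    (\<forall>v\<in>carrier V. \<exists>!c. c \<in> extensional X \<and> v = (\<Oplus>\<^bsub>V\<^esub>x\<in>X. c x \<odot>\<^bsub>V\<^esub> x)))"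

text \<open>Associative unital, not necessarily commutative (unlike the library locale \<open>algebra\<close>).\<close>

locale complex_algebra = module complex_ring A + A: ring A for A (structure) +
  assumes smult_mult_left:
      "\<lbrakk>x \<in> carrier A; y \<in> carrier A\<rbrakk> \<Longrightarrow> (c \<odot> x) \<otimes> y = c \<odot> (x \<otimes> y)"
    and smult_mult_right:
      "\<lbrakk>x \<in> carrier A; y \<in> carrier A\<rbrakk> \<Longrightarrow> x \<otimes> (c \<odot> y) = c \<odot> (x \<otimes> y)"

definition algebra_homs ::
  "(complex, 'a, 'c) module_scheme \<Rightarrow> (complex, 'b, 'd) module_scheme \<Rightarrow> ('a \<Rightarrow> 'b) set"
  where "algebra_homs A B = linear_maps A B \<inter> ring_hom A B"

definition tensorC ::
  "(complex, 'm, 'c) module_scheme \<Rightarrow> (complex, 'n, 'd) module_scheme \<Rightarrow> (complex, ('m, 'n) tens) module"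
  where "tensorC M N = tensor_module complex_ring M (\<lambda>x c. c \<odot>\<^bsub>M\<^esub> x) N"

definition pureC ::
  "(complex, 'm, 'c) module_scheme \<Rightarrow> (complex, 'n, 'd) module_scheme \<Rightarrow> 'm \<Rightarrow> 'n \<Rightarrow> ('m, 'n) tens"
  where "pureC M N = pure_tensor complex_ring M (\<lambda>x c. c \<odot>\<^bsub>M\<^esub> x) N"

text \<open>\<open>tensor_map M N f g\<close> is \<open>f \<otimes> g\<close>, where \<open>M\<close> and \<open>N\<close> are the codomains of \<open>f\<close> and \<open>g\<close>.\<close>

definition tensor_map ::
  "(complex, 'm, 'c) module_scheme \<Rightarrow> (complex, 'n, 'd) module_scheme \<Rightarrow>
    ('k \<Rightarrow> 'm) \<Rightarrow> ('l \<Rightarrow> 'n) \<Rightarrow> ('k, 'l) tens \<Rightarrow> ('m, 'n) tens"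
  where "tensor_map M N f g = tensor_lift (tensorC M N) (\<lambda>x y. pureC M N (f x) (g y))"

text \<open>The canonical map \<open>(L \<otimes> M) \<otimes> N \<rightarrow> L \<otimes> (M \<otimes> N)\<close>.\<close>

definition tensor_assoc ::
  "(complex, 'l, 'b) module_scheme \<Rightarrow> (complex, 'm, 'c) module_scheme \<Rightarrow>
    (complex, 'n, 'd) module_scheme \<Rightarrow> (('l, 'm) tens, 'n) tens \<Rightarrow> ('l, ('m, 'n) tens) tens"
  where "tensor_assoc L M N = (let T = tensorC L (tensorC M N) in
    tensor_lift T (\<lambda>t z. tensor_lift T (\<lambda>x y. pureC L (tensorC M N) x (pureC M N y z)) t))"

definition tensor_flip ::
  "(complex, 'm, 'c) module_scheme \<Rightarrow> (complex, 'n, 'd) module_scheme \<Rightarrow>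
    ('m, 'n) tens \<Rightarrow> ('n, 'm) tens"
  where "tensor_flip M N = tensor_lift (tensorC N M) (\<lambda>x y. pureC N M y x)"

definition tensor_algebra ::
  "(complex, 'a, 'c) module_scheme \<Rightarrow> (complex, 'b, 'd) module_scheme \<Rightarrow> (complex, ('a, 'b) tens) module"
  where "tensor_algebra A B = (tensorC A B)
    \<lparr>mult := (\<lambda>s t. tensor_lift (tensorC A B) (\<lambda>x y. tensor_lift (tensorC A B)
        (\<lambda>x' y'. pureC A B (x \<otimes>\<^bsub>A\<^esub> x') (y \<otimes>\<^bsub>B\<^esub> y')) t) s),
     one := pureC A B \<one>\<^bsub>A\<^esub> \<one>\<^bsub>B\<^esub>\<rparr>"

section \<open>Hopf algebras, comodules, principal comodule algebras\<close>

record 'h hopf = "(complex, 'h) module" +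
  comul :: "'h \<Rightarrow> ('h, 'h) tens"
  counit :: "'h \<Rightarrow> complex"
  antipode :: "'h \<Rightarrow> 'h"

locale hopf_algebra = complex_algebra H for H :: "'h hopf" (structure) +
  assumes comul_hom: "comul H \<in> algebra_homs H (tensor_algebra H H)"
    and counit_hom: "counit H \<in> algebra_homs H (regular_module complex_ring)"
    and coassoc: "h \<in> carrier H \<Longrightarrow>
      tensor_assoc H H H (tensor_map (tensorC H H) H (comul H) id (comul H h)) =
      tensor_map H (tensorC H H) id (comul H) (comul H h)"
    and counit_left: "h \<in> carrier H \<Longrightarrow> tensor_lift H (\<lambda>x y. counit H x \<odot> y) (comul H h) = h"
    and counit_right: "h \<in> carrier H \<Longrightarrow> tensor_lift H (\<lambda>x y. counit H y \<odot> x) (comul H h) = h"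
    and antipode_linear: "antipode H \<in> linear_maps H H"
    and antipode_left: "h \<in> carrier H \<Longrightarrow>
      tensor_lift H (\<lambda>x y. antipode H x \<otimes> y) (comul H h) = counit H h \<odot> \<one>"
    and antipode_right: "h \<in> carrier H \<Longrightarrow>
      tensor_lift H (\<lambda>x y. x \<otimes> antipode H y) (comul H h) = counit H h \<odot> \<one>"

definition right_comodule ::
  "'h hopf \<Rightarrow> (complex, 'm) module \<Rightarrow> ('m \<Rightarrow> ('m, 'h) tens) \<Rightarrow> bool"
  where "right_comodule H M \<delta> \<longleftrightarrow> complex_space M \<and> \<delta> \<in> linear_maps M (tensorC M H) \<and>
    (\<forall>x\<in>carrier M. tensor_assoc M H H (tensor_map (tensorC M H) H \<delta> id (\<delta> x)) =
      tensor_map M (tensorC H H) id (comul H) (\<delta> x)) \<and>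
    (\<forall>x\<in>carrier M. tensor_lift M (\<lambda>y h. counit H h \<odot>\<^bsub>M\<^esub> y) (\<delta> x) = x)"

definition left_comodule ::
  "'h hopf \<Rightarrow> (complex, 'n) module \<Rightarrow> ('n \<Rightarrow> ('h, 'n) tens) \<Rightarrow> bool"
  where "left_comodule H N \<rho> \<longleftrightarrow> complex_space N \<and> \<rho> \<in> linear_maps N (tensorC H N) \<and>
    (\<forall>x\<in>carrier N. tensor_assoc H H N (tensor_map (tensorC H H) N (comul H) id (\<rho> x)) =
      tensor_map H (tensorC H N) id \<rho> (\<rho> x)) \<and>
    (\<forall>x\<in>carrier N. tensor_lift N (\<lambda>h y. counit H h \<odot>\<^bsub>N\<^esub> y) (\<rho> x) = x)"

definition comodule_algebra ::
  "'h hopf \<Rightarrow> (complex, 'a) module \<Rightarrow> ('a \<Rightarrow> ('a, 'h) tens) \<Rightarrow> bool"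
  where "comodule_algebra H A \<delta> \<longleftrightarrow> complex_algebra A \<and> right_comodule H A \<delta> \<and>
    \<delta> \<in> algebra_homs A (tensor_algebra A H)"

definition colinear_maps ::
  "'h hopf \<Rightarrow> (complex, 'm) module \<Rightarrow> ('m \<Rightarrow> ('m, 'h) tens) \<Rightarrow>
    (complex, 'n) module \<Rightarrow> ('n \<Rightarrow> ('n, 'h) tens) \<Rightarrow> ('m \<Rightarrow> 'n) set"
  where "colinear_maps H M \<delta> N \<delta>' =
    {f \<in> linear_maps M N. \<forall>x\<in>carrier M. \<delta>' (f x) = tensor_map N H f id (\<delta> x)}"

definition coinvariants ::
  "'h hopf \<Rightarrow> (complex, 'a) module \<Rightarrow> ('a \<Rightarrow> ('a, 'h) tens) \<Rightarrow> (complex, 'a) module"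
  where "coinvariants H A \<delta> = A\<lparr>carrier := {b \<in> carrier A. \<delta> b = pureC A H b \<one>\<^bsub>H\<^esub>}\<rparr>"

definition strong_connection ::
  "'h hopf \<Rightarrow> (complex, 'a) module \<Rightarrow> ('a \<Rightarrow> ('a, 'h) tens) \<Rightarrow> ('h \<Rightarrow> ('a, 'a) tens) \<Rightarrow> bool"
  where "strong_connection H A \<delta> l \<longleftrightarrow>
    l \<in> linear_maps H (tensorC A A) \<and> l \<one>\<^bsub>H\<^esub> = pureC A A \<one>\<^bsub>A\<^esub> \<one>\<^bsub>A\<^esub> \<and>
    (\<forall>h\<in>carrier H. tensor_map A (tensorC A H) id \<delta> (l h) =
      tensor_assoc A A H (tensor_map (tensorC A A) H l id (comul H h))) \<and>
    (let Sinv = inv_into (carrier H) (antipode H);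
         coact_left = (\<lambda>a. tensor_map H A Sinv id (tensor_flip A H (\<delta> a)))
     in \<forall>h\<in>carrier H. tensor_assoc H A A (tensor_map (tensorC H A) A coact_left id (l h)) =
          tensor_map H (tensorC A A) id l (comul H h)) \<and>
    (\<forall>h\<in>carrier H. tensor_lift A (\<lambda>x y. x \<otimes>\<^bsub>A\<^esub> y) (l h) = counit H h \<odot>\<^bsub>A\<^esub> \<one>\<^bsub>A\<^esub>)"

definition principal_comodule_algebra ::
  "'h hopf \<Rightarrow> (complex, 'a) module \<Rightarrow> ('a \<Rightarrow> ('a, 'h) tens) \<Rightarrow> bool"
  where "principal_comodule_algebra H A \<delta> \<longleftrightarrow> comodule_algebra H A \<delta> \<and> (\<exists>l. strong_connection H A \<delta> l)"

definition cotensor ::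
  "'h hopf \<Rightarrow> (complex, 'm) module \<Rightarrow> ('m \<Rightarrow> ('m, 'h) tens) \<Rightarrow>
    (complex, 'n) module \<Rightarrow> ('n \<Rightarrow> ('h, 'n) tens) \<Rightarrow> ('m, 'n) tens set"
  where "cotensor H M \<delta> N \<rho> = {t \<in> carrier (tensorC M N).
    tensor_assoc M H N (tensor_map (tensorC M H) N \<delta> id t) = tensor_map M (tensorC H N) id \<rho> t}"

text \<open>The cotensor product as a left module, with scalars acting by left multiplication on \<open>A\<close>.\<close>

definition cotensor_module ::
  "'h hopf \<Rightarrow> (complex, 'a) module \<Rightarrow> ('a \<Rightarrow> ('a, 'h) tens) \<Rightarrow>
    (complex, 'v) module \<Rightarrow> ('v \<Rightarrow> ('h, 'v) tens) \<Rightarrow> ('a, ('a, 'v) tens) module"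
  where "cotensor_module H A \<delta> V \<rho> = \<lparr>carrier = cotensor H A \<delta> V \<rho>, mult = undefined,
    one = undefined, zero = \<zero>\<^bsub>tensorC A V\<^esub>, add = add (tensorC A V),
    smult = (\<lambda>b. tensor_map A V (\<lambda>a. b \<otimes>\<^bsub>A\<^esub> a) id)\<rparr>"

end

theory Submission
  imports Defs "HOL-Algebra.Subrings"
begin

text \<open>
  Write \<open>B\<close> and \<open>B'\<close> for the invariant subalgebras and \<open>P = A \<box> V\<close>, \<open>P' = A' \<box> V\<close>.  If \<open>V\<close> has a basis with
  coefficient matrix \<open>c\<close>, an element of \<open>P\<close> is a row \<open>a\<close> over \<open>A\<close> with \<open>\<delta>(a) = a \<otimes> c\<close>.  A strong
  connection \<open>l\<close> provides two rectangular matrices over \<open>A\<close>: a matrix \<open>Q\<close> whose rows lie in \<open>P\<close>, so that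
  \<open>\<delta>(Q) = Q \<otimes> c\<close>, and a matrix \<open>Z\<close> with \<open>\<delta>(Z)\<close> governed by \<open>S(c)\<close> and \<open>Z Q = 1\<close>.  For \<open>a\<close> in \<open>P\<close> the
  entries of \<open>a Z\<close> are then invariant, because \<open>c S(c) = 1\<close>, and \<open>a = (a Z) Q\<close>.  Hence the rows of \<open>Q\<close>
  together with the coordinates \<open>a \<mapsto> a Z\<close> form a finite dual basis of \<open>P\<close> over \<open>B\<close>, and \<open>P\<close> is finitely
  generated projective.

  The three properties of \<open>Z\<close> and \<open>Q\<close> are equations that an equivariant algebra homomorphism \<open>f\<close> preserves.
  So \<open>f(Z)\<close> and \<open>f(Q)\<close> do for \<open>P'\<close> what \<open>Z\<close> and \<open>Q\<close> do for \<open>P\<close>, and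
  \<open>b' \<otimes> p \<mapsto> b' f(p)\<close> has the inverse \<open>a' \<mapsto> \<Sum>\<^sub>k (a' f(Z))\<^sub>k \<otimes> Q\<^sub>k\<close>
  (\<open>base_change_isomorphic\<close>).

  The pair \<open>(Z, Q)\<close> is called a \<open>frame\<close> below and is stated without coordinates on \<open>V\<close>.  It comes
  from the linear map \<open>L = (l \<otimes> id) \<circ> \<rho>\<close> from \<open>V\<close> to \<open>A \<otimes> (A \<otimes> V)\<close>.  Right colinearity of \<open>l\<close> says that
  contracting the first leg of \<open>L v\<close> with any functional lands in \<open>P\<close> (\<open>slice_cotensor\<close>); as \<open>V\<close> is
  finite-dimensional, \<open>L v = \<Sum>\<^sub>k z\<^sub>k(v) \<otimes> q\<^sub>k\<close> for finitely many \<open>q\<^sub>k\<close> in \<open>P\<close> and linear maps \<open>z\<^sub>k\<close>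
  obtained by contracting the second leg (\<open>finite_rank_decomposition\<close>).  Left colinearity of \<open>l\<close> gives the
  transformation law of \<open>z\<^sub>k\<close> (\<open>coefficient_covariant\<close>), and \<open>m \<circ> l = \<epsilon>\<close> gives
  \<open>\<Sum>\<^sub>k z\<^sub>k(v) q\<^sub>k = 1 \<otimes> v\<close> (\<open>mult_L\<close>).

  The statement on \<open>K\<^sub>0\<close> is then formal.  Being finitely generated projective is the same as having a
  finite dual basis; base change carries dual bases, isomorphisms and direct sums along, so it descends to a
  unique homomorphism \<open>K\<^sub>0(B) \<rightarrow> K\<^sub>0(B')\<close>, whose value at \<open>[P]\<close> is read off from the isomorphism above.
\<close>

section \<open>Additive maps\<close>

definition add_homs :: "('g, 'c) ring_scheme \<Rightarrow> ('k, 'd) ring_scheme \<Rightarrow> ('g \<Rightarrow> 'k) set"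
  where "add_homs G K = {h \<in> carrier G \<rightarrow> carrier K.
    \<forall>x\<in>carrier G. \<forall>y\<in>carrier G. h (x \<oplus>\<^bsub>G\<^esub> y) = h x \<oplus>\<^bsub>K\<^esub> h y}"

lemma add_homsI:
  assumes "\<And>x. x \<in> carrier G \<Longrightarrow> h x \<in> carrier K"
    and "\<And>x y. \<lbrakk>x \<in> carrier G; y \<in> carrier G\<rbrakk> \<Longrightarrow> h (x \<oplus>\<^bsub>G\<^esub> y) = h x \<oplus>\<^bsub>K\<^esub> h y"
  shows "h \<in> add_homs G K"
  using assms by (auto simp: add_homs_def)

lemma add_homs_closed: "\<lbrakk>h \<in> add_homs G K; x \<in> carrier G\<rbrakk> \<Longrightarrow> h x \<in> carrier K"
  by (auto simp: add_homs_def)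

lemma add_homs_add:
  "\<lbrakk>h \<in> add_homs G K; x \<in> carrier G; y \<in> carrier G\<rbrakk> \<Longrightarrow> h (x \<oplus>\<^bsub>G\<^esub> y) = h x \<oplus>\<^bsub>K\<^esub> h y"
  by (auto simp: add_homs_def)

lemma (in abelian_group) add_idem_zero:
  assumes "x \<in> carrier G" "x \<oplus> x = x" shows "x = \<zero>"
  using assms by (metis add.r_cancel_one')

lemma add_homs_zero:
  assumes "abelian_group G" "abelian_group K" "h \<in> add_homs G K"
  shows "h \<zero>\<^bsub>G\<^esub> = \<zero>\<^bsub>K\<^esub>"
proof -
  interpret G: abelian_group G by fact
  interpret K: abelian_group K by fact
  have "h \<zero>\<^bsub>G\<^esub> \<oplus>\<^bsub>K\<^esub> h \<zero>\<^bsub>G\<^esub> = h \<zero>\<^bsub>G\<^esub>"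
    using add_homs_add[OF assms(3), of "\<zero>\<^bsub>G\<^esub>" "\<zero>\<^bsub>G\<^esub>"] by simp
  then show ?thesis using K.add_idem_zero add_homs_closed[OF assms(3)] by blast
qed

lemma add_homs_finsum:
  assumes "abelian_group G" "abelian_group K" "h \<in> add_homs G K" "finite I"
    and "\<And>i. i \<in> I \<Longrightarrow> g i \<in> carrier G"
  shows "h (\<Oplus>\<^bsub>G\<^esub>i\<in>I. g i) = (\<Oplus>\<^bsub>K\<^esub>i\<in>I. h (g i))"
proof -
  interpret G: abelian_group G by fact
  interpret K: abelian_group K by fact
  from assms(4,5) show ?thesis
    by (induction I rule: finite_induct)
      (auto simp: add_homs_zero[OF assms(1-3)] G.finsum_insert K.finsum_insert Pi_iff
        add_homs_add[OF assms(3)] add_homs_closed[OF assms(3)])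
qed

lemma abelian_group_cong:
  assumes "abelian_group G" "carrier H = carrier G" "zero H = zero G" "add H = add G"
  shows "abelian_group H"
proof -
  interpret G: abelian_group G by fact
  show ?thesis
  proof (rule abelian_groupI)
    fix x assume "x \<in> carrier H"
    then show "\<exists>y\<in>carrier H. y \<oplus>\<^bsub>H\<^esub> x = \<zero>\<^bsub>H\<^esub>"
      by (intro bexI[of _ "\<ominus>\<^bsub>G\<^esub> x"]) (simp_all add: assms G.l_neg)
  qed (simp_all add: assms G.a_ac)
qed

section \<open>The tensor product of modules\<close>

locale tensor_data =
  fixes R :: "('r, 'c) ring_scheme" and M :: "('m, 'd) ring_scheme"
    and act :: "'m \<Rightarrow> 'r \<Rightarrow> 'm" and N :: "('r, 'n, 'e) module_scheme"
  assumes M_abelian: "abelian_group M" and N_abelian: "abelian_group N"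
    and act_carrier: "\<lbrakk>x \<in> carrier M; r \<in> carrier R\<rbrakk> \<Longrightarrow> act x r \<in> carrier M"
    and smult_carrier: "\<lbrakk>r \<in> carrier R; y \<in> carrier N\<rbrakk> \<Longrightarrow> r \<odot>\<^bsub>N\<^esub> y \<in> carrier N"
begin

abbreviation "FG \<equiv> free_Abelian_group (carrier M \<times> carrier N)"
abbreviation "TK \<equiv> tensor_kernel R M act N"
abbreviation "T \<equiv> tensor_group R M act N"
abbreviation "pt \<equiv> pure_tensor R M act N"

definition balanced :: "('g, 'k) ring_scheme \<Rightarrow> ('m \<Rightarrow> 'n \<Rightarrow> 'g) \<Rightarrow> bool"
  where "balanced G \<phi> \<longleftrightarrow>
    (\<forall>x\<in>carrier M. \<forall>y\<in>carrier N. \<phi> x y \<in> carrier G) \<and>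
    (\<forall>x\<in>carrier M. \<forall>x'\<in>carrier M. \<forall>y\<in>carrier N. \<phi> (x \<oplus>\<^bsub>M\<^esub> x') y = \<phi> x y \<oplus>\<^bsub>G\<^esub> \<phi> x' y) \<and>
    (\<forall>x\<in>carrier M. \<forall>y\<in>carrier N. \<forall>y'\<in>carrier N. \<phi> x (y \<oplus>\<^bsub>N\<^esub> y') = \<phi> x y \<oplus>\<^bsub>G\<^esub> \<phi> x y') \<and>
    (\<forall>x\<in>carrier M. \<forall>r\<in>carrier R. \<forall>y\<in>carrier N. \<phi> (act x r) y = \<phi> x (r \<odot>\<^bsub>N\<^esub> y))"

lemma balancedI:
  assumes "\<And>x y. \<lbrakk>x \<in> carrier M; y \<in> carrier N\<rbrakk> \<Longrightarrow> \<phi> x y \<in> carrier G"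
    and "\<And>x x' y. \<lbrakk>x \<in> carrier M; x' \<in> carrier M; y \<in> carrier N\<rbrakk> \<Longrightarrow> \<phi> (x \<oplus>\<^bsub>M\<^esub> x') y = \<phi> x y \<oplus>\<^bsub>G\<^esub> \<phi> x' y"
    and "\<And>x y y'. \<lbrakk>x \<in> carrier M; y \<in> carrier N; y' \<in> carrier N\<rbrakk> \<Longrightarrow> \<phi> x (y \<oplus>\<^bsub>N\<^esub> y') = \<phi> x y \<oplus>\<^bsub>G\<^esub> \<phi> x y'"
    and "\<And>x r y. \<lbrakk>x \<in> carrier M; r \<in> carrier R; y \<in> carrier N\<rbrakk> \<Longrightarrow> \<phi> (act x r) y = \<phi> x (r \<odot>\<^bsub>N\<^esub> y)"
  shows "balanced G \<phi>"
  using assms by (auto simp: balanced_def)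

lemma frag_closed: "\<lbrakk>x \<in> carrier M; y \<in> carrier N\<rbrakk> \<Longrightarrow> frag_of (x, y) \<in> carrier FG"
  by simp

lemma FG_add: "\<lbrakk>c \<in> carrier FG; d \<in> carrier FG\<rbrakk> \<Longrightarrow> c + d \<in> carrier FG"
  using keys_add[of c d] by auto

lemma FG_diff: "\<lbrakk>c \<in> carrier FG; d \<in> carrier FG\<rbrakk> \<Longrightarrow> c - d \<in> carrier FG"
  using keys_diff[of c d] by auto

lemma relations_subset: "tensor_relations R M act N \<subseteq> carrier FG"
proof -
  interpret M: abelian_group M by (rule M_abelian)
  interpret N: abelian_group N by (rule N_abelian)
  show ?thesis
    unfolding tensor_relations_def
    by (auto simp del: carrier_free_Abelian_group_iff intro!: FG_diff frag_closed act_carrier smult_carrier)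
qed

lemma TK_subgroup: "subgroup TK FG"
  unfolding tensor_kernel_def
  by (intro group.generate_is_subgroup group_free_Abelian_group relations_subset)

lemma TK_normal: "TK \<lhd> FG"
  using TK_subgroup comm_group.normal_iff_subgroup[OF abelian_free_Abelian_group] by blast

lemma carrier_T: "carrier T = (\<lambda>c. TK #>\<^bsub>FG\<^esub> c) ` carrier FG"
  by (simp add: tensor_group_def Let_def carrier_FactGroup)

lemma zero_T: "\<zero>\<^bsub>T\<^esub> = TK #>\<^bsub>FG\<^esub> 0"
  using group.coset_mult_one[OF group_free_Abelian_group, of TK] TK_subgroup
  by (simp add: tensor_group_def Let_def subgroup_def)

lemma add_T: "\<lbrakk>c \<in> carrier FG; d \<in> carrier FG\<rbrakk> \<Longrightarrow>
    (TK #>\<^bsub>FG\<^esub> c) \<oplus>\<^bsub>T\<^esub> (TK #>\<^bsub>FG\<^esub> d) = TK #>\<^bsub>FG\<^esub> (c + d)"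
  using normal.rcos_sum[OF TK_normal, of c d] by (simp add: tensor_group_def Let_def)

lemma tensor_abelian: "abelian_group T"
proof -
  have "comm_group (FG Mod TK)"
    by (rule comm_group.abelian_FactGroup[OF abelian_free_Abelian_group TK_subgroup])
  then interpret Q: comm_group "FG Mod TK" .
  show ?thesis
  proof (rule abelian_groupI)
    fix x assume "x \<in> carrier T"
    then have "x \<in> carrier (FG Mod TK)" by (simp add: tensor_group_def Let_def)
    then show "\<exists>y\<in>carrier T. y \<oplus>\<^bsub>T\<^esub> x = \<zero>\<^bsub>T\<^esub>"
      using Q.l_inv_ex by (simp add: tensor_group_def Let_def)
  qed (use Q.m_assoc Q.m_comm Q.m_closed Q.l_one Q.one_closed in \<open>simp_all add: tensor_group_def Let_def\<close>)
qed

lemma coset_eqI: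
  assumes "c \<in> carrier FG" "d \<in> carrier FG" "c - d \<in> TK"
  shows "TK #>\<^bsub>FG\<^esub> c = TK #>\<^bsub>FG\<^esub> d"
proof -
  have "c \<in> TK #>\<^bsub>FG\<^esub> d"
    using assms(3) unfolding r_coset_def by force
  then show ?thesis
    using group.repr_independence[OF group_free_Abelian_group _ assms(2) TK_subgroup] by metis
qed

lemma rel_in_TK: "x \<in> tensor_relations R M act N \<Longrightarrow> x \<in> TK"
  unfolding tensor_kernel_def by (rule generate.incl)

lemma pure_closed: "\<lbrakk>x \<in> carrier M; y \<in> carrier N\<rbrakk> \<Longrightarrow> pt x y \<in> carrier T"
  unfolding pure_tensor_def carrier_T by (intro imageI frag_closed)

lemma pure_balanced: "balanced T pt"
proof (rule balancedI)
  interpret M: abelian_group M by (rule M_abelian)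
  interpret N: abelian_group N by (rule N_abelian)
  show "pt (x \<oplus>\<^bsub>M\<^esub> x') y = pt x y \<oplus>\<^bsub>T\<^esub> pt x' y"
    if "x \<in> carrier M" "x' \<in> carrier M" "y \<in> carrier N" for x x' y
  proof -
    have "frag_of (x \<oplus>\<^bsub>M\<^esub> x', y) - (frag_of (x, y) + frag_of (x', y)) \<in> TK"
      by (rule rel_in_TK) (use that in \<open>unfold tensor_relations_def diff_diff_eq[symmetric], blast\<close>)
    then show ?thesis
      unfolding pure_tensor_def using that
      by (subst add_T) (simp_all del: carrier_free_Abelian_group_iff
          add: frag_closed coset_eqI FG_add)
  qed
  show "pt x (y \<oplus>\<^bsub>N\<^esub> y') = pt x y \<oplus>\<^bsub>T\<^esub> pt x y'"
    if "x \<in> carrier M" "y \<in> carrier N" "y' \<in> carrier N" for x y y'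
  proof -
    have "frag_of (x, y \<oplus>\<^bsub>N\<^esub> y') - (frag_of (x, y) + frag_of (x, y')) \<in> TK"
      by (rule rel_in_TK) (use that in \<open>unfold tensor_relations_def diff_diff_eq[symmetric], blast\<close>)
    then show ?thesis
      unfolding pure_tensor_def using that
      by (subst add_T) (simp_all del: carrier_free_Abelian_group_iff
          add: frag_closed coset_eqI FG_add)
  qed
  show "pt (act x r) y = pt x (r \<odot>\<^bsub>N\<^esub> y)"
    if "x \<in> carrier M" "r \<in> carrier R" "y \<in> carrier N" for x r y
  proof -
    have "frag_of (act x r, y) - frag_of (x, r \<odot>\<^bsub>N\<^esub> y) \<in> TK"
      by (rule rel_in_TK) (use that in \<open>unfold tensor_relations_def, blast\<close>)
    then show ?thesis
      unfolding pure_tensor_def using that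
      by (simp del: carrier_free_Abelian_group_iff add: frag_closed coset_eqI act_carrier smult_carrier)
  qed
qed (rule pure_closed)

text \<open>
  A formal combination may have negative coefficients, but \<open>- (x \<otimes> y) = (- x) \<otimes> y\<close>, so sums of pure
  tensors already exhaust the tensor product.  The induction on formal combinations, which is stated with
  differences, therefore carries the claim for a coset and for its negative together.
\<close>

lemma tensor_induct [consumes 1, case_names zero pure add]:
  assumes t: "t \<in> carrier T"
    and zero: "Q \<zero>\<^bsub>T\<^esub>"
    and pure: "\<And>x y. \<lbrakk>x \<in> carrier M; y \<in> carrier N\<rbrakk> \<Longrightarrow> Q (pt x y)"
    and add: "\<And>s u. \<lbrakk>s \<in> carrier T; u \<in> carrier T; Q s; Q u\<rbrakk> \<Longrightarrow> Q (s \<oplus>\<^bsub>T\<^esub> u)"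
  shows "Q t"
proof -
  interpret M: abelian_group M by (rule M_abelian)
  interpret N: abelian_group N by (rule N_abelian)
  interpret T: abelian_group T by (rule tensor_abelian)
  have neg: "TK #>\<^bsub>FG\<^esub> (- frag_of (x, y)) = pt (\<ominus>\<^bsub>M\<^esub> x) y"
    if xy: "x \<in> carrier M" "y \<in> carrier N" for x y
  proof -
    have "pt (\<ominus>\<^bsub>M\<^esub> x) y \<oplus>\<^bsub>T\<^esub> pt x y = pt \<zero>\<^bsub>M\<^esub> y"
      using pure_balanced xy unfolding balanced_def by (metis M.a_inv_closed M.l_neg)
    also have "pt \<zero>\<^bsub>M\<^esub> y = \<zero>\<^bsub>T\<^esub>"
      using pure_balanced xy unfolding balanced_def
      by (metis M.l_zero M.zero_closed T.add_idem_zero)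
    finally have 1: "pt (\<ominus>\<^bsub>M\<^esub> x) y \<oplus>\<^bsub>T\<^esub> pt x y = \<zero>\<^bsub>T\<^esub>" .
    have "(TK #>\<^bsub>FG\<^esub> (- frag_of (x, y))) \<oplus>\<^bsub>T\<^esub> pt x y = \<zero>\<^bsub>T\<^esub>"
      using xy unfolding pure_tensor_def zero_T by (subst add_T) simp_all
    moreover have "TK #>\<^bsub>FG\<^esub> (- frag_of (x, y)) \<in> carrier T"
      using xy unfolding carrier_T by (intro imageI) simp
    ultimately show ?thesis using 1 xy
      by (metis M.a_inv_closed T.add.inv_equality pure_closed)
  qed
  from t obtain c where c: "c \<in> carrier FG" and tc: "t = TK #>\<^bsub>FG\<^esub> c" by (auto simp: carrier_T)
  have "Q (TK #>\<^bsub>FG\<^esub> c) \<and> Q (TK #>\<^bsub>FG\<^esub> (- c))"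
  proof (rule free_Abelian_group_induct[OF c[unfolded carrier_free_Abelian_group_iff]], goal_cases)
    case 1 then show ?case using zero by (simp add: zero_T)
  next
    case (2 x y)
    have m: "- x \<in> carrier FG" "- y \<in> carrier FG" "x \<in> carrier FG" "y \<in> carrier FG" using 2 by auto
    have "Q ((TK #>\<^bsub>FG\<^esub> x) \<oplus>\<^bsub>T\<^esub> (TK #>\<^bsub>FG\<^esub> (-y)))" "Q ((TK #>\<^bsub>FG\<^esub> (-x)) \<oplus>\<^bsub>T\<^esub> (TK #>\<^bsub>FG\<^esub> y))"
      using 2 m by (auto intro!: add simp: carrier_T simp del: carrier_free_Abelian_group_iff)
    then show ?case using m by (simp add: add_T)
  next
    case (3 a)
    then show ?case by (cases a) (use pure in \<open>auto simp: neg\<close>, simp add: pure_tensor_def)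
  qed
  then show ?thesis by (simp add: tc)
qed

text \<open>
  The sum inside \<open>tensor_lift\<close>: the extension of \<open>\<phi>\<close> to the free abelian group on pairs.
\<close>

definition evaluate :: "('g, 'k) ring_scheme \<Rightarrow> ('m \<Rightarrow> 'n \<Rightarrow> 'g) \<Rightarrow> ('m \<times> 'n \<Rightarrow>\<^sub>0 int) \<Rightarrow> 'g"
  where "evaluate G \<phi> c = (\<Oplus>\<^bsub>G\<^esub>p\<in>Poly_Mapping.keys c. [Poly_Mapping.lookup c p] \<cdot>\<^bsub>G\<^esub> \<phi> (fst p) (snd p))"

lemma evaluate_hom:
  assumes G: "abelian_group G" and \<phi>: "\<And>x y. \<lbrakk>x \<in> carrier M; y \<in> carrier N\<rbrakk> \<Longrightarrow> \<phi> x y \<in> carrier G"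
  shows "evaluate G \<phi> \<in> hom FG (add_monoid G)"
proof (rule homI)
  interpret G: abelian_group G by fact
  have fc: "[k] \<cdot>\<^bsub>G\<^esub> \<phi> (fst p) (snd p) \<in> carrier G" if "p \<in> carrier M \<times> carrier N" for p and k :: int
    using that \<phi> by (intro G.add.int_pow_closed) auto
  show "evaluate G \<phi> c \<in> carrier (add_monoid G)" if "c \<in> carrier FG" for c
    using that by (auto simp: evaluate_def intro!: G.finsum_closed fc)
  have sup: "evaluate G \<phi> c = (\<Oplus>\<^bsub>G\<^esub>p\<in>K. [Poly_Mapping.lookup c p] \<cdot>\<^bsub>G\<^esub> \<phi> (fst p) (snd p))"
    if "Poly_Mapping.keys c \<subseteq> K" "finite K" "K \<subseteq> carrier M \<times> carrier N" for c K
    unfolding evaluate_def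
    by (rule G.add.finprod_mono_neutral_cong_left) (use that fc in \<open>auto simp: in_keys_iff add_pow_def\<close>)
  fix c d assume cd: "c \<in> carrier FG" "d \<in> carrier FG"
  \<comment> \<open>Cancellation can make the support of a sum smaller than the union of the supports, so all three sums
    are extended by zero to this common index set.\<close>
  define K where "K = Poly_Mapping.keys c \<union> Poly_Mapping.keys d"
  have K: "finite K" "Poly_Mapping.keys c \<subseteq> K" "Poly_Mapping.keys d \<subseteq> K" "Poly_Mapping.keys (c + d) \<subseteq> K" "K \<subseteq> carrier M \<times> carrier N"
    using cd keys_add[of c d] by (auto simp: K_def)
  have "evaluate G \<phi> (c + d) = (\<Oplus>\<^bsub>G\<^esub>p\<in>K. [Poly_Mapping.lookup c p] \<cdot>\<^bsub>G\<^esub> \<phi> (fst p) (snd p) \<oplus>\<^bsub>G\<^esub>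
      [Poly_Mapping.lookup d p] \<cdot>\<^bsub>G\<^esub> \<phi> (fst p) (snd p))"
    unfolding sup[OF K(4,1,5)]
    by (rule G.finsum_cong) (use K fc \<phi> in \<open>auto simp: lookup_add simp_implies_def intro!: G.add.int_pow_mult\<close>)
  also have "\<dots> = evaluate G \<phi> c \<oplus>\<^bsub>G\<^esub> evaluate G \<phi> d"
    unfolding sup[OF K(2,1,5)] sup[OF K(3,1,5)]
    by (rule G.finsum_addf) (use K fc in auto)
  finally show "evaluate G \<phi> (c \<otimes>\<^bsub>FG\<^esub> d) = evaluate G \<phi> c \<otimes>\<^bsub>add_monoid G\<^esub> evaluate G \<phi> d" by simp
qed

lemma evaluate_frag:
  assumes G: "abelian_group G" and "\<phi> x y \<in> carrier G"
  shows "evaluate G \<phi> (frag_of (x, y)) = \<phi> x y"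
proof -
  interpret G: abelian_group G by fact
  show ?thesis using assms(2) by (simp add: evaluate_def G.finsum_insert)
qed

text \<open>
  The kernel is generated by the defining relations of the tensor product, and a balanced map turns each of
  them into a true equation.  This makes \<open>evaluate\<close> constant on cosets, so that the image taken by
  \<open>tensor_lift\<close> is a singleton.
\<close>

lemma evaluate_kernel:
  assumes G: "abelian_group G" and \<phi>: "balanced G \<phi>" and k: "k \<in> TK"
  shows "evaluate G \<phi> k = \<zero>\<^bsub>G\<^esub>"
proof -
  interpret G: abelian_group G by fact
  interpret M: abelian_group M by (rule M_abelian)
  interpret N: abelian_group N by (rule N_abelian)
  have \<phi>c: "\<phi> x y \<in> carrier G" if "x \<in> carrier M" "y \<in> carrier N" for x y
    using \<phi> that by (auto simp: balanced_def)
  have gg: "group (add_monoid G)" by (rule G.a_group)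
  interpret h: group_hom FG "add_monoid G" "evaluate G \<phi>"
    using evaluate_hom[where \<phi>=\<phi>, OF G \<phi>c] gg by (auto simp: group_hom_def group_hom_axioms_def)
  have diff: "evaluate G \<phi> (a - b) = evaluate G \<phi> a \<ominus>\<^bsub>G\<^esub> evaluate G \<phi> b"
    if "a \<in> carrier FG" "b \<in> carrier FG" for a b
  proof -
    have "evaluate G \<phi> (a \<otimes>\<^bsub>FG\<^esub> inv\<^bsub>FG\<^esub> b) = evaluate G \<phi> a \<otimes>\<^bsub>add_monoid G\<^esub> inv\<^bsub>add_monoid G\<^esub> evaluate G \<phi> b"
      using that h.hom_mult h.hom_inv h.G.inv_closed by metis
    then show ?thesis using that by (simp add: a_minus_def a_inv_def)
  qed
  have sub: "frag_of p - frag_of q \<in> carrier FG" if "p \<in> carrier M \<times> carrier N" "q \<in> carrier M \<times> carrier N" for p q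
    using that keys_diff[of "frag_of p" "frag_of q"] by auto
  have rel: "evaluate G \<phi> x = \<zero>\<^bsub>G\<^esub>" if "x \<in> tensor_relations R M act N" for x
  proof -
    have e: "evaluate G \<phi> (frag_of (x, y)) = \<phi> x y" if "x \<in> carrier M" "y \<in> carrier N" for x y
      by (rule evaluate_frag[where \<phi>=\<phi>, OF G \<phi>c[OF that]])
    have d3: "evaluate G \<phi> (frag_of p - frag_of q - frag_of r) = evaluate G \<phi> (frag_of p) \<ominus>\<^bsub>G\<^esub> evaluate G \<phi> (frag_of q) \<ominus>\<^bsub>G\<^esub> evaluate G \<phi> (frag_of r)"
      if "p \<in> carrier M \<times> carrier N" "q \<in> carrier M \<times> carrier N" "r \<in> carrier M \<times> carrier N" for p q r
      using diff[OF sub[OF that(1,2)], of "frag_of r"] diff[of "frag_of p" "frag_of q"] that by simp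
    have d2: "evaluate G \<phi> (frag_of p - frag_of q) = evaluate G \<phi> (frag_of p) \<ominus>\<^bsub>G\<^esub> evaluate G \<phi> (frag_of q)"
      if "p \<in> carrier M \<times> carrier N" "q \<in> carrier M \<times> carrier N" for p q
      using diff[of "frag_of p" "frag_of q"] that by simp
    have z1: "a \<ominus>\<^bsub>G\<^esub> a = \<zero>\<^bsub>G\<^esub>" if "a \<in> carrier G" for a
      using that by (simp add: G.minus_eq G.r_neg)
    have z: "(a \<oplus>\<^bsub>G\<^esub> b) \<ominus>\<^bsub>G\<^esub> a \<ominus>\<^bsub>G\<^esub> b = \<zero>\<^bsub>G\<^esub>" if "a \<in> carrier G" "b \<in> carrier G" for a b
    proof -
      have "(a \<oplus>\<^bsub>G\<^esub> b) \<ominus>\<^bsub>G\<^esub> a = b"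
        using that by (simp add: G.minus_eq G.a_comm[of a b] G.a_assoc G.r_neg)
      then show ?thesis using that z1 by simp
    qed
    show ?thesis
      using that unfolding tensor_relations_def
    proof (elim UnE CollectE exE conjE, goal_cases)
      case (1 a b c)
      then show ?case using \<phi> by (simp add: d3 e z \<phi>c balanced_def)
    next
      case (2 a b c)
      then show ?case using \<phi> by (simp add: d3 e z \<phi>c balanced_def)
    next
      case (3 a b c)
      then show ?case using \<phi> by (simp add: d2 e z1 \<phi>c balanced_def act_carrier smult_carrier)
    qed
  qed
  have "tensor_relations R M act N \<subseteq> kernel FG (add_monoid G) (evaluate G \<phi>)"
    using rel relations_subset by (auto simp: kernel_def simp del: carrier_free_Abelian_group_iff)
  then have "TK \<subseteq> kernel FG (add_monoid G) (evaluate G \<phi>)"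
    unfolding tensor_kernel_def by (rule h.G.generate_subgroup_incl) (rule h.subgroup_kernel)
  then show ?thesis using k by (auto simp: kernel_def)
qed

lemma lift_coset:
  assumes G: "abelian_group G" and \<phi>: "balanced G \<phi>" and c: "c \<in> carrier FG"
  shows "tensor_lift G \<phi> (TK #>\<^bsub>FG\<^esub> c) = evaluate G \<phi> c"
proof -
  interpret G: abelian_group G by fact
  have \<phi>c: "\<phi> x y \<in> carrier G" if "x \<in> carrier M" "y \<in> carrier N" for x y
    using \<phi> that by (auto simp: balanced_def)
  have h: "evaluate G \<phi> \<in> hom FG (add_monoid G)" by (rule evaluate_hom[OF G]) (rule \<phi>c)
  have "evaluate G \<phi> d = evaluate G \<phi> c" if d: "d \<in> TK #>\<^bsub>FG\<^esub> c" for d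
  proof -
    obtain k where k: "k \<in> TK" "d = k + c" using d by (auto simp: r_coset_def)
    then have kc: "k \<in> carrier FG" using TK_subgroup subgroup.subset by blast
    have "evaluate G \<phi> (k \<otimes>\<^bsub>FG\<^esub> c) = evaluate G \<phi> k \<otimes>\<^bsub>add_monoid G\<^esub> evaluate G \<phi> c"
      by (rule hom_mult[OF h kc c])
    moreover have "evaluate G \<phi> c \<in> carrier G" using hom_in_carrier[OF h c] by simp
    ultimately show ?thesis using k evaluate_kernel[OF G \<phi> k(1)] by simp
  qed
  moreover have "c \<in> TK #>\<^bsub>FG\<^esub> c"
    using group.rcos_self[OF group_free_Abelian_group c TK_subgroup] .
  ultimately have "evaluate G \<phi> ` (TK #>\<^bsub>FG\<^esub> c) = {evaluate G \<phi> c}" by blast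
  then show ?thesis unfolding tensor_lift_def evaluate_def[symmetric] by simp
qed

lemma lift_hom:
  assumes G: "abelian_group G" and \<phi>: "balanced G \<phi>"
  shows "tensor_lift G \<phi> \<in> add_homs T G"
proof -
  have \<phi>c: "\<phi> x y \<in> carrier G" if "x \<in> carrier M" "y \<in> carrier N" for x y
    using \<phi> that by (auto simp: balanced_def)
  have h: "evaluate G \<phi> \<in> hom FG (add_monoid G)" by (rule evaluate_hom[OF G]) (rule \<phi>c)
  show ?thesis
  proof (rule add_homsI)
    fix x assume "x \<in> carrier T"
    then obtain c where "c \<in> carrier FG" "x = TK #>\<^bsub>FG\<^esub> c" unfolding carrier_T by blast
    then show "tensor_lift G \<phi> x \<in> carrier G"
      using hom_in_carrier[OF h] lift_coset[OF G \<phi>] by fastforce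
    fix y assume "y \<in> carrier T"
    then obtain d where d: "d \<in> carrier FG" "y = TK #>\<^bsub>FG\<^esub> d" unfolding carrier_T by blast
    have "evaluate G \<phi> (c \<otimes>\<^bsub>FG\<^esub> d) = evaluate G \<phi> c \<otimes>\<^bsub>add_monoid G\<^esub> evaluate G \<phi> d"
      using hom_mult[OF h] \<open>c \<in> carrier FG\<close> d by blast
    then show "tensor_lift G \<phi> (x \<oplus>\<^bsub>T\<^esub> y) = tensor_lift G \<phi> x \<oplus>\<^bsub>G\<^esub> tensor_lift G \<phi> y"
      using \<open>c \<in> carrier FG\<close> \<open>x = TK #>\<^bsub>FG\<^esub> c\<close> d FG_add[of c d]
      by (simp add: add_T lift_coset[OF G \<phi>] del: carrier_free_Abelian_group_iff)
  qed
qed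

lemma lift_pure:
  assumes G: "abelian_group G" and \<phi>: "balanced G \<phi>" and "x \<in> carrier M" "y \<in> carrier N"
  shows "tensor_lift G \<phi> (pt x y) = \<phi> x y"
proof -
  have "\<phi> x y \<in> carrier G" using assms by (auto simp: balanced_def)
  then show ?thesis
    unfolding pure_tensor_def using assms
    by (simp add: lift_coset evaluate_frag[where \<phi>=\<phi>])
qed

end

section \<open>Left modules\<close>

lemma module_homs_add_homs: "h \<in> module_homs R M N \<Longrightarrow> h \<in> add_homs M N"
  by (auto simp: module_homs_def add_homs_def)

lemma module_homsI:
  assumes "\<And>x. x \<in> carrier M \<Longrightarrow> h x \<in> carrier N"
    and "\<And>x y. \<lbrakk>x \<in> carrier M; y \<in> carrier M\<rbrakk> \<Longrightarrow> h (x \<oplus>\<^bsub>M\<^esub> y) = h x \<oplus>\<^bsub>N\<^esub> h y"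
    and "\<And>r x. \<lbrakk>r \<in> carrier R; x \<in> carrier M\<rbrakk> \<Longrightarrow> h (r \<odot>\<^bsub>M\<^esub> x) = r \<odot>\<^bsub>N\<^esub> h x"
  shows "h \<in> module_homs R M N"
  using assms by (auto simp: module_homs_def)

lemma module_homs_closed: "\<lbrakk>h \<in> module_homs R M N; x \<in> carrier M\<rbrakk> \<Longrightarrow> h x \<in> carrier N"
  by (auto simp: module_homs_def)

lemma module_homs_add:
  "\<lbrakk>h \<in> module_homs R M N; x \<in> carrier M; y \<in> carrier M\<rbrakk> \<Longrightarrow> h (x \<oplus>\<^bsub>M\<^esub> y) = h x \<oplus>\<^bsub>N\<^esub> h y"
  by (auto simp: module_homs_def)

lemma module_homs_smult:
  "\<lbrakk>h \<in> module_homs R M N; r \<in> carrier R; x \<in> carrier M\<rbrakk> \<Longrightarrow> h (r \<odot>\<^bsub>M\<^esub> x) = r \<odot>\<^bsub>N\<^esub> h x"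
  by (auto simp: module_homs_def)

lemma module_homs_id: "(\<lambda>x. x) \<in> module_homs R M M"
  by (auto simp: module_homs_def)

lemma module_homs_comp:
  "\<lbrakk>h \<in> module_homs R M N; k \<in> module_homs R N L\<rbrakk> \<Longrightarrow> (\<lambda>x. k (h x)) \<in> module_homs R M L"
  by (auto simp: module_homs_def Pi_iff)

lemma left_module_abelian: "left_module R M \<Longrightarrow> abelian_group M"
  by (simp add: left_module_def)

lemma module_isomorphicI:
  assumes "left_module R M" "left_module R N" "h \<in> module_homs R M N" "k \<in> module_homs R N M"
    and "\<And>x. x \<in> carrier M \<Longrightarrow> k (h x) = x" "\<And>y. y \<in> carrier N \<Longrightarrow> h (k y) = y"
  shows "module_isomorphic R M N"
proof -
  have "bij_betw h (carrier M) (carrier N)"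
    by (rule bij_betw_byWitness[of _ k])
      (use assms(5,6) module_homs_closed[OF assms(3)] module_homs_closed[OF assms(4)] in auto)
  then show ?thesis using assms unfolding module_isomorphic_def by blast
qed

lemma module_homs_inv_into:
  assumes M: "left_module R M" and h: "h \<in> module_homs R M N" and bij: "bij_betw h (carrier M) (carrier N)"
  shows "inv_into (carrier M) h \<in> module_homs R N M"
proof -
  interpret M: left_module R M by (rule M)
  let ?k = "inv_into (carrier M) h"
  have kh: "?k (h x) = x" if "x \<in> carrier M" for x
    using bij that by (simp add: bij_betw_inv_into_left)
  have hk: "h (?k y) = y" if "y \<in> carrier N" for y
    using bij that by (simp add: bij_betw_inv_into_right)
  have kc: "?k y \<in> carrier M" if "y \<in> carrier N" for y
    using bij that by (metis bij_betw_def inv_into_into)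
  show ?thesis
  proof (rule module_homsI)
    fix x y assume xy: "x \<in> carrier N" "y \<in> carrier N"
    have "?k (h (?k x \<oplus>\<^bsub>M\<^esub> ?k y)) = ?k (x \<oplus>\<^bsub>N\<^esub> y)"
      using xy by (simp add: module_homs_add[OF h] hk kc)
    then show "?k (x \<oplus>\<^bsub>N\<^esub> y) = ?k x \<oplus>\<^bsub>M\<^esub> ?k y" using xy by (simp add: kh kc)
  next
    fix r x assume rx: "r \<in> carrier R" "x \<in> carrier N"
    have "?k (h (r \<odot>\<^bsub>M\<^esub> ?k x)) = ?k (r \<odot>\<^bsub>N\<^esub> x)"
      using rx by (simp add: module_homs_smult[OF h] hk kc)
    then show "?k (r \<odot>\<^bsub>N\<^esub> x) = r \<odot>\<^bsub>M\<^esub> ?k x" using rx by (simp add: kh kc M.lsmult_closed)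
  qed (rule kc)
qed

lemma module_isomorphicE:
  assumes "module_isomorphic R M N"
  obtains h k where "left_module R M" "left_module R N" "h \<in> module_homs R M N" "k \<in> module_homs R N M"
    "\<And>x. x \<in> carrier M \<Longrightarrow> k (h x) = x" "\<And>y. y \<in> carrier N \<Longrightarrow> h (k y) = y"
proof -
  from assms obtain h where M: "left_module R M" and N: "left_module R N"
    and h: "h \<in> module_homs R M N" "bij_betw h (carrier M) (carrier N)"
    unfolding module_isomorphic_def by blast
  from that[OF M N h(1) module_homs_inv_into[OF M h] bij_betw_inv_into_left[OF h(2)] bij_betw_inv_into_right[OF h(2)]]
  show thesis by simp
qed

lemma module_isomorphic_refl: "left_module R M \<Longrightarrow> module_isomorphic R M M"
  by (rule module_isomorphicI[where h="\<lambda>x. x" and k="\<lambda>x. x"]) (auto intro: module_homs_id)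

lemma module_isomorphic_sym: "module_isomorphic R M N \<Longrightarrow> module_isomorphic R N M"
  by (elim module_isomorphicE) (rule module_isomorphicI; assumption)

lemma module_isomorphic_trans:
  assumes "module_isomorphic R M N" "module_isomorphic R N L"
  shows "module_isomorphic R M L"
proof -
  obtain h k where 1: "left_module R M" "h \<in> module_homs R M N" "k \<in> module_homs R N M"
    "\<And>x. x \<in> carrier M \<Longrightarrow> k (h x) = x" "\<And>y. y \<in> carrier N \<Longrightarrow> h (k y) = y"
    by (rule module_isomorphicE[OF assms(1)]) blast
  obtain h' k' where 2: "left_module R L" "h' \<in> module_homs R N L" "k' \<in> module_homs R L N"
    "\<And>x. x \<in> carrier N \<Longrightarrow> k' (h' x) = x" "\<And>y. y \<in> carrier L \<Longrightarrow> h' (k' y) = y"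
    by (rule module_isomorphicE[OF assms(2)]) blast
  show ?thesis
    by (rule module_isomorphicI[OF 1(1) 2(1) module_homs_comp[OF 1(2) 2(2)] module_homs_comp[OF 2(3) 1(3)]])
      (simp_all add: 1 2 module_homs_closed[OF 1(2)] module_homs_closed[OF 2(3)])
qed

lemma regular_module_simps [simp]:
  "carrier (regular_module R) = carrier R" "add (regular_module R) = add R"
  "zero (regular_module R) = zero R" "smult (regular_module R) = monoid.mult R"
  by (simp_all add: regular_module_def)

lemma left_module_regular:
  assumes "ring R" shows "left_module R (regular_module R)"
proof -
  interpret R: ring R by fact
  have "abelian_group (regular_module R)"
  proof (rule abelian_groupI)
    fix x assume "x \<in> carrier (regular_module R)"
    then show "\<exists>y\<in>carrier (regular_module R). y \<oplus>\<^bsub>regular_module R\<^esub> x = \<zero>\<^bsub>regular_module R\<^esub>"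
      by (intro bexI[of _ "\<ominus>\<^bsub>R\<^esub> x"]) (simp_all add: R.l_neg)
  qed (simp_all add: R.a_ac)
  then show ?thesis
    by (intro left_module.intro left_module_axioms.intro R.ring_axioms)
      (simp_all add: R.l_distr R.r_distr R.m_assoc)
qed

context left_module begin

lemma smult_hom: "r \<in> carrier R \<Longrightarrow> (\<lambda>x. r \<odot>\<^bsub>M\<^esub> x) \<in> add_homs M M"
  by (rule add_homsI) (auto simp: lsmult_closed lsmult_r_distr)

lemma smult_zero_right: "r \<in> carrier R \<Longrightarrow> r \<odot>\<^bsub>M\<^esub> \<zero>\<^bsub>M\<^esub> = \<zero>\<^bsub>M\<^esub>"
  using add_homs_zero[OF M.abelian_group_axioms M.abelian_group_axioms smult_hom] by simp

lemma smult_finsum: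
  "\<lbrakk>r \<in> carrier R; finite I; \<And>i. i \<in> I \<Longrightarrow> g i \<in> carrier M\<rbrakk> \<Longrightarrow>
    r \<odot>\<^bsub>M\<^esub> (\<Oplus>\<^bsub>M\<^esub>i\<in>I. g i) = (\<Oplus>\<^bsub>M\<^esub>i\<in>I. r \<odot>\<^bsub>M\<^esub> g i)"
  by (rule add_homs_finsum[OF M.abelian_group_axioms M.abelian_group_axioms smult_hom])

lemma smult_left_zero: "x \<in> carrier M \<Longrightarrow> \<zero> \<odot>\<^bsub>M\<^esub> x = \<zero>\<^bsub>M\<^esub>"
proof -
  assume x: "x \<in> carrier M"
  have "\<zero> \<odot>\<^bsub>M\<^esub> x \<oplus>\<^bsub>M\<^esub> \<zero> \<odot>\<^bsub>M\<^esub> x = \<zero> \<odot>\<^bsub>M\<^esub> x"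
    using lsmult_l_distr[of \<zero> \<zero> x] x by simp
  then show ?thesis by (rule M.add_idem_zero[rotated]) (simp add: lsmult_closed x)
qed

end

lemma module_homs_zero:
  "\<lbrakk>left_module R M; left_module R N; h \<in> module_homs R M N\<rbrakk> \<Longrightarrow> h \<zero>\<^bsub>M\<^esub> = \<zero>\<^bsub>N\<^esub>"
  by (rule add_homs_zero[OF left_module_abelian left_module_abelian module_homs_add_homs])

lemma module_homs_finsum:
  assumes "left_module R M" "left_module R N" "h \<in> module_homs R M N" "finite I"
    and "\<And>i. i \<in> I \<Longrightarrow> g i \<in> carrier M"
  shows "h (\<Oplus>\<^bsub>M\<^esub>i\<in>I. g i) = (\<Oplus>\<^bsub>N\<^esub>i\<in>I. h (g i))"
  by (rule add_homs_finsum[OF left_module_abelian[OF assms(1)] left_module_abelian[OF assms(2)]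
        module_homs_add_homs[OF assms(3)] assms(4,5)])

lemma module_homs_sum:
  assumes N: "left_module R N" and "finite I" and g: "\<And>i. i \<in> I \<Longrightarrow> g i \<in> module_homs R M N"
  shows "(\<lambda>x. \<Oplus>\<^bsub>N\<^esub>i\<in>I. g i x) \<in> module_homs R M N"
proof -
  interpret N: left_module R N by (rule N)
  note cl = module_homs_closed[OF g]
  show ?thesis
  proof (rule module_homsI)
    fix x y assume xy: "x \<in> carrier M" "y \<in> carrier M"
    have "(\<Oplus>\<^bsub>N\<^esub>i\<in>I. g i (x \<oplus>\<^bsub>M\<^esub> y)) = (\<Oplus>\<^bsub>N\<^esub>i\<in>I. g i x \<oplus>\<^bsub>N\<^esub> g i y)"
      by (rule N.finsum_cong') (use xy cl in \<open>auto simp: module_homs_add[OF g]\<close>)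
    also have "\<dots> = (\<Oplus>\<^bsub>N\<^esub>i\<in>I. g i x) \<oplus>\<^bsub>N\<^esub> (\<Oplus>\<^bsub>N\<^esub>i\<in>I. g i y)"
      by (rule N.finsum_addf) (use xy cl in auto)
    finally show "(\<Oplus>\<^bsub>N\<^esub>i\<in>I. g i (x \<oplus>\<^bsub>M\<^esub> y)) = (\<Oplus>\<^bsub>N\<^esub>i\<in>I. g i x) \<oplus>\<^bsub>N\<^esub> (\<Oplus>\<^bsub>N\<^esub>i\<in>I. g i y)" .
  next
    fix r x assume rx: "r \<in> carrier R" "x \<in> carrier M"
    have "(\<Oplus>\<^bsub>N\<^esub>i\<in>I. g i (r \<odot>\<^bsub>M\<^esub> x)) = (\<Oplus>\<^bsub>N\<^esub>i\<in>I. r \<odot>\<^bsub>N\<^esub> g i x)"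
      by (rule N.finsum_cong') (use rx cl in \<open>auto simp: module_homs_smult[OF g] N.lsmult_closed\<close>)
    also have "\<dots> = r \<odot>\<^bsub>N\<^esub> (\<Oplus>\<^bsub>N\<^esub>i\<in>I. g i x)"
      by (rule N.smult_finsum[symmetric]) (use rx cl assms(2) in auto)
    finally show "(\<Oplus>\<^bsub>N\<^esub>i\<in>I. g i (r \<odot>\<^bsub>M\<^esub> x)) = r \<odot>\<^bsub>N\<^esub> (\<Oplus>\<^bsub>N\<^esub>i\<in>I. g i x)" .
  qed (use cl in \<open>auto intro!: N.finsum_closed\<close>)
qed

lemma module_homs_coefficient:
  assumes N: "left_module R N" and y: "y \<in> carrier N" and \<kappa>: "\<kappa> \<in> module_homs R M (regular_module R)"
  shows "(\<lambda>x. \<kappa> x \<odot>\<^bsub>N\<^esub> y) \<in> module_homs R M N"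
proof -
  interpret N: left_module R N by (rule N)
  show ?thesis
    by (rule module_homsI) (use y module_homs_closed[OF \<kappa>] in \<open>simp_all add: module_homs_add[OF \<kappa>]
      module_homs_smult[OF \<kappa>] N.lsmult_closed N.lsmult_l_distr N.lsmult_assoc\<close>)
qed

lemma module_homs_coefficient_sum:
  assumes "left_module R N" "finite I" "\<And>i. i \<in> I \<Longrightarrow> y i \<in> carrier N"
    "\<And>i. i \<in> I \<Longrightarrow> \<kappa> i \<in> module_homs R M (regular_module R)"
  shows "(\<lambda>x. \<Oplus>\<^bsub>N\<^esub>i\<in>I. \<kappa> i x \<odot>\<^bsub>N\<^esub> y i) \<in> module_homs R M N"
  by (rule module_homs_sum[OF assms(1,2)]) (rule module_homs_coefficient[OF assms(1,3,4)])

section \<open>Finitely generated projective modules and dual bases\<close>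

text \<open>
  The elements are indexed by numbers rather than collected in a set: images of a dual basis under a
  retraction may coincide, and they still form a dual basis in the indexed sense.
\<close>

definition dual_basis ::
  "('r, 'c) ring_scheme \<Rightarrow> ('r, 'p, 'e) module_scheme \<Rightarrow> nat \<Rightarrow> (nat \<Rightarrow> 'p) \<Rightarrow> (nat \<Rightarrow> 'p \<Rightarrow> 'r) \<Rightarrow> bool"
  where "dual_basis R P n e \<kappa> \<longleftrightarrow>
    (\<forall>k<n. e k \<in> carrier P \<and> \<kappa> k \<in> module_homs R P (regular_module R)) \<and>
    (\<forall>p\<in>carrier P. p = (\<Oplus>\<^bsub>P\<^esub>k\<in>{..<n}. \<kappa> k p \<odot>\<^bsub>P\<^esub> e k))"

lemma dual_basisD:
  assumes "dual_basis R P n e \<kappa>"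
  shows "k < n \<Longrightarrow> e k \<in> carrier P" "k < n \<Longrightarrow> \<kappa> k \<in> module_homs R P (regular_module R)"
    "\<lbrakk>k < n; p \<in> carrier P\<rbrakk> \<Longrightarrow> \<kappa> k p \<in> carrier R"
    "p \<in> carrier P \<Longrightarrow> (\<Oplus>\<^bsub>P\<^esub>k\<in>{..<n}. \<kappa> k p \<odot>\<^bsub>P\<^esub> e k) = p"
proof -
  show 1: "k < n \<Longrightarrow> \<kappa> k \<in> module_homs R P (regular_module R)"
    using assms by (simp add: dual_basis_def)
  show "k < n \<Longrightarrow> e k \<in> carrier P" using assms by (simp add: dual_basis_def)
  show "\<lbrakk>k < n; p \<in> carrier P\<rbrakk> \<Longrightarrow> \<kappa> k p \<in> carrier R" using module_homs_closed[OF 1] by simp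
  show "p \<in> carrier P \<Longrightarrow> (\<Oplus>\<^bsub>P\<^esub>k\<in>{..<n}. \<kappa> k p \<odot>\<^bsub>P\<^esub> e k) = p"
    using assms unfolding dual_basis_def by metis
qed

text \<open>
  A retract of a module with a dual basis has one: apply the expansion to \<open>k y\<close> and push it back with \<open>h\<close>.
\<close>

lemma dual_basis_transfer:
  assumes P: "left_module R P" and Q: "left_module R Q" and db: "dual_basis R P n e \<kappa>"
    and h: "h \<in> module_homs R P Q" and k: "k \<in> module_homs R Q P"
    and hk: "\<And>y. y \<in> carrier Q \<Longrightarrow> h (k y) = y"
  shows "dual_basis R Q n (\<lambda>i. h (e i)) (\<lambda>i y. \<kappa> i (k y))"
proof -
  interpret P: left_module R P by (rule P)
  interpret Q: left_module R Q by (rule Q)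
  have "y = (\<Oplus>\<^bsub>Q\<^esub>i\<in>{..<n}. \<kappa> i (k y) \<odot>\<^bsub>Q\<^esub> h (e i))" if y: "y \<in> carrier Q" for y
  proof -
    have ky: "k y \<in> carrier P" using module_homs_closed[OF k y] .
    have "y = h (\<Oplus>\<^bsub>P\<^esub>i\<in>{..<n}. \<kappa> i (k y) \<odot>\<^bsub>P\<^esub> e i)"
      using dual_basisD(4)[OF db ky] hk[OF y] by simp
    also have "\<dots> = (\<Oplus>\<^bsub>Q\<^esub>i\<in>{..<n}. h (\<kappa> i (k y) \<odot>\<^bsub>P\<^esub> e i))"
      by (rule module_homs_finsum[OF P Q h]) (auto simp: P.lsmult_closed dual_basisD[OF db] ky)
    also have "\<dots> = (\<Oplus>\<^bsub>Q\<^esub>i\<in>{..<n}. \<kappa> i (k y) \<odot>\<^bsub>Q\<^esub> h (e i))"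
      by (rule Q.finsum_cong')
        (auto simp: Q.lsmult_closed dual_basisD[OF db] ky module_homs_smult[OF h] module_homs_closed[OF h])
    finally show ?thesis .
  qed
  then show ?thesis
    using dual_basisD(1,2)[OF db] module_homs_closed[OF h] module_homs_comp[OF k]
    unfolding dual_basis_def by blast
qed

text \<open>
  The definition of finite generation sums over a set, so the coefficients of equal members of the family
  have to be collected.  They are added one at a time, along an initial segment of the family.
\<close>

lemma dual_basis_finitely_generated:
  fixes P :: "('r, 'p) module"
  assumes P: "left_module R P" and db: "dual_basis R P n e \<kappa>"
  shows "finitely_generated R P"
proof -
  interpret P: left_module R P by (rule P)
  define X where "X = e ` {..<n}"
  have X: "finite X" "X \<subseteq> carrier P" using dual_basisD(1)[OF db] by (auto simp: X_def)
  have "\<exists>c\<in>X \<rightarrow> carrier R. (\<Oplus>\<^bsub>P\<^esub>k\<in>{..<m}. a k \<odot>\<^bsub>P\<^esub> e k) = (\<Oplus>\<^bsub>P\<^esub>x\<in>X. c x \<odot>\<^bsub>P\<^esub> x)"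
    if "m \<le> n" "\<And>k. k < n \<Longrightarrow> a k \<in> carrier R" for m a
    using that(1)
  proof (induction m)
    case 0
    have "(\<Oplus>\<^bsub>P\<^esub>x\<in>X. \<zero>\<^bsub>R\<^esub> \<odot>\<^bsub>P\<^esub> x) = \<zero>\<^bsub>P\<^esub>"
      using X(2) by (intro P.M.add.finprod_one_eqI) (auto simp: P.smult_left_zero)
    then show ?case by (intro bexI[of _ "\<lambda>_. \<zero>\<^bsub>R\<^esub>"]) auto
  next
    case (Suc m)
    then obtain c where c: "c \<in> X \<rightarrow> carrier R"
      "(\<Oplus>\<^bsub>P\<^esub>k\<in>{..<m}. a k \<odot>\<^bsub>P\<^esub> e k) = (\<Oplus>\<^bsub>P\<^esub>x\<in>X. c x \<odot>\<^bsub>P\<^esub> x)" by auto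
    have eX: "e m \<in> X" using Suc by (auto simp: X_def)
    have am: "a m \<in> carrier R" using Suc that(2) by auto
    let ?c = "c(e m := a m \<oplus>\<^bsub>R\<^esub> c (e m))"
    have cl: "c x \<odot>\<^bsub>P\<^esub> x \<in> carrier P" if "x \<in> X" for x
      using c(1) X(2) that by (intro P.lsmult_closed) auto
    have em: "c (e m) \<in> carrier R" "e m \<in> carrier P" using c(1) eX X(2) by auto
    have X': "X = insert (e m) (X - {e m})" using eX by auto
    have "(\<Oplus>\<^bsub>P\<^esub>k\<in>{..<Suc m}. a k \<odot>\<^bsub>P\<^esub> e k) = a m \<odot>\<^bsub>P\<^esub> e m \<oplus>\<^bsub>P\<^esub> (\<Oplus>\<^bsub>P\<^esub>x\<in>X. c x \<odot>\<^bsub>P\<^esub> x)"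
      unfolding lessThan_Suc c(2)[symmetric]
      by (subst P.finsum_insert) (use Suc that(2) in \<open>auto intro!: P.lsmult_closed dual_basisD(1)[OF db]\<close>)
    also have "(\<Oplus>\<^bsub>P\<^esub>x\<in>X. c x \<odot>\<^bsub>P\<^esub> x) = c (e m) \<odot>\<^bsub>P\<^esub> e m \<oplus>\<^bsub>P\<^esub> (\<Oplus>\<^bsub>P\<^esub>x\<in>X - {e m}. c x \<odot>\<^bsub>P\<^esub> x)"
      by (subst X', subst P.finsum_insert) (use X cl eX in auto)
    also have "a m \<odot>\<^bsub>P\<^esub> e m \<oplus>\<^bsub>P\<^esub> (c (e m) \<odot>\<^bsub>P\<^esub> e m \<oplus>\<^bsub>P\<^esub> (\<Oplus>\<^bsub>P\<^esub>x\<in>X - {e m}. c x \<odot>\<^bsub>P\<^esub> x)) =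
        ?c (e m) \<odot>\<^bsub>P\<^esub> e m \<oplus>\<^bsub>P\<^esub> (\<Oplus>\<^bsub>P\<^esub>x\<in>X - {e m}. c x \<odot>\<^bsub>P\<^esub> x)"
      using am em cl
      by (simp add: P.lsmult_l_distr P.M.a_assoc P.lsmult_closed)
    also have "(\<Oplus>\<^bsub>P\<^esub>x\<in>X - {e m}. c x \<odot>\<^bsub>P\<^esub> x) = (\<Oplus>\<^bsub>P\<^esub>x\<in>X - {e m}. ?c x \<odot>\<^bsub>P\<^esub> x)"
      by (rule P.finsum_cong') (use cl in auto)
    also have "?c (e m) \<odot>\<^bsub>P\<^esub> e m \<oplus>\<^bsub>P\<^esub> (\<Oplus>\<^bsub>P\<^esub>x\<in>X - {e m}. ?c x \<odot>\<^bsub>P\<^esub> x) = (\<Oplus>\<^bsub>P\<^esub>x\<in>X. ?c x \<odot>\<^bsub>P\<^esub> x)"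
      by (subst (2) X', subst P.finsum_insert)
        (use X cl eX c(1) am in \<open>auto intro!: P.lsmult_closed\<close>)
    finally show ?case using c(1) am em by (intro bexI[of _ ?c]) (auto simp: Pi_iff)
  qed
  note combine = this[OF order_refl]
  show ?thesis
    unfolding finitely_generated_def
  proof (intro exI[of _ X] conjI ballI X)
    fix p assume p: "p \<in> carrier P"
    show "\<exists>c\<in>X \<rightarrow> carrier R. p = (\<Oplus>\<^bsub>P\<^esub>x\<in>X. c x \<odot>\<^bsub>P\<^esub> x)"
      using combine[of "\<lambda>k. \<kappa> k p"] dual_basisD(3,4)[OF db] p by simp
  qed
qed

text \<open>
  A lift of \<open>h\<close> through \<open>g\<close> may be prescribed at the elements \<open>e k\<close> by choosing preimages \<open>m k\<close> of \<open>h (e k)\<close>; the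
  coordinate functionals extend it linearly.
\<close>

lemma dual_basis_projective:
  fixes P :: "('r, 'p) module"
  assumes P: "left_module R P" and db: "dual_basis R P n e \<kappa>"
  shows "projective R P"
  unfolding projective_def
proof (intro allI impI, elim conjE)
  interpret P: left_module R P by (rule P)
  fix M :: "('r, 'p \<Rightarrow> 'r) module" and N :: "('r, 'p) module" and g h
  assume M: "left_module R M" and N: "left_module R N" and g: "g \<in> module_homs R M N"
    and surj: "g ` carrier M = carrier N" and h: "h \<in> module_homs R P N"
  interpret M: left_module R M by (rule M)
  interpret N: left_module R N by (rule N)
  have "\<exists>m. m \<in> carrier M \<and> g m = h (e k)" if "k < n" for k
    using module_homs_closed[OF h dual_basisD(1)[OF db that]] unfolding surj[symmetric] by auto
  then have "\<forall>k\<in>{..<n}. \<exists>m. m \<in> carrier M \<and> g m = h (e k)" by simp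
  from bchoice[OF this] obtain m where m: "\<And>k. k < n \<Longrightarrow> m k \<in> carrier M \<and> g (m k) = h (e k)" by auto
  let ?k = "\<lambda>p. \<Oplus>\<^bsub>M\<^esub>k\<in>{..<n}. \<kappa> k p \<odot>\<^bsub>M\<^esub> m k"
  have cl: "\<kappa> k p \<odot>\<^bsub>M\<^esub> m k \<in> carrier M" if "k < n" "p \<in> carrier P" for k p
    using that m dual_basisD[OF db] by (intro M.lsmult_closed) auto
  have "?k \<in> module_homs R P M"
    by (rule module_homs_coefficient_sum[OF M]) (use m dual_basisD(2)[OF db] in auto)
  moreover have "g (?k p) = h p" if p: "p \<in> carrier P" for p
  proof -
    have "g (?k p) = (\<Oplus>\<^bsub>N\<^esub>k\<in>{..<n}. g (\<kappa> k p \<odot>\<^bsub>M\<^esub> m k))"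
      by (rule module_homs_finsum[OF M N g]) (use p cl in auto)
    also have "\<dots> = (\<Oplus>\<^bsub>N\<^esub>k\<in>{..<n}. h (\<kappa> k p \<odot>\<^bsub>P\<^esub> e k))"
      by (rule N.finsum_cong') (use p m in \<open>auto simp: module_homs_smult[OF g] module_homs_smult[OF h]
            dual_basisD[OF db] intro!: N.lsmult_closed P.lsmult_closed module_homs_closed[OF h]\<close>)
    also have "\<dots> = h (\<Oplus>\<^bsub>P\<^esub>k\<in>{..<n}. \<kappa> k p \<odot>\<^bsub>P\<^esub> e k)"
      by (rule module_homs_finsum[OF P N h, symmetric])
        (use p in \<open>auto intro!: P.lsmult_closed dual_basisD[OF db]\<close>)
    finally show ?thesis using dual_basisD(4)[OF db p] by simp
  qed
  ultimately show "\<exists>k\<in>module_homs R P M. \<forall>p\<in>carrier P. g (k p) = h p" by (intro bexI[of _ ?k] ballI)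
qed

lemma fg_projectiveI:
  "\<lbrakk>left_module R P; dual_basis R P n e \<kappa>\<rbrakk> \<Longrightarrow> fg_projective R P"
  unfolding fg_projective_def
  by (intro conjI; (assumption | erule (1) dual_basis_finitely_generated | erule (1) dual_basis_projective))

text \<open>
  Let \<open>X\<close> be a finite generating set.  Projectivity splits the surjection onto \<open>P\<close> of the free module on
  \<open>X\<close>, and the coordinates of the splitting form the dual basis.  The free module is realised by functions
  on the type of elements of \<open>P\<close> that are extensional on \<open>X\<close>, which is the type that the lifting property
  quantifies over.
\<close>

lemma fg_projective_dual_basis:
  fixes P :: "('r, 'p) module"
  assumes "fg_projective R P"
  obtains n e \<kappa> where "dual_basis R P n e \<kappa>"
proof -
  have P: "left_module R P" using assms by (simp add: fg_projective_def)
  interpret P: left_module R P by (rule P)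
  obtain X where X: "finite X" "X \<subseteq> carrier P"
    and gen: "\<And>p. p \<in> carrier P \<Longrightarrow> \<exists>c\<in>X \<rightarrow> carrier R. p = (\<Oplus>\<^bsub>P\<^esub>x\<in>X. c x \<odot>\<^bsub>P\<^esub> x)"
    using assms unfolding fg_projective_def finitely_generated_def by blast
  define M :: "('r, 'p \<Rightarrow> 'r) module" where
    "M = \<lparr>carrier = X \<rightarrow>\<^sub>E carrier R, mult = undefined, one = undefined, zero = (\<lambda>x\<in>X. \<zero>\<^bsub>R\<^esub>),
      add = (\<lambda>u v. \<lambda>x\<in>X. u x \<oplus>\<^bsub>R\<^esub> v x), smult = (\<lambda>r u. \<lambda>x\<in>X. r \<otimes>\<^bsub>R\<^esub> u x)\<rparr>"
  have mem: "u x \<in> carrier R" if "u \<in> X \<rightarrow>\<^sub>E carrier R" "x \<in> X" for u x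
    using that by auto
  have arb: "u x = undefined" if "u \<in> X \<rightarrow>\<^sub>E carrier R" "x \<notin> X" for u x
    using that by auto
  have Mab: "abelian_group M"
  proof (rule abelian_groupI)
    fix u assume "u \<in> carrier M"
    then show "\<exists>v\<in>carrier M. v \<oplus>\<^bsub>M\<^esub> u = \<zero>\<^bsub>M\<^esub>"
      by (intro bexI[of _ "\<lambda>x\<in>X. \<ominus>\<^bsub>R\<^esub> u x"]) (auto simp: M_def P.R.l_neg mem fun_eq_iff)
  qed (auto simp: M_def P.R.a_ac mem arb fun_eq_iff)
  have M: "left_module R M"
    by (intro left_module.intro P.R.ring_axioms Mab left_module_axioms.intro)
      (auto simp: M_def P.R.l_distr P.R.r_distr P.R.m_assoc mem arb fun_eq_iff)
  interpret M: left_module R M by (rule M)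
  let ?g = "\<lambda>u. \<Oplus>\<^bsub>P\<^esub>x\<in>X. u x \<odot>\<^bsub>P\<^esub> x"
  have g: "?g \<in> module_homs R M P"
    by (rule module_homs_coefficient_sum[OF P X(1)])
      (use X in \<open>auto intro!: module_homsI simp: M_def mem\<close>)
  have surj: "?g ` carrier M = carrier P"
  proof (intro equalityI subsetI)
    fix p assume "p \<in> carrier P"
    then obtain c where c: "c \<in> X \<rightarrow> carrier R" "p = (\<Oplus>\<^bsub>P\<^esub>x\<in>X. c x \<odot>\<^bsub>P\<^esub> x)" using gen by blast
    have "?g (restrict c X) = p"
      unfolding c(2) by (rule P.finsum_cong') (use c(1) X in \<open>auto intro!: P.lsmult_closed\<close>)
    moreover have "restrict c X \<in> carrier M" using c(1) by (auto simp: M_def)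
    ultimately show "p \<in> ?g ` carrier M" by blast
  qed (use module_homs_closed[OF g] in auto)
  obtain k where k: "k \<in> module_homs R P M" "\<And>p. p \<in> carrier P \<Longrightarrow> ?g (k p) = p"
    using assms M P g surj module_homs_id[of R P] unfolding fg_projective_def projective_def by blast
  obtain b where b: "bij_betw b {..<card X} X"
    using ex_bij_betw_nat_finite[OF X(1)] by (auto simp: atLeast0LessThan)
  have bX: "b i \<in> X" if "i < card X" for i using b that by (auto simp: bij_betw_def)
  have kc: "k p x \<in> carrier R" if "p \<in> carrier P" "x \<in> X" for p x
    using module_homs_closed[OF k(1) that(1)] that(2) by (auto simp: M_def)
  have "dual_basis R P (card X) b (\<lambda>i p. k p (b i))"
    unfolding dual_basis_def
  proof (intro conjI allI impI ballI)
    fix i assume i: "i < card X"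
    show "b i \<in> carrier P" using bX[OF i] X by auto
    show "(\<lambda>p. k p (b i)) \<in> module_homs R P (regular_module R)"
      by (rule module_homsI) (use bX[OF i] in \<open>auto simp: kc module_homs_add[OF k(1)] module_homs_smult[OF k(1)], auto simp: M_def\<close>)
  next
    fix p assume p: "p \<in> carrier P"
    have "(\<Oplus>\<^bsub>P\<^esub>i\<in>{..<card X}. k p (b i) \<odot>\<^bsub>P\<^esub> b i) = (\<Oplus>\<^bsub>P\<^esub>x\<in>b ` {..<card X}. k p x \<odot>\<^bsub>P\<^esub> x)"
      by (rule P.finsum_reindex[symmetric])
        (use b X p kc bX in \<open>auto simp: bij_betw_def intro!: P.lsmult_closed\<close>)
    also have "\<dots> = p" using k(2)[OF p] b by (simp add: bij_betw_def)
    finally show "p = (\<Oplus>\<^bsub>P\<^esub>i\<in>{..<card X}. k p (b i) \<odot>\<^bsub>P\<^esub> b i)" by simp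
  qed
  then show thesis by (rule that)
qed

lemma fg_projective_isomorphic:
  fixes P :: "('r, 'p) module" and Q :: "('r, 'q) module"
  assumes "fg_projective R P" "module_isomorphic R P Q"
  shows "fg_projective R Q"
proof -
  obtain n e \<kappa> where db: "dual_basis R P n e \<kappa>" using fg_projective_dual_basis[OF assms(1)] .
  obtain h k where "left_module R P" and Q: "left_module R Q" and "h \<in> module_homs R P Q" "k \<in> module_homs R Q P"
    "\<And>x. x \<in> carrier P \<Longrightarrow> k (h x) = x" "\<And>y. y \<in> carrier Q \<Longrightarrow> h (k y) = y"
    by (rule module_isomorphicE[OF assms(2)]) blast
  from fg_projectiveI[OF Q dual_basis_transfer[OF this(1,2) db this(3,4,6)]] show ?thesis .
qed

text \<open>
  The module structure is transported along \<open>j\<close>, so only the type of the elements changes.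
\<close>

lemma isomorphic_copy:
  fixes P :: "('r, 'p) module" and j :: "'p \<Rightarrow> 'q"
  assumes P: "left_module R P" and inj: "inj_on j (carrier P)"
  shows "\<exists>Q :: ('r, 'q) module. module_isomorphic R P Q"
proof -
  interpret P: left_module R P by (rule P)
  define i where "i = inv_into (carrier P) j"
  have ij [simp]: "i (j x) = x" if "x \<in> carrier P" for x
    using inj that by (simp add: i_def)
  define Q :: "('r, 'q) module" where
    "Q = \<lparr>carrier = j ` carrier P, mult = undefined, one = undefined, zero = j \<zero>\<^bsub>P\<^esub>,
      add = (\<lambda>u v. j (i u \<oplus>\<^bsub>P\<^esub> i v)), smult = (\<lambda>r u. j (r \<odot>\<^bsub>P\<^esub> i u))\<rparr>"
  have ab: "abelian_group Q"
  proof (rule abelian_groupI)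
    fix u assume "u \<in> carrier Q"
    then show "\<exists>v\<in>carrier Q. v \<oplus>\<^bsub>Q\<^esub> u = \<zero>\<^bsub>Q\<^esub>"
      by (intro bexI[of _ "j (\<ominus>\<^bsub>P\<^esub> i u)"]) (auto simp: Q_def P.M.l_neg)
  qed (auto simp: Q_def P.M.a_ac)
  have Q: "left_module R Q"
    by (intro left_module.intro P.R.ring_axioms ab left_module_axioms.intro)
      (auto simp: Q_def P.lsmult_closed P.lsmult_l_distr P.lsmult_r_distr P.lsmult_assoc P.lsmult_one)
  have "module_isomorphic R P Q"
    by (rule module_isomorphicI[OF P Q, where h=j and k=i])
      (auto intro!: module_homsI simp: Q_def P.lsmult_closed)
  then show ?thesis ..
qed

text \<open>
  The classes in \<open>K\<^sub>0\<close> are those of modules whose elements are sequences.  The coordinates with respect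
  to a dual basis embed an arbitrary finitely generated projective module into such sequences.
\<close>

lemma fg_projective_representative:
  fixes P :: "('r, 'p) module"
  assumes "fg_projective R P"
  obtains Q :: "('r, nat \<Rightarrow> 'r) module" where "fg_projective R Q" "module_isomorphic R P Q"
proof -
  have P: "left_module R P" using assms by (simp add: fg_projective_def)
  interpret P: left_module R P by (rule P)
  obtain n e \<kappa> where db: "dual_basis R P n e \<kappa>" using fg_projective_dual_basis[OF assms] .
  \<comment> \<open>Beyond \<open>n\<close> all sequences share the same value, so they are determined by the coordinates.\<close>
  let ?j = "\<lambda>p k. if k < n then \<kappa> k p else undefined"
  have "inj_on ?j (carrier P)"
  proof (rule inj_onI)
    fix p q assume pq: "p \<in> carrier P" "q \<in> carrier P" "?j p = ?j q"
    then have "\<kappa> k p = \<kappa> k q" if "k < n" for k using that by (metis (full_types))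
    then have "(\<Oplus>\<^bsub>P\<^esub>k\<in>{..<n}. \<kappa> k p \<odot>\<^bsub>P\<^esub> e k) = (\<Oplus>\<^bsub>P\<^esub>k\<in>{..<n}. \<kappa> k q \<odot>\<^bsub>P\<^esub> e k)"
      using pq by (intro P.finsum_cong') (auto intro!: P.lsmult_closed dual_basisD[OF db])
    then show "p = q" using dual_basisD(4)[OF db] pq by simp
  qed
  from isomorphic_copy[OF P this] obtain Q :: "('r, nat \<Rightarrow> 'r) module" where "module_isomorphic R P Q" ..
  then show thesis using that fg_projective_isomorphic[OF assms] by blast
qed

text \<open>
  Both base change and the tensor product of vector spaces are instances, with \<open>M\<close> the ring \<open>S\<close> over itself
  and a vector space with its scalars acting on both sides, respectively.
\<close>

locale tensor_bimodule = tensor_data R M act N + M: left_module S M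
  for R :: "('r, 'c) ring_scheme" and S :: "('s, 'k) ring_scheme" and M :: "('s, 'm, 'd) module_scheme"
    and act and N :: "('r, 'n, 'e) module_scheme" +
  assumes act_smult_commute: "\<lbrakk>a \<in> carrier S; x \<in> carrier M; r \<in> carrier R\<rbrakk> \<Longrightarrow>
    act (a \<odot>\<^bsub>M\<^esub> x) r = a \<odot>\<^bsub>M\<^esub> act x r"
begin

abbreviation "TM \<equiv> tensor_module R M act N"

lemma TM_simps:
  "carrier TM = carrier T" "zero TM = zero T" "add TM = add T"
  "s \<odot>\<^bsub>TM\<^esub> t = tensor_lift T (\<lambda>x y. pt (s \<odot>\<^bsub>M\<^esub> x) y) t"
  by (simp_all add: tensor_module_def Let_def)

lemma TM_abelian: "abelian_group TM"
  by (rule abelian_group_cong[OF tensor_abelian]) (simp_all add: TM_simps)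

lemma TM_pure_closed: "\<lbrakk>x \<in> carrier M; y \<in> carrier N\<rbrakk> \<Longrightarrow> pt x y \<in> carrier TM"
  using pure_closed by (simp add: TM_simps)

lemma TM_pure_add_left: "\<lbrakk>x \<in> carrier M; x' \<in> carrier M; y \<in> carrier N\<rbrakk> \<Longrightarrow>
    pt (x \<oplus>\<^bsub>M\<^esub> x') y = pt x y \<oplus>\<^bsub>TM\<^esub> pt x' y"
  using pure_balanced by (simp add: TM_simps balanced_def)

lemma TM_pure_add_right: "\<lbrakk>x \<in> carrier M; y \<in> carrier N; y' \<in> carrier N\<rbrakk> \<Longrightarrow>
    pt x (y \<oplus>\<^bsub>N\<^esub> y') = pt x y \<oplus>\<^bsub>TM\<^esub> pt x y'"
  using pure_balanced by (simp add: TM_simps balanced_def)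

lemma TM_pure_balanced: "\<lbrakk>x \<in> carrier M; r \<in> carrier R; y \<in> carrier N\<rbrakk> \<Longrightarrow>
    pt (act x r) y = pt x (r \<odot>\<^bsub>N\<^esub> y)"
  using pure_balanced by (simp add: balanced_def)

lemma TM_induct [consumes 1, case_names zero pure add]:
  assumes "u \<in> carrier TM" "Q \<zero>\<^bsub>TM\<^esub>"
    "\<And>x y. \<lbrakk>x \<in> carrier M; y \<in> carrier N\<rbrakk> \<Longrightarrow> Q (pt x y)"
    "\<And>v w. \<lbrakk>v \<in> carrier TM; w \<in> carrier TM; Q v; Q w\<rbrakk> \<Longrightarrow> Q (v \<oplus>\<^bsub>TM\<^esub> w)"
  shows "Q u"
  using assms tensor_induct[of u Q] by (simp add: TM_simps)

lemma smult_balanced: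
  assumes "s \<in> carrier S"
  shows "balanced T (\<lambda>x y. pt (s \<odot>\<^bsub>M\<^esub> x) y)"
  by (rule balancedI)
    (use assms pure_balanced in \<open>simp_all add: balanced_def M.lsmult_closed M.lsmult_r_distr flip: act_smult_commute\<close>)

lemma TM_smult_hom: "s \<in> carrier S \<Longrightarrow> (\<lambda>u. s \<odot>\<^bsub>TM\<^esub> u) \<in> add_homs TM TM"
  using lift_hom[OF tensor_abelian smult_balanced] by (simp add: add_homs_def TM_simps)

lemma TM_smult_pure:
  "\<lbrakk>s \<in> carrier S; x \<in> carrier M; y \<in> carrier N\<rbrakk> \<Longrightarrow> s \<odot>\<^bsub>TM\<^esub> pt x y = pt (s \<odot>\<^bsub>M\<^esub> x) y"
  using lift_pure[OF tensor_abelian smult_balanced] by (simp add: TM_simps)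

lemma TM_smult_closed: "\<lbrakk>s \<in> carrier S; u \<in> carrier TM\<rbrakk> \<Longrightarrow> s \<odot>\<^bsub>TM\<^esub> u \<in> carrier TM"
  by (rule add_homs_closed[OF TM_smult_hom])

lemma TM_smult_add: "\<lbrakk>s \<in> carrier S; u \<in> carrier TM; v \<in> carrier TM\<rbrakk> \<Longrightarrow>
    s \<odot>\<^bsub>TM\<^esub> (u \<oplus>\<^bsub>TM\<^esub> v) = s \<odot>\<^bsub>TM\<^esub> u \<oplus>\<^bsub>TM\<^esub> s \<odot>\<^bsub>TM\<^esub> v"
  by (rule add_homs_add[OF TM_smult_hom])

lemma TM_smult_zero: "s \<in> carrier S \<Longrightarrow> s \<odot>\<^bsub>TM\<^esub> \<zero>\<^bsub>TM\<^esub> = \<zero>\<^bsub>TM\<^esub>"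
  by (rule add_homs_zero[OF TM_abelian TM_abelian TM_smult_hom])

lemma TM_left_module: "left_module S TM"
proof (intro left_module.intro left_module_axioms.intro M.R.ring_axioms TM_abelian)
  interpret A: abelian_group TM by (rule TM_abelian)
  show "(r \<oplus>\<^bsub>S\<^esub> s) \<odot>\<^bsub>TM\<^esub> x = r \<odot>\<^bsub>TM\<^esub> x \<oplus>\<^bsub>TM\<^esub> s \<odot>\<^bsub>TM\<^esub> x"
    if r: "r \<in> carrier S" and s: "s \<in> carrier S" and x: "x \<in> carrier TM" for r s x
    using x
  proof (induction rule: TM_induct)
    case zero
    show ?case using r s by (simp add: TM_smult_zero)
  next
    case (pure x y)
    then show ?case using r s by (simp add: TM_smult_pure M.lsmult_l_distr M.lsmult_closed TM_pure_add_left)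
  next
    case (add v w)
    then show ?case using r s by (simp add: TM_smult_add TM_smult_closed A.a_ac)
  qed
  show "(r \<otimes>\<^bsub>S\<^esub> s) \<odot>\<^bsub>TM\<^esub> x = r \<odot>\<^bsub>TM\<^esub> (s \<odot>\<^bsub>TM\<^esub> x)"
    if r: "r \<in> carrier S" and s: "s \<in> carrier S" and x: "x \<in> carrier TM" for r s x
    using x
  proof (induction rule: TM_induct)
    case zero
    show ?case using r s by (simp add: TM_smult_zero)
  next
    case (pure x y)
    then show ?case using r s by (simp add: TM_smult_pure M.lsmult_assoc M.lsmult_closed)
  next
    case (add v w)
    then show ?case using r s by (simp add: TM_smult_add TM_smult_closed)
  qed
  show "\<one>\<^bsub>S\<^esub> \<odot>\<^bsub>TM\<^esub> x = x" if x: "x \<in> carrier TM" for x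
    using x by (induction rule: TM_induct) (simp_all add: TM_smult_zero TM_smult_pure TM_smult_add M.lsmult_one)
qed (simp_all add: TM_smult_closed TM_smult_add)

end

section \<open>Tensor products with a bimodule\<close>

section \<open>Base change\<close>

locale base_ring_hom = R: ring R + S: ring S
  for R :: "('r, 'c) ring_scheme" and S :: "('s, 'd) ring_scheme" +
  fixes f :: "'r \<Rightarrow> 's"
  assumes f_hom: "f \<in> ring_hom R S"
begin

abbreviation "right_act \<equiv> \<lambda>s r. s \<otimes>\<^bsub>S\<^esub> f r"
abbreviation "BC P \<equiv> base_change R S f P"
abbreviation "pb P \<equiv> pure_tensor R (regular_module S) right_act P"

lemma f_closed [simp]: "r \<in> carrier R \<Longrightarrow> f r \<in> carrier S"
  using f_hom by (rule ring_hom_closed)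

lemma f_add: "\<lbrakk>r \<in> carrier R; r' \<in> carrier R\<rbrakk> \<Longrightarrow> f (r \<oplus>\<^bsub>R\<^esub> r') = f r \<oplus>\<^bsub>S\<^esub> f r'"
  using f_hom by (rule ring_hom_add)

lemma f_mult: "\<lbrakk>r \<in> carrier R; r' \<in> carrier R\<rbrakk> \<Longrightarrow> f (r \<otimes>\<^bsub>R\<^esub> r') = f r \<otimes>\<^bsub>S\<^esub> f r'"
  using f_hom by (rule ring_hom_mult)

lemma f_one: "f \<one>\<^bsub>R\<^esub> = \<one>\<^bsub>S\<^esub>"
  using f_hom by (rule ring_hom_one)

lemma regular_bimodule: "bimodule S R (regular_module S) right_act"
  by (intro bimodule.intro bimodule_axioms.intro left_module_regular S.ring_axioms R.ring_axioms)
    (simp_all add: S.l_distr S.r_distr S.m_assoc f_add f_mult f_one)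

lemma tensor_bimodule:
  assumes P: "left_module R P"
  shows "tensor_bimodule R S (regular_module S) right_act P"
proof -
  interpret P: left_module R P by (rule P)
  show ?thesis
    by (intro tensor_bimodule.intro tensor_data.intro tensor_bimodule_axioms.intro
        left_module_abelian[OF P] left_module_regular[OF S.ring_axioms]
        left_module_abelian[OF left_module_regular[OF S.ring_axioms]])
      (simp_all add: P.lsmult_closed S.m_assoc)
qed

context
  fixes P :: "('r, 'p, 'e) module_scheme"
  assumes P: "left_module R P"
begin

interpretation P: left_module R P by (rule P)
interpretation t: tensor_bimodule R S "regular_module S" right_act P by (rule tensor_bimodule[OF P])

lemma BC_abelian: "abelian_group (BC P)"
  unfolding base_change_def by (rule t.TM_abelian)

lemma BC_left_module: "left_module S (BC P)"
  unfolding base_change_def by (rule t.TM_left_module)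

lemma pb_closed: "\<lbrakk>s \<in> carrier S; p \<in> carrier P\<rbrakk> \<Longrightarrow> pb P s p \<in> carrier (BC P)"
  using t.TM_pure_closed by (simp add: base_change_def)

lemma pb_add_right: "\<lbrakk>s \<in> carrier S; p \<in> carrier P; p' \<in> carrier P\<rbrakk> \<Longrightarrow>
    pb P s (p \<oplus>\<^bsub>P\<^esub> p') = pb P s p \<oplus>\<^bsub>BC P\<^esub> pb P s p'"
  using t.TM_pure_add_right by (simp add: base_change_def)

lemma pb_balanced: "\<lbrakk>s \<in> carrier S; r \<in> carrier R; p \<in> carrier P\<rbrakk> \<Longrightarrow>
    pb P (s \<otimes>\<^bsub>S\<^esub> f r) p = pb P s (r \<odot>\<^bsub>P\<^esub> p)"
  using t.TM_pure_balanced by simp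

lemmas BC_induct [consumes 1, case_names zero pure add] =
  t.TM_induct[folded base_change_def, unfolded regular_module_simps]

lemma BC_smult_pure:
  "\<lbrakk>s \<in> carrier S; s' \<in> carrier S; p \<in> carrier P\<rbrakk> \<Longrightarrow> s \<odot>\<^bsub>BC P\<^esub> pb P s' p = pb P (s \<otimes>\<^bsub>S\<^esub> s') p"
  using t.TM_smult_pure by (simp add: base_change_def)

lemmas BC_smult_zero = t.TM_smult_zero[folded base_change_def]
lemmas BC_smult_add = t.TM_smult_add[folded base_change_def]
lemmas BC_smult_closed = t.TM_smult_closed[folded base_change_def]

text \<open>
  Base change is left adjoint to restriction of scalars along \<open>f\<close>: a semilinear map on \<open>P\<close> extends.
\<close>

lemma BC_lift:
  fixes Q :: "('s, 'q, 'k) module_scheme"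
  assumes Q: "left_module S Q"
    and cl: "\<And>p. p \<in> carrier P \<Longrightarrow> \<phi> p \<in> carrier Q"
    and add: "\<And>p p'. \<lbrakk>p \<in> carrier P; p' \<in> carrier P\<rbrakk> \<Longrightarrow> \<phi> (p \<oplus>\<^bsub>P\<^esub> p') = \<phi> p \<oplus>\<^bsub>Q\<^esub> \<phi> p'"
    and semi: "\<And>r p. \<lbrakk>r \<in> carrier R; p \<in> carrier P\<rbrakk> \<Longrightarrow> \<phi> (r \<odot>\<^bsub>P\<^esub> p) = f r \<odot>\<^bsub>Q\<^esub> \<phi> p"
  obtains h where "h \<in> module_homs S (BC P) Q"
    "\<And>s p. \<lbrakk>s \<in> carrier S; p \<in> carrier P\<rbrakk> \<Longrightarrow> h (pb P s p) = s \<odot>\<^bsub>Q\<^esub> \<phi> p"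
proof -
  interpret Q: left_module S Q by (rule Q)
  let ?h = "tensor_lift Q (\<lambda>s p. s \<odot>\<^bsub>Q\<^esub> \<phi> p)"
  have bal: "t.balanced Q (\<lambda>s p. s \<odot>\<^bsub>Q\<^esub> \<phi> p)"
    by (rule t.balancedI) (simp_all add: cl add semi Q.lsmult_closed Q.lsmult_l_distr Q.lsmult_r_distr Q.lsmult_assoc)
  have ab: "abelian_group Q" by (rule left_module_abelian[OF Q])
  have pure: "?h (pb P s p) = s \<odot>\<^bsub>Q\<^esub> \<phi> p" if "s \<in> carrier S" "p \<in> carrier P" for s p
    using t.lift_pure[OF ab bal] that by simp
  have hom: "?h \<in> add_homs (BC P) Q"
    using t.lift_hom[OF ab bal] by (simp add: add_homs_def base_change_def t.TM_simps)
  have "?h \<in> module_homs S (BC P) Q"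
  proof (rule module_homsI)
    fix s u assume s: "s \<in> carrier S" and u: "u \<in> carrier (BC P)"
    from u show "?h (s \<odot>\<^bsub>BC P\<^esub> u) = s \<odot>\<^bsub>Q\<^esub> ?h u"
    proof (induction rule: BC_induct)
      case zero
      show ?case using s add_homs_zero[OF BC_abelian ab hom] by (simp add: BC_smult_zero Q.smult_zero_right)
    next
      case (pure s' p)
      then show ?case using s by (simp add: BC_smult_pure \<open>\<And>s p. _ \<Longrightarrow> _ \<Longrightarrow> ?h (pb P s p) = _\<close> Q.lsmult_assoc cl)
    next
      case (add v w)
      then show ?case using s
        by (simp add: BC_smult_add BC_smult_closed add_homs_add[OF hom] add_homs_closed[OF hom] Q.lsmult_r_distr)
    qed
  qed (auto intro: add_homs_closed[OF hom] add_homs_add[OF hom])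
  then show thesis using that pure by blast
qed

text \<open>
  The elements \<open>1 \<otimes> p\<close> generate the base change as a left module, since \<open>s \<otimes> p = s (1 \<otimes> p)\<close>.
\<close>

lemma BC_ext:
  fixes Q :: "('s, 'q, 'k) module_scheme"
  assumes Q: "left_module S Q" and g: "g \<in> module_homs S (BC P) Q" and h: "h \<in> module_homs S (BC P) Q"
    and eq: "\<And>p. p \<in> carrier P \<Longrightarrow> g (pb P \<one>\<^bsub>S\<^esub> p) = h (pb P \<one>\<^bsub>S\<^esub> p)"
    and u: "u \<in> carrier (BC P)"
  shows "g u = h u"
  using u
proof (induction rule: BC_induct)
  case zero
  show ?case using module_homs_zero[OF BC_left_module Q] g h by metis
next
  case (pure s p)
  then have "pb P s p = s \<odot>\<^bsub>BC P\<^esub> pb P \<one>\<^bsub>S\<^esub> p" by (simp add: BC_smult_pure)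
  then show ?case
    using pure by (simp add: module_homs_smult[OF g] module_homs_smult[OF h] pb_closed eq)
next
  case (add v w)
  then show ?case by (simp add: module_homs_add[OF g] module_homs_add[OF h])
qed

end

lemma BC_map:
  fixes P :: "('r, 'p, 'e) module_scheme" and Q :: "('r, 'q, 'k) module_scheme"
  assumes P: "left_module R P" and Q: "left_module R Q" and g: "g \<in> module_homs R P Q"
  obtains h where "h \<in> module_homs S (BC P) (BC Q)"
    "\<And>p. p \<in> carrier P \<Longrightarrow> h (pb P \<one>\<^bsub>S\<^esub> p) = pb Q \<one>\<^bsub>S\<^esub> (g p)"
proof -
  note BQ = BC_left_module[OF Q]
  interpret Q: left_module R Q by (rule Q)
  obtain h where h: "h \<in> module_homs S (BC P) (BC Q)"
    "\<And>s p. \<lbrakk>s \<in> carrier S; p \<in> carrier P\<rbrakk> \<Longrightarrow> h (pb P s p) = s \<odot>\<^bsub>BC Q\<^esub> pb Q \<one>\<^bsub>S\<^esub> (g p)"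
  proof (rule BC_lift[OF P BQ, of "\<lambda>p. pb Q \<one>\<^bsub>S\<^esub> (g p)"])
    show "pb Q \<one>\<^bsub>S\<^esub> (g (r \<odot>\<^bsub>P\<^esub> p)) = f r \<odot>\<^bsub>BC Q\<^esub> pb Q \<one>\<^bsub>S\<^esub> (g p)"
      if "r \<in> carrier R" "p \<in> carrier P" for r p
      using that module_homs_closed[OF g]
      by (simp add: module_homs_smult[OF g] BC_smult_pure[OF Q] pb_balanced[OF Q, symmetric])
  qed (use module_homs_closed[OF g] in \<open>auto simp: module_homs_add[OF g] pb_closed[OF Q] pb_add_right[OF Q]\<close>)
  have "h (pb P \<one>\<^bsub>S\<^esub> p) = pb Q \<one>\<^bsub>S\<^esub> (g p)" if "p \<in> carrier P" for p
    using h(2)[of "\<one>\<^bsub>S\<^esub>" p] that module_homs_closed[OF g that] by (simp add: BC_smult_pure[OF Q])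
  then show thesis using that h(1) by blast
qed

lemma BC_isomorphic:
  fixes P :: "('r, 'p, 'e) module_scheme" and Q :: "('r, 'q, 'k) module_scheme"
  assumes "module_isomorphic R P Q"
  shows "module_isomorphic S (BC P) (BC Q)"
proof -
  obtain g k where P: "left_module R P" and Q: "left_module R Q"
    and g: "g \<in> module_homs R P Q" and k: "k \<in> module_homs R Q P"
    and kg: "\<And>x. x \<in> carrier P \<Longrightarrow> k (g x) = x" and gk: "\<And>y. y \<in> carrier Q \<Longrightarrow> g (k y) = y"
    by (rule module_isomorphicE[OF assms]) blast
  obtain g' where g': "g' \<in> module_homs S (BC P) (BC Q)"
    "\<And>p. p \<in> carrier P \<Longrightarrow> g' (pb P \<one>\<^bsub>S\<^esub> p) = pb Q \<one>\<^bsub>S\<^esub> (g p)" using BC_map[OF P Q g] by blast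
  obtain k' where k': "k' \<in> module_homs S (BC Q) (BC P)"
    "\<And>p. p \<in> carrier Q \<Longrightarrow> k' (pb Q \<one>\<^bsub>S\<^esub> p) = pb P \<one>\<^bsub>S\<^esub> (k p)" using BC_map[OF Q P k] by blast
  show ?thesis
  proof (rule module_isomorphicI[OF BC_left_module[OF P] BC_left_module[OF Q] g'(1) k'(1)])
    show "k' (g' x) = x" if "x \<in> carrier (BC P)" for x
      by (rule BC_ext[OF P BC_left_module[OF P] module_homs_comp[OF g'(1) k'(1)] module_homs_id _ that])
        (simp add: g' k' kg module_homs_closed[OF g])
    show "g' (k' x) = x" if "x \<in> carrier (BC Q)" for x
      by (rule BC_ext[OF Q BC_left_module[OF Q] module_homs_comp[OF k'(1) g'(1)] module_homs_id _ that])
        (simp add: g' k' gk module_homs_closed[OF k])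
  qed
qed

text \<open>
  The functional \<open>\<kappa>\<^sub>k\<close> extends to \<open>s \<otimes> p \<mapsto> s f(\<kappa>\<^sub>k p)\<close>, and the expansion of \<open>1 \<otimes> p\<close> is the image of
  the expansion of \<open>p\<close> because scalars of \<open>R\<close> may be moved across the tensor sign.
\<close>

lemma BC_dual_basis:
  fixes P :: "('r, 'p, 'e) module_scheme"
  assumes P: "left_module R P" and db: "dual_basis R P n e \<kappa>"
  shows "\<exists>\<kappa>'. dual_basis S (BC P) n (\<lambda>k. pb P \<one>\<^bsub>S\<^esub> (e k)) \<kappa>'"
proof -
  interpret P: left_module R P by (rule P)
  have RS: "left_module S (regular_module S)" by (rule left_module_regular[OF S.ring_axioms])
  have "\<exists>h\<in>module_homs S (BC P) (regular_module S). \<forall>p\<in>carrier P. h (pb P \<one>\<^bsub>S\<^esub> p) = f (\<kappa> k p)"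
    if k: "k < n" for k
  proof -
    note \<kappa> = dual_basisD(2)[OF db k]
    obtain h where "h \<in> module_homs S (BC P) (regular_module S)"
      "\<And>s p. \<lbrakk>s \<in> carrier S; p \<in> carrier P\<rbrakk> \<Longrightarrow> h (pb P s p) = s \<odot>\<^bsub>regular_module S\<^esub> f (\<kappa> k p)"
    proof (rule BC_lift[OF P RS, of "\<lambda>p. f (\<kappa> k p)"])
    qed (use dual_basisD(3)[OF db k] in \<open>auto simp: module_homs_add[OF \<kappa>] module_homs_smult[OF \<kappa>] f_add f_mult\<close>)
    then show ?thesis using dual_basisD(3)[OF db k] by (intro bexI[of _ h]) auto
  qed
  then have "\<forall>k\<in>{..<n}. \<exists>h. h \<in> module_homs S (BC P) (regular_module S) \<and>
      (\<forall>p\<in>carrier P. h (pb P \<one>\<^bsub>S\<^esub> p) = f (\<kappa> k p))" by blast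
  from bchoice[OF this] obtain \<kappa>' where \<kappa>':
    "\<And>k. k < n \<Longrightarrow> \<kappa>' k \<in> module_homs S (BC P) (regular_module S)"
    "\<And>k p. \<lbrakk>k < n; p \<in> carrier P\<rbrakk> \<Longrightarrow> \<kappa>' k (pb P \<one>\<^bsub>S\<^esub> p) = f (\<kappa> k p)" by auto
  have \<kappa>'c: "\<kappa>' k u \<in> carrier S" if "k < n" "u \<in> carrier (BC P)" for k u
    using module_homs_closed[OF \<kappa>'(1)] that by simp
  interpret B: left_module S "BC P" by (rule BC_left_module[OF P])
  have eB: "pb P \<one>\<^bsub>S\<^esub> (e k) \<in> carrier (BC P)" if "k < n" for k
    using that by (simp add: pb_closed[OF P] dual_basisD(1)[OF db])
  let ?s = "\<lambda>u. \<Oplus>\<^bsub>BC P\<^esub>k\<in>{..<n}. \<kappa>' k u \<odot>\<^bsub>BC P\<^esub> pb P \<one>\<^bsub>S\<^esub> (e k)"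
  have s: "?s \<in> module_homs S (BC P) (BC P)"
    by (rule module_homs_coefficient_sum[OF BC_left_module[OF P]]) (use eB \<kappa>'(1) in auto)
  have "?s (pb P \<one>\<^bsub>S\<^esub> p) = pb P \<one>\<^bsub>S\<^esub> p" if p: "p \<in> carrier P" for p
  proof -
    have "?s (pb P \<one>\<^bsub>S\<^esub> p) = (\<Oplus>\<^bsub>BC P\<^esub>k\<in>{..<n}. pb P \<one>\<^bsub>S\<^esub> (\<kappa> k p \<odot>\<^bsub>P\<^esub> e k))"
      by (rule B.finsum_cong')
        (use p in \<open>auto simp: \<kappa>' BC_smult_pure[OF P] pb_balanced[OF P, symmetric] dual_basisD[OF db] pb_closed[OF P]\<close>)
    also have "\<dots> = pb P \<one>\<^bsub>S\<^esub> (\<Oplus>\<^bsub>P\<^esub>k\<in>{..<n}. \<kappa> k p \<odot>\<^bsub>P\<^esub> e k)"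
      by (rule add_homs_finsum[OF left_module_abelian[OF P] BC_abelian[OF P], symmetric])
        (use p in \<open>auto intro!: add_homsI P.lsmult_closed simp: pb_closed[OF P] pb_add_right[OF P] dual_basisD[OF db]\<close>)
    finally show ?thesis using dual_basisD(4)[OF db p] by simp
  qed
  then have "?s u = u" if "u \<in> carrier (BC P)" for u
    using BC_ext[OF P BC_left_module[OF P] s module_homs_id _ that] by blast
  then have "dual_basis S (BC P) n (\<lambda>k. pb P \<one>\<^bsub>S\<^esub> (e k)) \<kappa>'"
    unfolding dual_basis_def using eB \<kappa>'(1) by simp
  then show ?thesis by blast
qed

lemma BC_fg_projective:
  fixes P :: "('r, 'p) module"
  assumes "fg_projective R P" shows "fg_projective S (BC P)"
proof -
  have P: "left_module R P" using assms by (simp add: fg_projective_def)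
  obtain n e \<kappa> where db: "dual_basis R P n e \<kappa>" using fg_projective_dual_basis[OF assms] .
  then show ?thesis using BC_dual_basis[OF P db] fg_projectiveI[OF BC_left_module[OF P]] by blast
qed

end

section \<open>Direct sums\<close>

lemma module_sum_simps [simp]:
  "carrier (module_sum M N) = carrier M \<times> carrier N" "zero (module_sum M N) = (\<zero>\<^bsub>M\<^esub>, \<zero>\<^bsub>N\<^esub>)"
  "(x, y) \<oplus>\<^bsub>module_sum M N\<^esub> (x', y') = (x \<oplus>\<^bsub>M\<^esub> x', y \<oplus>\<^bsub>N\<^esub> y')"
  "r \<odot>\<^bsub>module_sum M N\<^esub> (x, y) = (r \<odot>\<^bsub>M\<^esub> x, r \<odot>\<^bsub>N\<^esub> y)"
  by (simp_all add: module_sum_def)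

lemma module_sum_left_module:
  assumes M: "left_module R M" and N: "left_module R N"
  shows "left_module R (module_sum M N)"
proof -
  interpret M: left_module R M by (rule M)
  interpret N: left_module R N by (rule N)
  have "abelian_group (module_sum M N)"
  proof (rule abelian_groupI)
    fix u assume "u \<in> carrier (module_sum M N)"
    then show "\<exists>v\<in>carrier (module_sum M N). v \<oplus>\<^bsub>module_sum M N\<^esub> u = \<zero>\<^bsub>module_sum M N\<^esub>"
      by (intro bexI[of _ "(\<ominus>\<^bsub>M\<^esub> fst u, \<ominus>\<^bsub>N\<^esub> snd u)"]) (auto simp: M.M.l_neg N.M.l_neg)
  qed (auto simp: M.M.a_ac N.M.a_ac)
  then show ?thesis
    by (intro left_module.intro left_module_axioms.intro M.R.ring_axioms)
      (auto simp: M.lsmult_closed N.lsmult_closed M.lsmult_l_distr N.lsmult_l_distr M.lsmult_r_distr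
        N.lsmult_r_distr M.lsmult_assoc N.lsmult_assoc M.lsmult_one N.lsmult_one)
qed

lemma module_sum_isomorphic:
  assumes "module_isomorphic R M M'" "module_isomorphic R N N'"
  shows "module_isomorphic R (module_sum M N) (module_sum M' N')"
proof -
  obtain h k where 1: "left_module R M" "left_module R M'" "h \<in> module_homs R M M'" "k \<in> module_homs R M' M"
    "\<And>x. x \<in> carrier M \<Longrightarrow> k (h x) = x" "\<And>y. y \<in> carrier M' \<Longrightarrow> h (k y) = y"
    by (rule module_isomorphicE[OF assms(1)]) blast
  obtain h' k' where 2: "left_module R N" "left_module R N'" "h' \<in> module_homs R N N'" "k' \<in> module_homs R N' N"
    "\<And>x. x \<in> carrier N \<Longrightarrow> k' (h' x) = x" "\<And>y. y \<in> carrier N' \<Longrightarrow> h' (k' y) = y"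
    by (rule module_isomorphicE[OF assms(2)]) blast
  note homs = 1(3,4) 2(3,4)
  show ?thesis
    by (rule module_isomorphicI[OF module_sum_left_module[OF 1(1) 2(1)] module_sum_left_module[OF 1(2) 2(2)],
          where h="\<lambda>u. (h (fst u), h' (snd u))" and k="\<lambda>u. (k (fst u), k' (snd u))"])
      (auto intro!: module_homsI simp: 1(5,6) 2(5,6) homs[THEN module_homs_closed]
        homs[THEN module_homs_add] homs[THEN module_homs_smult])
qed

text \<open>
  Base change is an additive functor, so it preserves the projections and injections of a biproduct and the
  equations between them; these equations exhibit the base change as a direct sum again.
\<close>

lemma (in base_ring_hom) BC_module_sum:
  fixes P :: "('r, 'p) module" and Q :: "('r, 'q) module"
  assumes P: "left_module R P" and Q: "left_module R Q"
  shows "module_isomorphic S (BC (module_sum P Q)) (module_sum (BC P) (BC Q))"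
proof -
  interpret P: left_module R P by (rule P)
  interpret Q: left_module R Q by (rule Q)
  note PQ = module_sum_left_module[OF P Q]
  note mods = BC_left_module[OF P] BC_left_module[OF Q] BC_left_module[OF PQ]
  interpret BP: left_module S "BC P" by (rule mods)
  interpret BQ: left_module S "BC Q" by (rule mods)
  interpret BPQ: left_module S "BC (module_sum P Q)" by (rule mods)
  note BPQ' = module_sum_left_module[OF mods(1,2)]
  have maps: "fst \<in> module_homs R (module_sum P Q) P" "snd \<in> module_homs R (module_sum P Q) Q"
    "(\<lambda>p. (p, \<zero>\<^bsub>Q\<^esub>)) \<in> module_homs R P (module_sum P Q)" "(\<lambda>q. (\<zero>\<^bsub>P\<^esub>, q)) \<in> module_homs R Q (module_sum P Q)"
    by (auto intro!: module_homsI simp: P.smult_zero_right Q.smult_zero_right)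
  obtain p1 where p1: "p1 \<in> module_homs S (BC (module_sum P Q)) (BC P)"
      "\<And>x. x \<in> carrier (module_sum P Q) \<Longrightarrow> p1 (pb (module_sum P Q) \<one>\<^bsub>S\<^esub> x) = pb P \<one>\<^bsub>S\<^esub> (fst x)"
    by (rule BC_map[OF PQ P maps(1)]) blast
  obtain p2 where p2: "p2 \<in> module_homs S (BC (module_sum P Q)) (BC Q)"
      "\<And>x. x \<in> carrier (module_sum P Q) \<Longrightarrow> p2 (pb (module_sum P Q) \<one>\<^bsub>S\<^esub> x) = pb Q \<one>\<^bsub>S\<^esub> (snd x)"
    by (rule BC_map[OF PQ Q maps(2)]) blast
  obtain i1 where i1: "i1 \<in> module_homs S (BC P) (BC (module_sum P Q))"
      "\<And>x. x \<in> carrier P \<Longrightarrow> i1 (pb P \<one>\<^bsub>S\<^esub> x) = pb (module_sum P Q) \<one>\<^bsub>S\<^esub> (x, \<zero>\<^bsub>Q\<^esub>)"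
    by (rule BC_map[OF P PQ maps(3)]) blast
  obtain i2 where i2: "i2 \<in> module_homs S (BC Q) (BC (module_sum P Q))"
      "\<And>x. x \<in> carrier Q \<Longrightarrow> i2 (pb Q \<one>\<^bsub>S\<^esub> x) = pb (module_sum P Q) \<one>\<^bsub>S\<^esub> (\<zero>\<^bsub>P\<^esub>, x)"
    by (rule BC_map[OF Q PQ maps(4)]) blast
  have z: "pb P \<one>\<^bsub>S\<^esub> \<zero>\<^bsub>P\<^esub> = \<zero>\<^bsub>BC P\<^esub>" "pb Q \<one>\<^bsub>S\<^esub> \<zero>\<^bsub>Q\<^esub> = \<zero>\<^bsub>BC Q\<^esub>"
    by (rule add_homs_zero[OF left_module_abelian[OF P] BC_abelian[OF P]]
        add_homs_zero[OF left_module_abelian[OF Q] BC_abelian[OF Q]];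
      auto intro!: add_homsI simp: pb_closed[OF P] pb_add_right[OF P] pb_closed[OF Q] pb_add_right[OF Q])+
  note homs = p1(1) p2(1) i1(1) i2(1)
  note cl = homs[THEN module_homs_closed]
  note ad = homs[THEN module_homs_add]
  note sm = homs[THEN module_homs_smult]
  have z0: "(\<lambda>_. \<zero>\<^bsub>BC P\<^esub>) \<in> module_homs S (BC Q) (BC P)" "(\<lambda>_. \<zero>\<^bsub>BC Q\<^esub>) \<in> module_homs S (BC P) (BC Q)"
    by (auto intro!: module_homsI simp: BP.smult_zero_right BQ.smult_zero_right)
  have c11: "p1 (i1 u) = u" if "u \<in> carrier (BC P)" for u
    by (rule BC_ext[OF P mods(1) module_homs_comp[OF i1(1) p1(1)] module_homs_id _ that]) (simp add: p1 i1)
  have c12: "p2 (i1 u) = \<zero>\<^bsub>BC Q\<^esub>" if "u \<in> carrier (BC P)" for u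
    by (rule BC_ext[OF P mods(2) module_homs_comp[OF i1(1) p2(1)] z0(2) _ that]) (simp add: p2 i1 z)
  have c21: "p1 (i2 u) = \<zero>\<^bsub>BC P\<^esub>" if "u \<in> carrier (BC Q)" for u
    by (rule BC_ext[OF Q mods(1) module_homs_comp[OF i2(1) p1(1)] z0(1) _ that]) (simp add: p1 i2 z)
  have c22: "p2 (i2 u) = u" if "u \<in> carrier (BC Q)" for u
    by (rule BC_ext[OF Q mods(2) module_homs_comp[OF i2(1) p2(1)] module_homs_id _ that]) (simp add: p2 i2)
  have sum: "(\<lambda>u. i1 (p1 u) \<oplus>\<^bsub>BC (module_sum P Q)\<^esub> i2 (p2 u)) \<in> module_homs S (BC (module_sum P Q)) (BC (module_sum P Q))"
    by (rule module_homsI) (simp_all add: ad cl sm BPQ.M.a_ac BPQ.lsmult_r_distr)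
  have c: "i1 (p1 u) \<oplus>\<^bsub>BC (module_sum P Q)\<^esub> i2 (p2 u) = u" if "u \<in> carrier (BC (module_sum P Q))" for u
    by (rule BC_ext[OF PQ mods(3) sum module_homs_id _ that])
      (auto simp: p1 p2 i1 i2 pb_add_right[OF PQ, symmetric])
  show ?thesis
    by (rule module_isomorphicI[OF mods(3) BPQ', where h="\<lambda>u. (p1 u, p2 u)"
          and k="\<lambda>u. i1 (fst u) \<oplus>\<^bsub>BC (module_sum P Q)\<^esub> i2 (snd u)"])
      (auto intro!: module_homsI simp: cl ad sm c c11 c12 c21 c22 BPQ.M.a_ac BPQ.lsmult_r_distr)
qed

section \<open>The induced map on \<open>K\<^sub>0\<close>\<close>

lemma iso_class_cong:
  assumes "module_isomorphic R P Q" shows "iso_class R P = iso_class R Q"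
  unfolding iso_class_def
  using module_isomorphic_trans[OF assms] module_isomorphic_trans[OF module_isomorphic_sym[OF assms]] by blast

lemma K0_class_cong:
  "module_isomorphic R P Q \<Longrightarrow> K0_class R P = K0_class R Q"
  by (simp add: K0_class_def iso_class_cong)

lemma iso_class_fg_projective:
  fixes P :: "('r, 'p) module"
  assumes "fg_projective R P" shows "iso_class R P \<in> fgp_classes R"
proof -
  obtain Q :: "('r, nat \<Rightarrow> 'r) module" where "fg_projective R Q" "module_isomorphic R P Q"
    using fg_projective_representative[OF assms] .
  then show ?thesis using iso_class_cong unfolding fgp_classes_def by blast
qed

lemma K0_relations_subset: "K0_relations (R :: ('r, 'c) ring_scheme) \<subseteq> carrier (free_Abelian_group (fgp_classes R))"
proof
  fix x assume "x \<in> K0_relations R"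
  then obtain T P Q :: "('r, nat \<Rightarrow> 'r) module" where
    x: "x = frag_of (iso_class R T) - frag_of (iso_class R P) - frag_of (iso_class R Q)"
    and fgp: "fg_projective R T" "fg_projective R P" "fg_projective R Q"
    unfolding K0_relations_def by blast
  note fgp[THEN iso_class_fg_projective]
  then show "x \<in> carrier (free_Abelian_group (fgp_classes R))"
    using x keys_diff[of "frag_of (iso_class R T) - frag_of (iso_class R P)" "frag_of (iso_class R Q)"]
      keys_diff[of "frag_of (iso_class R T)" "frag_of (iso_class R P)"] by auto
qed

lemma K0_kernel_subgroup: "subgroup (K0_kernel R) (free_Abelian_group (fgp_classes R))"
  unfolding K0_kernel_def
  by (intro group.generate_is_subgroup group_free_Abelian_group K0_relations_subset)

lemma K0_kernel_normal: "K0_kernel R \<lhd> free_Abelian_group (fgp_classes R)"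
  using K0_kernel_subgroup comm_group.normal_iff_subgroup[OF abelian_free_Abelian_group] by blast

lemma K0_comm_group: "comm_group (K0 R)"
  unfolding K0_def by (rule comm_group.abelian_FactGroup[OF abelian_free_Abelian_group K0_kernel_subgroup])

lemma K0_class_closed:
  fixes P :: "('r, 'p) module"
  assumes "fg_projective R P" shows "K0_class R P \<in> carrier (K0 R)"
  unfolding K0_def K0_class_def carrier_FactGroup
  by (rule imageI) (simp add: iso_class_fg_projective[OF assms])

text \<open>
  The defining relations only mention modules of sequences; for other element types the relation is
  obtained by passing to representatives.
\<close>

lemma K0_class_sum:
  fixes T :: "('r, 't) module" and P :: "('r, 'p) module" and Q :: "('r, 'q) module"
  assumes T: "fg_projective R T" and P: "fg_projective R P" and Q: "fg_projective R Q"
    and iso: "module_isomorphic R T (module_sum P Q)"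
  shows "K0_class R T = K0_class R P \<otimes>\<^bsub>K0 R\<^esub> K0_class R Q"
proof -
  let ?F = "free_Abelian_group (fgp_classes R)"
  obtain T' :: "('r, nat \<Rightarrow> 'r) module" where T': "fg_projective R T'" "module_isomorphic R T T'"
    using fg_projective_representative[OF T] .
  obtain P' :: "('r, nat \<Rightarrow> 'r) module" where P': "fg_projective R P'" "module_isomorphic R P P'"
    using fg_projective_representative[OF P] .
  obtain Q' :: "('r, nat \<Rightarrow> 'r) module" where Q': "fg_projective R Q'" "module_isomorphic R Q Q'"
    using fg_projective_representative[OF Q] .
  have "module_isomorphic R T' (module_sum P' Q')"
    using module_isomorphic_trans[OF module_isomorphic_sym[OF T'(2)]
        module_isomorphic_trans[OF iso module_sum_isomorphic[OF P'(2) Q'(2)]]] .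
  then have rel: "frag_of (iso_class R T') - frag_of (iso_class R P') - frag_of (iso_class R Q') \<in> K0_kernel R"
    unfolding K0_kernel_def K0_relations_def using T' P' Q' by (intro generate.incl) blast
  have cl: "frag_of (iso_class R T') \<in> carrier ?F" "frag_of (iso_class R P') \<in> carrier ?F"
    "frag_of (iso_class R Q') \<in> carrier ?F"
    using iso_class_fg_projective T'(1) P'(1) Q'(1) by simp_all
  then have cl2: "frag_of (iso_class R P') + frag_of (iso_class R Q') \<in> carrier ?F"
    using keys_add[of "frag_of (iso_class R P')" "frag_of (iso_class R Q')"] by auto
  have "frag_of (iso_class R T') \<in> K0_kernel R #>\<^bsub>?F\<^esub> (frag_of (iso_class R P') + frag_of (iso_class R Q'))"
    using rel unfolding r_coset_def by (force simp: algebra_simps)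
  then have "K0_kernel R #>\<^bsub>?F\<^esub> (frag_of (iso_class R P') + frag_of (iso_class R Q')) = K0_class R T'"
    unfolding K0_class_def
    by (rule group.repr_independence[OF group_free_Abelian_group _ cl2 K0_kernel_subgroup])
  moreover have "K0_class R P' \<otimes>\<^bsub>K0 R\<^esub> K0_class R Q' =
      K0_kernel R #>\<^bsub>?F\<^esub> (frag_of (iso_class R P') + frag_of (iso_class R Q'))"
    using normal.rcos_sum[OF K0_kernel_normal cl(2,3)] by (simp add: K0_def K0_class_def)
  ultimately show ?thesis
    using K0_class_cong[OF T'(2)] K0_class_cong[OF P'(2)] K0_class_cong[OF Q'(2)] by simp
qed

text \<open>
  The classes of modules generate \<open>K\<^sub>0\<close>, being the images of the generators of the free abelian group.
\<close>

lemma K0_hom_unique: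
  assumes G: "group G" and F: "F \<in> hom (K0 R) G" and F': "F' \<in> hom (K0 R) G"
    and eq: "\<And>P :: ('r, nat \<Rightarrow> 'r) module. fg_projective R P \<Longrightarrow> F (K0_class R P) = F' (K0_class R P)"
    and x: "x \<in> carrier (K0 (R :: ('r, 'c) ring_scheme))"
  shows "F x = F' x"
proof -
  let ?F = "free_Abelian_group (fgp_classes R)"
  let ?q = "\<lambda>c. K0_kernel R #>\<^bsub>?F\<^esub> c"
  have q: "?q \<in> hom ?F (K0 R)" unfolding K0_def by (rule normal.r_coset_hom_Mod[OF K0_kernel_normal])
  have comp: "(\<lambda>c. E (?q c)) \<in> hom ?F G" if "E \<in> hom (K0 R) G" for E
    using hom_compose[OF q that] by (simp add: o_def)
  interpret h: group_hom ?F G "\<lambda>c. F (?q c)"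
    using comp[OF F] G by (simp add: group_hom_def group_hom_axioms_def)
  interpret h': group_hom ?F G "\<lambda>c. F' (?q c)"
    using comp[OF F'] G by (simp add: group_hom_def group_hom_axioms_def)
  obtain c where c: "c \<in> carrier ?F" "x = ?q c"
    using x unfolding K0_def carrier_FactGroup by blast
  have "F (?q c) = F' (?q c)"
  proof (rule free_Abelian_group_induct[OF c(1)[unfolded carrier_free_Abelian_group_iff]], goal_cases)
    case 1
    show ?case using h.hom_one h'.hom_one by simp
  next
    case (2 a b)
    then have ab: "a \<in> carrier ?F" "b \<in> carrier ?F" by simp_all
    have "a - b = a \<otimes>\<^bsub>?F\<^esub> inv\<^bsub>?F\<^esub> b" using 2 by simp
    then show ?case
      using 2 h.hom_mult[OF ab(1) h.G.inv_closed[OF ab(2)]] h'.hom_mult[OF ab(1) h.G.inv_closed[OF ab(2)]]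
        h.hom_inv[OF ab(2)] h'.hom_inv[OF ab(2)] by (simp del: inv_free_Abelian_group mult_free_Abelian_group)
  next
    case (3 a)
    then show ?case using eq by (auto simp: fgp_classes_def K0_class_def)
  qed
  then show ?thesis using c(2) by simp
qed

context base_ring_hom begin

text \<open>
  On a generator, that is on an isomorphism class, the value is the class of the base change of a chosen
  member.  Base change respects isomorphisms, so the choice is immaterial, and it respects direct sums, so
  the relations go to zero and the map passes to the quotient.
\<close>

lemma K0_map_exists: "\<exists>F. is_K0_map R S f F"
proof -
  let ?F = "free_Abelian_group (fgp_classes R)"
  interpret K: comm_group "K0 S" by (rule K0_comm_group)
  \<comment> \<open>A member of a class \<open>c\<close> that has \<open>c\<close> as its own isomorphism class; outside \<open>fgp_classes R\<close> the value is arbitrary.\<close>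
  define rep :: "('r, nat \<Rightarrow> 'r) module set \<Rightarrow> ('r, nat \<Rightarrow> 'r) module" where
    "rep c = (SOME P. fg_projective R P \<and> c = iso_class R P)" for c
  have rep: "fg_projective R (rep c) \<and> c = iso_class R (rep c)" if "c \<in> fgp_classes R" for c
    unfolding rep_def by (rule someI_ex) (use that in \<open>auto simp: fgp_classes_def\<close>)
  have rep_iso: "module_isomorphic R P (rep (iso_class R P))" if "fg_projective R P"
    for P :: "('r, nat \<Rightarrow> 'r) module"
  proof -
    have 1: "fg_projective R (rep (iso_class R P))" "iso_class R P = iso_class R (rep (iso_class R P))"
      using rep[OF iso_class_fg_projective[OF that]] by auto
    have "rep (iso_class R P) \<in> iso_class R (rep (iso_class R P))"
      using 1(1) by (simp add: iso_class_def module_isomorphic_refl fg_projective_def)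
    then have "rep (iso_class R P) \<in> iso_class R P" using 1(2) by simp
    then show ?thesis by (simp add: iso_class_def)
  qed
  define \<phi> where "\<phi> c = K0_class S (BC (rep c))" for c
  have "\<phi> ` fgp_classes R \<subseteq> carrier (K0 S)"
    using rep BC_fg_projective K0_class_closed unfolding \<phi>_def by blast
  from K.free_Abelian_group_universal[OF this] obtain h where h: "h \<in> hom ?F (K0 S)"
    and h_frag: "\<And>c. c \<in> fgp_classes R \<Longrightarrow> h (frag_of c) = \<phi> c" by blast
  have h_class: "h (frag_of (iso_class R P)) = K0_class S (BC P)" if "fg_projective R P"
    for P :: "('r, nat \<Rightarrow> 'r) module"
    using h_frag[OF iso_class_fg_projective[OF that]] K0_class_cong[OF BC_isomorphic[OF rep_iso[OF that]]]
    by (simp add: \<phi>_def)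
  interpret h: group_hom ?F "K0 S" h
    using h K.group_axioms by (simp add: group_hom_def group_hom_axioms_def)
  have "K0_relations R \<subseteq> kernel ?F (K0 S) h"
  proof
    fix x assume x: "x \<in> K0_relations R"
    then obtain T P Q :: "('r, nat \<Rightarrow> 'r) module" where
      x_eq: "x = frag_of (iso_class R T) - frag_of (iso_class R P) - frag_of (iso_class R Q)"
      and fgp: "fg_projective R T" "fg_projective R P" "fg_projective R Q"
      and iso: "module_isomorphic R T (module_sum P Q)"
      unfolding K0_relations_def by blast
    have lm: "left_module R P" "left_module R Q" using fgp by (simp_all add: fg_projective_def)
    have sum: "K0_class S (BC T) = K0_class S (BC P) \<otimes>\<^bsub>K0 S\<^esub> K0_class S (BC Q)"
      by (rule K0_class_sum[OF fgp[THEN BC_fg_projective]])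
        (rule module_isomorphic_trans[OF BC_isomorphic[OF iso] BC_module_sum[OF lm]])
    have xF: "x \<in> carrier ?F" using x K0_relations_subset by blast
    have fr: "frag_of (iso_class R P) \<in> carrier ?F" "frag_of (iso_class R Q) \<in> carrier ?F"
      using fgp iso_class_fg_projective by simp_all
    have "frag_of (iso_class R T) = x \<otimes>\<^bsub>?F\<^esub> (frag_of (iso_class R P) \<otimes>\<^bsub>?F\<^esub> frag_of (iso_class R Q))"
      by (simp add: x_eq)
    then have "h (frag_of (iso_class R T)) = h x \<otimes>\<^bsub>K0 S\<^esub> (h (frag_of (iso_class R P)) \<otimes>\<^bsub>K0 S\<^esub> h (frag_of (iso_class R Q)))"
      using h.hom_mult[OF xF h.G.m_closed[OF fr]] h.hom_mult[OF fr] by simp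
    then have "h x = \<one>\<^bsub>K0 S\<^esub>"
      using sum fgp h.hom_closed[OF xF] K0_class_closed[OF BC_fg_projective[OF fgp(2)]]
        K0_class_closed[OF BC_fg_projective[OF fgp(3)]]
      by (simp add: h_class)
    then show "x \<in> kernel ?F (K0 S) h" using xF by (simp add: kernel_def)
  qed
  then have "K0_kernel R \<subseteq> kernel ?F (K0 S) h"
    unfolding K0_kernel_def by (rule h.G.generate_subgroup_incl) (rule h.subgroup_kernel)
  from h.FactGroup_universal_kernel[OF K0_kernel_normal this]
  obtain g where g: "g \<in> hom (K0 R) (K0 S)" and g_coset: "\<And>x. x \<in> carrier ?F \<Longrightarrow> g (K0_kernel R #>\<^bsub>?F\<^esub> x) = h x"
    unfolding K0_def by blast
  interpret KR: comm_group "K0 R" by (rule K0_comm_group)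
  have "is_K0_map R S f (restrict g (carrier (K0 R)))"
    unfolding is_K0_map_def
  proof (intro conjI allI impI)
    show "restrict g (carrier (K0 R)) \<in> hom (K0 R) (K0 S)"
      using g by (auto simp: hom_def)
    fix P :: "('r, nat \<Rightarrow> 'r) module" assume P: "fg_projective R P"
    then show "fg_projective S (BC P)" by (rule BC_fg_projective)
    have "g (K0_class R P) = K0_class S (BC P)"
      using g_coset[of "frag_of (iso_class R P)"] h_class[OF P] iso_class_fg_projective[OF P]
      by (simp add: K0_class_def)
    then show "restrict g (carrier (K0 R)) (K0_class R P) = K0_class S (BC P)"
      using K0_class_closed[OF P] by simp
  qed simp
  then show ?thesis by blast
qed

lemma is_K0_map_K0_map: "is_K0_map R S f (K0_map R S f)"
proof -
  obtain F where F: "is_K0_map R S f F" using K0_map_exists by blast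
  have "G = F" if G: "is_K0_map R S f G" for G
  proof (rule extensionalityI)
    show "G \<in> extensional (carrier (K0 R))" "F \<in> extensional (carrier (K0 R))"
      using F G by (simp_all add: is_K0_map_def)
    show "G x = F x" if "x \<in> carrier (K0 R)" for x
      by (rule K0_hom_unique[OF _ _ _ _ that, of "K0 S"])
        (use F G K0_comm_group[of S] in \<open>auto simp: is_K0_map_def comm_group_def\<close>)
  qed
  then show ?thesis unfolding K0_map_def by (rule theI[of "is_K0_map R S f", OF F])
qed

lemma K0_map_K0_class:
  fixes P :: "('r, 'p) module"
  assumes P: "fg_projective R P"
  shows "K0_map R S f (K0_class R P) = K0_class S (BC P)"
proof -
  obtain Q :: "('r, nat \<Rightarrow> 'r) module" where Q: "fg_projective R Q" "module_isomorphic R P Q"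
    using fg_projective_representative[OF P] .
  have "K0_map R S f (K0_class R Q) = K0_class S (BC Q)"
    using is_K0_map_K0_map Q(1) by (simp add: is_K0_map_def)
  then show ?thesis
    using K0_class_cong[OF Q(2)] K0_class_cong[OF BC_isomorphic[OF Q(2)]] by simp
qed

end

section \<open>Complex vector spaces and linear maps\<close>

lemma complex_ring_simps [simp]:
  "carrier complex_ring = UNIV" "mult complex_ring = (*)" "one complex_ring = 1"
  "zero complex_ring = 0" "add complex_ring = (+)"
  by (simp_all add: complex_ring_def)

lemma complex_cring: "cring complex_ring"
proof (intro cringI abelian_groupI comm_monoidI)
  show "\<exists>y\<in>carrier complex_ring. y \<oplus>\<^bsub>complex_ring\<^esub> x = \<zero>\<^bsub>complex_ring\<^esub>" for x
    by (rule bexI[of _ "- x"]) simp_all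
qed (simp_all add: algebra_simps)

lemma complex_ring_ring: "ring complex_ring"
  using complex_cring by (rule cring.axioms)

lemma complex_space_iff: "complex_space V \<longleftrightarrow> left_module complex_ring V"
  using complex_cring complex_ring_ring
  by (auto simp: module_def module_axioms_def left_module_def left_module_axioms_def)

lemma space_module: "complex_space V \<Longrightarrow> left_module complex_ring V"
  by (simp add: complex_space_iff)

abbreviation CC :: "(complex, complex) module" where "CC \<equiv> regular_module complex_ring"

lemma CC_space: "complex_space CC"
  unfolding complex_space_iff by (rule left_module_regular[OF complex_ring_ring])

lemma space_smult:
  assumes "complex_space V"
  shows "x \<in> carrier V \<Longrightarrow> c \<odot>\<^bsub>V\<^esub> x \<in> carrier V"
    "x \<in> carrier V \<Longrightarrow> (a + b) \<odot>\<^bsub>V\<^esub> x = a \<odot>\<^bsub>V\<^esub> x \<oplus>\<^bsub>V\<^esub> b \<odot>\<^bsub>V\<^esub> x"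
    "\<lbrakk>x \<in> carrier V; y \<in> carrier V\<rbrakk> \<Longrightarrow> c \<odot>\<^bsub>V\<^esub> (x \<oplus>\<^bsub>V\<^esub> y) = c \<odot>\<^bsub>V\<^esub> x \<oplus>\<^bsub>V\<^esub> c \<odot>\<^bsub>V\<^esub> y"
    "x \<in> carrier V \<Longrightarrow> (a * b) \<odot>\<^bsub>V\<^esub> x = a \<odot>\<^bsub>V\<^esub> (b \<odot>\<^bsub>V\<^esub> x)"
    "x \<in> carrier V \<Longrightarrow> 1 \<odot>\<^bsub>V\<^esub> x = x"
    "x \<in> carrier V \<Longrightarrow> 0 \<odot>\<^bsub>V\<^esub> x = \<zero>\<^bsub>V\<^esub>"
    "c \<odot>\<^bsub>V\<^esub> \<zero>\<^bsub>V\<^esub> = \<zero>\<^bsub>V\<^esub>"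
proof -
  interpret module complex_ring V by fact
  show "x \<in> carrier V \<Longrightarrow> c \<odot>\<^bsub>V\<^esub> x \<in> carrier V"
    "x \<in> carrier V \<Longrightarrow> (a + b) \<odot>\<^bsub>V\<^esub> x = a \<odot>\<^bsub>V\<^esub> x \<oplus>\<^bsub>V\<^esub> b \<odot>\<^bsub>V\<^esub> x"
    "\<lbrakk>x \<in> carrier V; y \<in> carrier V\<rbrakk> \<Longrightarrow> c \<odot>\<^bsub>V\<^esub> (x \<oplus>\<^bsub>V\<^esub> y) = c \<odot>\<^bsub>V\<^esub> x \<oplus>\<^bsub>V\<^esub> c \<odot>\<^bsub>V\<^esub> y"
    "x \<in> carrier V \<Longrightarrow> (a * b) \<odot>\<^bsub>V\<^esub> x = a \<odot>\<^bsub>V\<^esub> (b \<odot>\<^bsub>V\<^esub> x)"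
    "x \<in> carrier V \<Longrightarrow> 1 \<odot>\<^bsub>V\<^esub> x = x"
    "x \<in> carrier V \<Longrightarrow> 0 \<odot>\<^bsub>V\<^esub> x = \<zero>\<^bsub>V\<^esub>"
    "c \<odot>\<^bsub>V\<^esub> \<zero>\<^bsub>V\<^esub> = \<zero>\<^bsub>V\<^esub>"
    using smult_closed smult_l_distr[of a b x] smult_r_distr[of c x y] smult_assoc1[of a b x] smult_one[of x]
      smult_l_null[of x] smult_r_null[of c]
    by simp_all
qed

lemma space_group: "complex_space V \<Longrightarrow> abelian_group V"
  by (simp add: module_def)

lemma lin_smult: "\<lbrakk>g \<in> linear_maps M N; x \<in> carrier M\<rbrakk> \<Longrightarrow> g (c \<odot>\<^bsub>M\<^esub> x) = c \<odot>\<^bsub>N\<^esub> g x"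
  by (rule module_homs_smult[where R=complex_ring]) simp_all

lemma lin_comp: "\<lbrakk>g \<in> linear_maps N K; (\<lambda>x. E x) \<in> linear_maps M N\<rbrakk> \<Longrightarrow> (\<lambda>x. g (E x)) \<in> linear_maps M K"
  by (rule module_homs_comp)

lemma lin_cong:
  assumes "g \<in> linear_maps M N" "complex_space M" "\<And>x. x \<in> carrier M \<Longrightarrow> h x = g x"
  shows "h \<in> linear_maps M N"
proof -
  interpret module complex_ring M by fact
  show ?thesis
    by (rule module_homsI)
      (simp_all add: assms(3) module_homs_closed[OF assms(1)] module_homs_add[OF assms(1)] lin_smult[OF assms(1)])
qed

lemma lin_scale:
  assumes "complex_space N" "(\<lambda>x. E x) \<in> linear_maps M N"
  shows "(\<lambda>x. c \<odot>\<^bsub>N\<^esub> E x) \<in> linear_maps M N"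
  by (rule module_homsI)
    (simp_all add: space_smult[OF assms(1)] module_homs_closed[OF assms(2)] module_homs_add[OF assms(2)]
      lin_smult[OF assms(2)] mult.commute flip: space_smult(4)[OF assms(1)])

lemma lin_scalar:
  "\<lbrakk>complex_space N; y \<in> carrier N; (\<lambda>x. E x) \<in> linear_maps M CC\<rbrakk> \<Longrightarrow>
    (\<lambda>x. E x \<odot>\<^bsub>N\<^esub> y) \<in> linear_maps M N"
  by (rule module_homs_coefficient[OF space_module])

lemma lin_zero:
  "\<lbrakk>complex_space M; complex_space N; h \<in> linear_maps M N\<rbrakk> \<Longrightarrow> h \<zero>\<^bsub>M\<^esub> = \<zero>\<^bsub>N\<^esub>"
  by (rule module_homs_zero[OF space_module space_module])

lemma lin_finsum:
  "\<lbrakk>complex_space N; finite I; \<And>i. i \<in> I \<Longrightarrow> (\<lambda>x. g i x) \<in> linear_maps M N\<rbrakk> \<Longrightarrow>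
    (\<lambda>x. \<Oplus>\<^bsub>N\<^esub>i\<in>I. g i x) \<in> linear_maps M N"
  by (rule module_homs_sum[OF space_module])

lemma lin_of_finsum:
  "\<lbrakk>complex_space M; complex_space N; h \<in> linear_maps M N; finite I; \<And>i. i \<in> I \<Longrightarrow> g i \<in> carrier M\<rbrakk> \<Longrightarrow>
    h (\<Oplus>\<^bsub>M\<^esub>i\<in>I. g i) = (\<Oplus>\<^bsub>N\<^esub>i\<in>I. h (g i))"
  by (rule module_homs_finsum[OF space_module space_module])

text \<open>
  By Zorn's lemma there is a subspace \<open>M\<close> that contains \<open>W\<close> and is maximal among those avoiding \<open>n\<close>.
  Adding any vector outside \<open>M\<close> would produce \<open>n\<close>, which means that \<open>M\<close> and the line through \<open>n\<close> span
  everything.  The functional reads off the coefficient of \<open>n\<close>.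
\<close>

lemma functional_separates:
  assumes N: "complex_space N" and W: "W \<subseteq> carrier N" "\<zero>\<^bsub>N\<^esub> \<in> W"
    "\<And>x y. \<lbrakk>x \<in> W; y \<in> W\<rbrakk> \<Longrightarrow> x \<oplus>\<^bsub>N\<^esub> y \<in> W" "\<And>c x. x \<in> W \<Longrightarrow> c \<odot>\<^bsub>N\<^esub> x \<in> W"
    and n: "n \<in> carrier N" "n \<notin> W"
  shows "\<exists>\<phi>\<in>linear_maps N CC. \<phi> n = 1 \<and> (\<forall>w\<in>W. \<phi> w = 0)"
proof -
  interpret N: module complex_ring N by (rule N)
  note sm = space_smult[OF N]
  define sub where "sub X \<longleftrightarrow> X \<subseteq> carrier N \<and> (\<forall>x\<in>X. \<forall>y\<in>X. x \<oplus>\<^bsub>N\<^esub> y \<in> X) \<and> (\<forall>c. \<forall>x\<in>X. c \<odot>\<^bsub>N\<^esub> x \<in> X)"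
    for X
  define \<A> where "\<A> = {X. sub X \<and> W \<subseteq> X \<and> n \<notin> X}"
  have "W \<in> \<A>" using W n by (auto simp: \<A>_def sub_def)
  then have ne: "\<A> \<noteq> {}" by blast
  have "\<Union>\<C> \<in> \<A>" if "\<C> \<noteq> {}" "subset.chain \<A> \<C>" for \<C>
  proof -
    have \<C>: "X \<in> \<A>" if "X \<in> \<C>" for X using \<open>subset.chain \<A> \<C>\<close> that by (auto simp: subset.chain_def)
    have "x \<oplus>\<^bsub>N\<^esub> y \<in> \<Union>\<C>" if x: "x \<in> \<Union>\<C>" and y: "y \<in> \<Union>\<C>" for x y
    proof -
      obtain X Y where XY: "X \<in> \<C>" "x \<in> X" "Y \<in> \<C>" "y \<in> Y" using x y by blast
      then have "X \<subseteq> Y \<or> Y \<subseteq> X" using \<open>subset.chain \<A> \<C>\<close> by (auto simp: subset.chain_def)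
      then show ?thesis using XY \<C>[of X] \<C>[of Y] unfolding \<A>_def sub_def by blast
    qed
    then show ?thesis using \<C> that(1) unfolding \<A>_def sub_def by blast
  qed
  from subset_Zorn_nonempty[OF ne this] obtain M where M: "M \<in> \<A>" and
    max: "\<And>X. \<lbrakk>X \<in> \<A>; M \<subseteq> X\<rbrakk> \<Longrightarrow> X = M" by blast
  have Mc: "\<And>x. x \<in> M \<Longrightarrow> x \<in> carrier N" and Madd: "\<And>x y. \<lbrakk>x \<in> M; y \<in> M\<rbrakk> \<Longrightarrow> x \<oplus>\<^bsub>N\<^esub> y \<in> M"
    and Msm: "\<And>c x. x \<in> M \<Longrightarrow> c \<odot>\<^bsub>N\<^esub> x \<in> M" and WM: "W \<subseteq> M" and nM: "n \<notin> M"
    using M by (auto simp: \<A>_def sub_def)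
  have M0: "\<zero>\<^bsub>N\<^esub> \<in> M" using W(2) WM by blast
  have cancel: "(- 1) \<odot>\<^bsub>N\<^esub> x \<oplus>\<^bsub>N\<^esub> (x \<oplus>\<^bsub>N\<^esub> y) = y" if "x \<in> carrier N" "y \<in> carrier N" for x y
  proof -
    have "(- 1) \<odot>\<^bsub>N\<^esub> x \<oplus>\<^bsub>N\<^esub> x = ((- 1) + 1) \<odot>\<^bsub>N\<^esub> x"
      using that by (subst sm(2)) (simp_all add: sm)
    then show ?thesis using that by (simp add: N.a_assoc[symmetric] sm)
  qed
  have exists: "\<exists>c m. m \<in> M \<and> x = m \<oplus>\<^bsub>N\<^esub> c \<odot>\<^bsub>N\<^esub> n" if x: "x \<in> carrier N" for x
  proof (cases "x \<in> M")
    case True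
    then show ?thesis using n by (intro exI[of _ 0] exI[of _ x]) (simp add: sm Mc)
  next
    case False
    \<comment> \<open>The subspace spanned by \<open>M\<close> and \<open>x\<close>.\<close>
    define X where "X = {m \<oplus>\<^bsub>N\<^esub> c \<odot>\<^bsub>N\<^esub> x | m c. m \<in> M}"
    have "M \<subseteq> X"
    proof
      fix m assume "m \<in> M"
      then have "m = m \<oplus>\<^bsub>N\<^esub> 0 \<odot>\<^bsub>N\<^esub> x" using x Mc by (simp add: sm)
      then show "m \<in> X" using \<open>m \<in> M\<close> unfolding X_def by blast
    qed
    moreover have "x \<in> X"
    proof -
      have "x = \<zero>\<^bsub>N\<^esub> \<oplus>\<^bsub>N\<^esub> 1 \<odot>\<^bsub>N\<^esub> x" using x by (simp add: sm)
      then show ?thesis using M0 unfolding X_def by blast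
    qed
    moreover have "sub X"
      unfolding sub_def
    proof (intro conjI ballI allI)
      show "X \<subseteq> carrier N" using x Mc by (auto simp: X_def sm)
      fix u assume "u \<in> X"
      then obtain m c where u: "u = m \<oplus>\<^bsub>N\<^esub> c \<odot>\<^bsub>N\<^esub> x" "m \<in> M" by (auto simp: X_def)
      have "d \<odot>\<^bsub>N\<^esub> u = d \<odot>\<^bsub>N\<^esub> m \<oplus>\<^bsub>N\<^esub> (d * c) \<odot>\<^bsub>N\<^esub> x" for d
        using u x Mc by (simp add: sm)
      then show "d \<odot>\<^bsub>N\<^esub> u \<in> X" for d using u Msm unfolding X_def by blast
      fix v assume "v \<in> X"
      then obtain m' c' where v: "v = m' \<oplus>\<^bsub>N\<^esub> c' \<odot>\<^bsub>N\<^esub> x" "m' \<in> M" by (auto simp: X_def)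
      have "u \<oplus>\<^bsub>N\<^esub> v = (m \<oplus>\<^bsub>N\<^esub> m') \<oplus>\<^bsub>N\<^esub> (c + c') \<odot>\<^bsub>N\<^esub> x"
        using u v x Mc by (simp add: sm N.a_ac)
      then show "u \<oplus>\<^bsub>N\<^esub> v \<in> X" using u v Madd unfolding X_def by blast
    qed
    ultimately have "n \<in> X"
      using max[of X] False WM by (auto simp: \<A>_def)
    then obtain m c where mc: "n = m \<oplus>\<^bsub>N\<^esub> c \<odot>\<^bsub>N\<^esub> x" "m \<in> M" by (auto simp: X_def)
    have "c \<noteq> 0" using mc nM x Mc by (auto simp: sm)
    have "(- 1) \<odot>\<^bsub>N\<^esub> m \<oplus>\<^bsub>N\<^esub> n = c \<odot>\<^bsub>N\<^esub> x"
      using mc x Mc cancel by (simp add: sm)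
    then have "(1 / c) \<odot>\<^bsub>N\<^esub> ((- 1) \<odot>\<^bsub>N\<^esub> m \<oplus>\<^bsub>N\<^esub> n) = x"
      using \<open>c \<noteq> 0\<close> x by (simp add: sm flip: sm(4))
    then have "x = (- 1 / c) \<odot>\<^bsub>N\<^esub> m \<oplus>\<^bsub>N\<^esub> (1 / c) \<odot>\<^bsub>N\<^esub> n"
      using mc n Mc by (simp add: sm flip: sm(4))
    then show ?thesis using mc Msm by blast
  qed
  have unique: "c = c'" if eq: "m \<oplus>\<^bsub>N\<^esub> c \<odot>\<^bsub>N\<^esub> n = m' \<oplus>\<^bsub>N\<^esub> c' \<odot>\<^bsub>N\<^esub> n" and m: "m \<in> M" "m' \<in> M" for m m' c c'
  proof (rule ccontr)
    assume ne: "c \<noteq> c'"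
    have "c \<odot>\<^bsub>N\<^esub> n = (- 1) \<odot>\<^bsub>N\<^esub> m \<oplus>\<^bsub>N\<^esub> (m' \<oplus>\<^bsub>N\<^esub> c' \<odot>\<^bsub>N\<^esub> n)"
      using cancel[of m "c \<odot>\<^bsub>N\<^esub> n"] eq m n Mc by (simp add: sm)
    also have "\<dots> = ((- 1) \<odot>\<^bsub>N\<^esub> m \<oplus>\<^bsub>N\<^esub> m') \<oplus>\<^bsub>N\<^esub> c' \<odot>\<^bsub>N\<^esub> n"
      using m n Mc by (simp add: sm N.a_assoc)
    finally have "c \<odot>\<^bsub>N\<^esub> n \<oplus>\<^bsub>N\<^esub> (- c') \<odot>\<^bsub>N\<^esub> n = ((- 1) \<odot>\<^bsub>N\<^esub> m \<oplus>\<^bsub>N\<^esub> m') \<oplus>\<^bsub>N\<^esub> (c' \<odot>\<^bsub>N\<^esub> n \<oplus>\<^bsub>N\<^esub> (- c') \<odot>\<^bsub>N\<^esub> n)"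
      using m n Mc by (simp add: sm N.a_assoc)
    also have "c' \<odot>\<^bsub>N\<^esub> n \<oplus>\<^bsub>N\<^esub> (- c') \<odot>\<^bsub>N\<^esub> n = \<zero>\<^bsub>N\<^esub>"
      using n by (simp add: sm flip: sm(2))
    finally have "(c - c') \<odot>\<^bsub>N\<^esub> n = (- 1) \<odot>\<^bsub>N\<^esub> m \<oplus>\<^bsub>N\<^esub> m'"
      using m n Mc by (simp add: sm flip: sm(2))
    then have "(1 / (c - c')) \<odot>\<^bsub>N\<^esub> ((c - c') \<odot>\<^bsub>N\<^esub> n) \<in> M"
      using m Msm Madd by metis
    then have "n \<in> M" using ne n by (simp add: sm flip: sm(4))
    then show False using nM by simp
  qed
  define \<phi> where "\<phi> x = (THE c. \<exists>m. m \<in> M \<and> x = m \<oplus>\<^bsub>N\<^esub> c \<odot>\<^bsub>N\<^esub> n)" for x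
  have \<phi>: "\<phi> (m \<oplus>\<^bsub>N\<^esub> c \<odot>\<^bsub>N\<^esub> n) = c" if "m \<in> M" for m c
    unfolding \<phi>_def by (rule the_equality) (use that unique in blast)+
  have "\<phi> \<in> linear_maps N CC"
  proof (rule module_homsI)
    fix x assume "x \<in> carrier N"
    then obtain m c where x: "x = m \<oplus>\<^bsub>N\<^esub> c \<odot>\<^bsub>N\<^esub> n" "m \<in> M" using exists by blast
    have "d \<odot>\<^bsub>N\<^esub> x = d \<odot>\<^bsub>N\<^esub> m \<oplus>\<^bsub>N\<^esub> (d * c) \<odot>\<^bsub>N\<^esub> n" for d
      using x n Mc by (simp add: sm)
    then show "\<phi> (d \<odot>\<^bsub>N\<^esub> x) = d \<odot>\<^bsub>CC\<^esub> \<phi> x" for d using x Msm by (simp add: \<phi>)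
    fix y assume "y \<in> carrier N"
    then obtain m' c' where y: "y = m' \<oplus>\<^bsub>N\<^esub> c' \<odot>\<^bsub>N\<^esub> n" "m' \<in> M" using exists by blast
    have "x \<oplus>\<^bsub>N\<^esub> y = (m \<oplus>\<^bsub>N\<^esub> m') \<oplus>\<^bsub>N\<^esub> (c + c') \<odot>\<^bsub>N\<^esub> n"
      using x y n Mc by (simp add: sm N.a_ac)
    then show "\<phi> (x \<oplus>\<^bsub>N\<^esub> y) = \<phi> x \<oplus>\<^bsub>CC\<^esub> \<phi> y" using x y Madd by (simp add: \<phi>)
  qed simp
  moreover have "\<phi> n = 1" using \<phi>[OF M0, of 1] n by (simp add: sm)
  moreover have "\<phi> w = 0" if "w \<in> W" for w
    using \<phi>[of w 0] that WM Mc n by (simp add: sm subset_iff)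
  ultimately show ?thesis by blast
qed

text \<open>
  A finite-rank operator on \<open>N\<close> with values in \<open>P\<close> that fixes all of \<open>Y\<close>.  The vectors fixed by such an
  operator \<open>E\<close> form a subspace.  If a further vector \<open>y\<close> is not among them, a functional \<open>\<psi>\<close> that vanishes on
  this subspace and has \<open>\<psi> y = 1\<close> corrects \<open>E\<close> to \<open>E + \<psi> (y - E y)\<close>, which fixes the old vectors and \<open>y\<close>.
\<close>

lemma finite_rank_reproducing:
  assumes N: "complex_space N" and "finite Y" "Y \<subseteq> P" and P: "P \<subseteq> carrier N" "\<zero>\<^bsub>N\<^esub> \<in> P"
    "\<And>x y. \<lbrakk>x \<in> P; y \<in> P\<rbrakk> \<Longrightarrow> x \<oplus>\<^bsub>N\<^esub> y \<in> P" "\<And>c x. x \<in> P \<Longrightarrow> c \<odot>\<^bsub>N\<^esub> x \<in> P"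
  shows "\<exists>(n :: nat) q \<phi>. (\<forall>k<n. q k \<in> P \<and> \<phi> k \<in> linear_maps N CC) \<and>
    (\<forall>y\<in>Y. (\<Oplus>\<^bsub>N\<^esub>k\<in>{..<n}. \<phi> k y \<odot>\<^bsub>N\<^esub> q k) = y)"
  using assms(2,3)
proof (induction Y rule: finite_induct)
  case empty
  show ?case by (intro exI[of _ 0]) simp
next
  case (insert y Y)
  interpret N: module complex_ring N by (rule N)
  note sm = space_smult[OF N]
  obtain n :: nat and q \<phi> where q: "\<And>k. k < n \<Longrightarrow> q k \<in> P" and \<phi>: "\<And>k. k < n \<Longrightarrow> \<phi> k \<in> linear_maps N CC"
    and Y: "\<And>y. y \<in> Y \<Longrightarrow> (\<Oplus>\<^bsub>N\<^esub>k\<in>{..<n}. \<phi> k y \<odot>\<^bsub>N\<^esub> q k) = y"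
    using insert by blast
  let ?E = "\<lambda>x. \<Oplus>\<^bsub>N\<^esub>k\<in>{..<n}. \<phi> k x \<odot>\<^bsub>N\<^esub> q k"
  have E: "?E \<in> linear_maps N N"
    by (rule lin_finsum[OF N]) (use q P(1) \<phi> in \<open>auto intro!: lin_scalar[OF N]\<close>)
  have y: "y \<in> P" "y \<in> carrier N" using insert P(1) by auto
  show ?case
  proof (cases "?E y = y")
    case True
    then show ?thesis using q \<phi> Y by (intro exI[of _ n] exI[of _ q] exI[of _ \<phi>]) auto
  next
    case False
    let ?W = "{w \<in> carrier N. ?E w = w}"
    have "\<exists>\<psi>\<in>linear_maps N CC. \<psi> y = 1 \<and> (\<forall>w\<in>?W. \<psi> w = 0)"
      by (rule functional_separates[OF N])
        (use False y in \<open>auto simp: module_homs_add[OF E] lin_smult[OF E] sm lin_zero[OF N N E]\<close>)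
    then obtain \<psi> where \<psi>: "\<psi> \<in> linear_maps N CC" "\<psi> y = 1" "\<And>w. w \<in> ?W \<Longrightarrow> \<psi> w = 0" by blast
    \<comment> \<open>The new term \<open>\<psi> \<otimes> (y - E y)\<close> is appended at index \<open>n\<close>.\<close>
    let ?r = "y \<oplus>\<^bsub>N\<^esub> (- 1) \<odot>\<^bsub>N\<^esub> ?E y"
    have EP: "(\<Oplus>\<^bsub>N\<^esub>k\<in>{..<m}. \<phi> k y \<odot>\<^bsub>N\<^esub> q k) \<in> P" if "m \<le> n" for m
      using that
    proof (induction m)
      case (Suc m)
      then have "(\<Oplus>\<^bsub>N\<^esub>k\<in>{..<Suc m}. \<phi> k y \<odot>\<^bsub>N\<^esub> q k) = \<phi> m y \<odot>\<^bsub>N\<^esub> q m \<oplus>\<^bsub>N\<^esub> (\<Oplus>\<^bsub>N\<^esub>k\<in>{..<m}. \<phi> k y \<odot>\<^bsub>N\<^esub> q k)"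
        unfolding lessThan_Suc using q P(1) by (subst N.finsum_insert) (auto intro!: sm(1))
      then show ?case using Suc q P(3,4) by simp
    qed (use P(2) in simp)
    have r: "?r \<in> P" using y EP[of n] P(3,4) by blast
    let ?q = "q(n := ?r)" and ?\<phi> = "\<phi>(n := \<psi>)"
    have sum: "(\<Oplus>\<^bsub>N\<^esub>k\<in>{..<Suc n}. ?\<phi> k x \<odot>\<^bsub>N\<^esub> ?q k) = \<psi> x \<odot>\<^bsub>N\<^esub> ?r \<oplus>\<^bsub>N\<^esub> ?E x" for x
    proof -
      have "(\<Oplus>\<^bsub>N\<^esub>k\<in>{..<Suc n}. ?\<phi> k x \<odot>\<^bsub>N\<^esub> ?q k) = \<psi> x \<odot>\<^bsub>N\<^esub> ?r \<oplus>\<^bsub>N\<^esub> (\<Oplus>\<^bsub>N\<^esub>k\<in>{..<n}. ?\<phi> k x \<odot>\<^bsub>N\<^esub> ?q k)"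
        unfolding lessThan_Suc using q r P(1) by (subst N.finsum_insert) (auto intro!: sm(1))
      also have "(\<Oplus>\<^bsub>N\<^esub>k\<in>{..<n}. ?\<phi> k x \<odot>\<^bsub>N\<^esub> ?q k) = ?E x"
        by (rule N.finsum_cong') (use q P(1) in \<open>auto intro!: sm(1)\<close>)
      finally show ?thesis .
    qed
    show ?thesis
    proof (intro exI[of _ "Suc n"] exI[of _ ?q] exI[of _ ?\<phi>] conjI allI impI ballI)
      fix k assume "k < Suc n"
      then show "?q k \<in> P" "?\<phi> k \<in> linear_maps N CC" using q r \<phi> \<psi> by (auto simp: less_Suc_eq)
    next
      fix x assume x: "x \<in> insert y Y"
      have Ey: "?E y \<in> carrier N" using module_homs_closed[OF E y(2)] .
      show "(\<Oplus>\<^bsub>N\<^esub>k\<in>{..<Suc n}. ?\<phi> k x \<odot>\<^bsub>N\<^esub> ?q k) = x"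
      proof (cases "x = y")
        case True
        have "?r \<oplus>\<^bsub>N\<^esub> ?E y = y \<oplus>\<^bsub>N\<^esub> ((- 1) \<odot>\<^bsub>N\<^esub> ?E y \<oplus>\<^bsub>N\<^esub> 1 \<odot>\<^bsub>N\<^esub> ?E y)"
          using y Ey by (simp add: sm N.a_assoc)
        also have "\<dots> = y" using y Ey by (subst sm(2)[symmetric]) (simp_all add: sm(6))
        finally show ?thesis unfolding sum True \<psi>(2) using y Ey by (simp add: sm)
      next
        case False
        then have "x \<in> Y" "x \<in> carrier N" using x insert P(1) by auto
        then have "x \<in> ?W" using Y by simp
        then show ?thesis unfolding sum using \<psi>(3) Y[OF \<open>x \<in> Y\<close>] \<open>x \<in> carrier N\<close> y Ey by (simp add: sm)
      qed
    qed
  qed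
qed

section \<open>Tensor products of complex vector spaces\<close>

definition bilin ::
  "(complex, 'm, 'c) module_scheme \<Rightarrow> (complex, 'n, 'd) module_scheme \<Rightarrow>
    (complex, 'k, 'e) module_scheme \<Rightarrow> ('m \<Rightarrow> 'n \<Rightarrow> 'k) \<Rightarrow> bool"
  where "bilin M N K \<phi> \<longleftrightarrow> (\<forall>x\<in>carrier M. \<phi> x \<in> linear_maps N K) \<and>
    (\<forall>y\<in>carrier N. (\<lambda>x. \<phi> x y) \<in> linear_maps M K)"

lemma bilinI:
  assumes "\<And>x. x \<in> carrier M \<Longrightarrow> (\<lambda>y. \<phi> x y) \<in> linear_maps N K"
    and "\<And>y. y \<in> carrier N \<Longrightarrow> (\<lambda>x. \<phi> x y) \<in> linear_maps M K"
  shows "bilin M N K \<phi>"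
  using assms by (simp add: bilin_def)

lemma bilin_left: "\<lbrakk>bilin M N K \<phi>; y \<in> carrier N\<rbrakk> \<Longrightarrow> (\<lambda>x. \<phi> x y) \<in> linear_maps M K"
  by (simp add: bilin_def)

lemma bilin_right: "\<lbrakk>bilin M N K \<phi>; x \<in> carrier M\<rbrakk> \<Longrightarrow> (\<lambda>y. \<phi> x y) \<in> linear_maps N K"
  by (simp add: bilin_def)

lemma bilin_closed: "\<lbrakk>bilin M N K \<phi>; x \<in> carrier M; y \<in> carrier N\<rbrakk> \<Longrightarrow> \<phi> x y \<in> carrier K"
  by (rule module_homs_closed[OF bilin_right])

lemma space_tensor_bimodule:
  assumes M: "complex_space M" and N: "complex_space N"
  shows "tensor_bimodule complex_ring complex_ring M (\<lambda>x c. c \<odot>\<^bsub>M\<^esub> x) N"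
  by (intro tensor_bimodule.intro tensor_data.intro tensor_bimodule_axioms.intro space_group
      M[unfolded complex_space_iff] M N)
    (simp_all add: space_smult[OF M] space_smult[OF N] mult.commute flip: space_smult(4)[OF M])

context
  fixes M :: "(complex, 'm, 'c) module_scheme" and N :: "(complex, 'n, 'd) module_scheme"
  assumes M: "complex_space M" and N: "complex_space N"
begin

interpretation t: tensor_bimodule complex_ring complex_ring M "\<lambda>x c. c \<odot>\<^bsub>M\<^esub> x" N
  by (rule space_tensor_bimodule[OF M N])

lemma tensorC_space: "complex_space (tensorC M N)"
  unfolding complex_space_iff tensorC_def by (rule t.TM_left_module)

lemma pureC_bilin: "bilin M N (tensorC M N) (pureC M N)"
  by (intro bilinI module_homsI)
    (simp_all add: pureC_def tensorC_def t.TM_pure_closed t.TM_pure_add_left t.TM_pure_add_right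
      t.TM_smult_pure flip: t.TM_pure_balanced)

lemmas tensorC_induct [consumes 1, case_names zero pure add] =
  t.TM_induct[folded tensorC_def pureC_def]

context
  fixes K :: "(complex, 'k, 'e) module_scheme" and \<phi>
  assumes K: "complex_space K" and \<phi>: "bilin M N K \<phi>"
begin

lemma bilin_balanced: "t.balanced K \<phi>"
  by (rule t.balancedI)
    (simp_all add: bilin_closed[OF \<phi>] module_homs_add[OF bilin_left[OF \<phi>]] module_homs_add[OF bilin_right[OF \<phi>]]
      lin_smult[OF bilin_left[OF \<phi>]] lin_smult[OF bilin_right[OF \<phi>]])

lemma lift_pureC: "\<lbrakk>x \<in> carrier M; y \<in> carrier N\<rbrakk> \<Longrightarrow> tensor_lift K \<phi> (pureC M N x y) = \<phi> x y"
  using t.lift_pure[OF space_group[OF K] bilin_balanced] by (simp add: pureC_def)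

lemma lift_linear: "tensor_lift K \<phi> \<in> linear_maps (tensorC M N) K"
proof -
  have h: "tensor_lift K \<phi> \<in> add_homs (tensorC M N) K"
    using t.lift_hom[OF space_group[OF K] bilin_balanced] by (simp add: add_homs_def tensorC_def t.TM_simps)
  interpret T: left_module complex_ring "tensorC M N" by (rule tensorC_space[unfolded complex_space_iff])
  show ?thesis
  proof (rule module_homsI)
    fix c u assume "u \<in> carrier (tensorC M N)"
    then show "tensor_lift K \<phi> (c \<odot>\<^bsub>tensorC M N\<^esub> u) = c \<odot>\<^bsub>K\<^esub> tensor_lift K \<phi> u"
    proof (induction rule: tensorC_induct)
      case zero
      then show ?case
        by (simp add: space_smult[OF tensorC_space] space_smult[OF K]
            add_homs_zero[OF space_group[OF tensorC_space] space_group[OF K] h])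
    next
      case (pure x y)
      then have "c \<odot>\<^bsub>tensorC M N\<^esub> pureC M N x y = pureC M N (c \<odot>\<^bsub>M\<^esub> x) y"
        by (simp add: lin_smult[OF bilin_left[OF pureC_bilin]])
      then show ?case using pure by (simp add: lift_pureC space_smult[OF M] lin_smult[OF bilin_left[OF \<phi>]])
    next
      case (add v w)
      then show ?case
        by (simp add: space_smult[OF tensorC_space] space_smult[OF K] add_homs_add[OF h] add_homs_closed[OF h])
    qed
  qed (use add_homs_closed[OF h] add_homs_add[OF h] in auto)
qed

lemma lift_closed: "t \<in> carrier (tensorC M N) \<Longrightarrow> tensor_lift K \<phi> t \<in> carrier K"
  by (rule module_homs_closed[OF lift_linear])

end

lemma tensorC_ext:
  assumes K: "complex_space K" and g: "g \<in> linear_maps (tensorC M N) K" and h: "h \<in> linear_maps (tensorC M N) K"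
    and eq: "\<And>x y. \<lbrakk>x \<in> carrier M; y \<in> carrier N\<rbrakk> \<Longrightarrow> g (pureC M N x y) = h (pureC M N x y)"
    and t: "t \<in> carrier (tensorC M N)"
  shows "g t = h t"
  using t
proof (induction rule: tensorC_induct)
  case zero
  show ?case
    using lin_zero[OF tensorC_space K] g h by metis
next
  case (add v w)
  then show ?case by (simp add: module_homs_add[OF g] module_homs_add[OF h])
qed (rule eq)

lemma lift_cong:
  assumes K: "complex_space K" and \<phi>: "bilin M N K \<phi>"
    and eq: "\<And>x y. \<lbrakk>x \<in> carrier M; y \<in> carrier N\<rbrakk> \<Longrightarrow> \<psi> x y = \<phi> x y"
    and t: "t \<in> carrier (tensorC M N)"
  shows "tensor_lift K \<psi> t = tensor_lift K \<phi> t"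
proof (rule tensorC_ext[OF K _ lift_linear[OF K \<phi>] _ t])
  have \<psi>: "bilin M N K \<psi>"
    by (rule bilinI) (rule lin_cong[OF bilin_right[OF \<phi>] N], simp_all add: eq lin_cong[OF bilin_left[OF \<phi>] M])
  show "tensor_lift K \<psi> \<in> linear_maps (tensorC M N) K" by (rule lift_linear[OF K \<psi>])
  show "tensor_lift K \<psi> (pureC M N x y) = tensor_lift K \<phi> (pureC M N x y)"
    if "x \<in> carrier M" "y \<in> carrier N" for x y
    using that by (simp add: lift_pureC[OF K \<phi>] lift_pureC[OF K \<psi>] eq)
qed

lemma bilin_comp:
  "\<lbrakk>bilin M N K \<phi>; g \<in> linear_maps K L\<rbrakk> \<Longrightarrow> bilin M N L (\<lambda>x y. g (\<phi> x y))"
  by (auto simp: bilin_def intro: lin_comp)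

lemma lift_comp:
  assumes K: "complex_space K" and L: "complex_space L" and \<phi>: "bilin M N K \<phi>" and g: "g \<in> linear_maps K L"
    and t: "t \<in> carrier (tensorC M N)"
  shows "g (tensor_lift K \<phi> t) = tensor_lift L (\<lambda>x y. g (\<phi> x y)) t"
  by (rule tensorC_ext[OF L lin_comp[OF g lift_linear[OF K \<phi>]] lift_linear[OF L bilin_comp[OF \<phi> g]] _ t])
    (simp add: lift_pureC[OF K \<phi>] lift_pureC[OF L bilin_comp[OF \<phi> g]])

lemma lift_pureC_id: "t \<in> carrier (tensorC M N) \<Longrightarrow> tensor_lift (tensorC M N) (pureC M N) t = t"
  by (rule tensorC_ext[OF tensorC_space lift_linear[OF tensorC_space pureC_bilin] module_homs_id])
    (simp_all add: lift_pureC[OF tensorC_space pureC_bilin])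

text \<open>
  Sums over a tensor depend linearly on parameters in the summand.  Iterated Sweedler sums are nested
  lifts in which the inner lift depends on the variables of the outer one, so this is the rule that makes them
  multilinear.
\<close>

lemma lin_lift_param:
  assumes t: "t \<in> carrier (tensorC M N)" and K: "complex_space K" and P: "complex_space P"
    and \<phi>: "\<And>p. p \<in> carrier P \<Longrightarrow> bilin M N K (\<phi> p)"
    and lin: "\<And>x y. \<lbrakk>x \<in> carrier M; y \<in> carrier N\<rbrakk> \<Longrightarrow> (\<lambda>p. \<phi> p x y) \<in> linear_maps P K"
  shows "(\<lambda>p. tensor_lift K (\<phi> p) t) \<in> linear_maps P K"
  using t
proof (induction rule: tensorC_induct)
  interpret K: module complex_ring K by (rule K)
  case zero
  have "tensor_lift K (\<phi> p) \<zero>\<^bsub>tensorC M N\<^esub> = \<zero>\<^bsub>K\<^esub>" if "p \<in> carrier P" for p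
    using lin_zero[OF tensorC_space K
        lift_linear[OF K \<phi>[OF that]]] .
  moreover have "(\<lambda>_. \<zero>\<^bsub>K\<^esub>) \<in> linear_maps P K"
    by (rule module_homsI) (simp_all add: space_smult[OF K])
  ultimately show ?case by (rule lin_cong[OF _ P, rotated])
next
  case (pure x y)
  show ?case by (rule lin_cong[OF lin[OF pure] P]) (simp add: lift_pureC[OF K \<phi>] pure)
next
  interpret K: module complex_ring K by (rule K)
  case (add v w)
  have "(\<lambda>p. tensor_lift K (\<phi> p) v \<oplus>\<^bsub>K\<^esub> tensor_lift K (\<phi> p) w) \<in> linear_maps P K"
    by (rule module_homsI)
      (use add(3,4)[THEN module_homs_closed] in
        \<open>simp_all add: add(3,4)[THEN module_homs_add] add(3,4)[THEN lin_smult] space_smult[OF K] K.a_ac\<close>)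
  then show ?case
    by (rule lin_cong[OF _ P]) (simp add: module_homs_add[OF lift_linear[OF K \<phi>]] add(1,2))
qed

end

lemma lin_pure_left:
  "\<lbrakk>complex_space M; complex_space N; y \<in> carrier N; (\<lambda>p. E p) \<in> linear_maps P M\<rbrakk> \<Longrightarrow>
    (\<lambda>p. pureC M N (E p) y) \<in> linear_maps P (tensorC M N)"
  by (rule lin_comp[OF bilin_left[OF pureC_bilin]])

lemma lin_pure_right:
  "\<lbrakk>complex_space M; complex_space N; x \<in> carrier M; (\<lambda>p. E p) \<in> linear_maps P N\<rbrakk> \<Longrightarrow>
    (\<lambda>p. pureC M N x (E p)) \<in> linear_maps P (tensorC M N)"
  by (rule lin_comp[OF bilin_right[OF pureC_bilin]])

lemma lin_lift:
  "\<lbrakk>(\<lambda>p. E p) \<in> linear_maps P (tensorC M N); complex_space M; complex_space N; complex_space K; bilin M N K \<phi>\<rbrakk> \<Longrightarrow>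
    (\<lambda>p. tensor_lift K \<phi> (E p)) \<in> linear_maps P K"
  by (rule lin_comp[OF lift_linear])

lemma pureC_closed:
  "\<lbrakk>complex_space M; complex_space N; x \<in> carrier M; y \<in> carrier N\<rbrakk> \<Longrightarrow> pureC M N x y \<in> carrier (tensorC M N)"
  by (rule bilin_closed[OF pureC_bilin])

lemma lift_closed':
  "\<lbrakk>t \<in> carrier (tensorC M N); complex_space M; complex_space N; complex_space K; bilin M N K \<phi>\<rbrakk> \<Longrightarrow>
    tensor_lift K \<phi> t \<in> carrier K"
  by (rule lift_closed)

text \<open>
  Fubini for Sweedler sums over two independent tensors.  Both sides are linear in \<open>t\<close>, and for a pure
  tensor \<open>t\<close> they agree.
\<close>

lemma lift_swap:
  assumes M: "complex_space M" and N: "complex_space N" and P: "complex_space P" and Q: "complex_space Q"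
    and K: "complex_space K"
    and t: "t \<in> carrier (tensorC M N)" and s: "s \<in> carrier (tensorC P Q)"
    and 1: "\<And>x y. \<lbrakk>x \<in> carrier M; y \<in> carrier N\<rbrakk> \<Longrightarrow> bilin P Q K (\<phi> x y)"
    and 2: "\<And>u v. \<lbrakk>u \<in> carrier P; v \<in> carrier Q\<rbrakk> \<Longrightarrow> bilin M N K (\<lambda>x y. \<phi> x y u v)"
  shows "tensor_lift K (\<lambda>x y. tensor_lift K (\<phi> x y) s) t = tensor_lift K (\<lambda>u v. tensor_lift K (\<lambda>x y. \<phi> x y u v) t) s"
proof -
  have b: "bilin M N K (\<lambda>x y. tensor_lift K (\<phi> x y) s)"
    by (rule bilinI; rule lin_lift_param[OF P Q s K])
      (simp_all add: 1 M N bilin_right[OF 2] bilin_left[OF 2])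
  have l: "(\<lambda>t. tensor_lift K (\<lambda>u v. tensor_lift K (\<lambda>x y. \<phi> x y u v) t) s) \<in> linear_maps (tensorC M N) K"
  proof (rule lin_lift_param[OF P Q s K tensorC_space[OF M N]])
    show "(\<lambda>t. tensor_lift K (\<lambda>x y. \<phi> x y u v) t) \<in> linear_maps (tensorC M N) K"
      if "u \<in> carrier P" "v \<in> carrier Q" for u v
      by (rule lift_linear[OF M N K 2[OF that]])
    show "bilin P Q K (\<lambda>u v. tensor_lift K (\<lambda>x y. \<phi> x y u v) t)" if t: "t \<in> carrier (tensorC M N)" for t
      by (rule bilinI; rule lin_lift_param[OF M N t K])
        (simp_all add: P Q 2 bilin_right[OF 1] bilin_left[OF 1])
  qed
  show ?thesis
  proof (rule tensorC_ext[OF M N K lift_linear[OF M N K b] l _ t])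
    fix x y assume xy: "x \<in> carrier M" "y \<in> carrier N"
    have "tensor_lift K (\<lambda>x y. tensor_lift K (\<phi> x y) s) (pureC M N x y) = tensor_lift K (\<phi> x y) s"
      by (rule lift_pureC[OF M N K b xy])
    also have "\<dots> = tensor_lift K (\<lambda>u v. tensor_lift K (\<lambda>x y. \<phi> x y u v) (pureC M N x y)) s"
      by (rule lift_cong[OF P Q K 1[OF xy] _ s, symmetric]) (simp add: lift_pureC[OF M N K 2] xy)
    finally show "tensor_lift K (\<lambda>x y. tensor_lift K (\<phi> x y) s) (pureC M N x y) =
      tensor_lift K (\<lambda>u v. tensor_lift K (\<lambda>x y. \<phi> x y u v) (pureC M N x y)) s" .
  qed
qed

section \<open>Maps between tensor products and Sweedler sums\<close>

lemma tensor_map_bilin: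
  assumes "complex_space M" "complex_space N" "f \<in> linear_maps P M" "g \<in> linear_maps Q N"
  shows "bilin P Q (tensorC M N) (\<lambda>x y. pureC M N (f x) (g y))"
  by (intro bilinI lin_pure_left lin_pure_right assms module_homs_closed[OF assms(3)] module_homs_closed[OF assms(4)])

context
  fixes P :: "(complex, 'p, 'a) module_scheme" and Q :: "(complex, 'q, 'b) module_scheme"
    and M :: "(complex, 'm, 'c) module_scheme" and N :: "(complex, 'n, 'd) module_scheme" and f g
  assumes sp: "complex_space P" "complex_space Q" "complex_space M" "complex_space N"
    and f: "f \<in> linear_maps P M" and g: "g \<in> linear_maps Q N"
begin

lemma tensor_map_pure: "\<lbrakk>x \<in> carrier P; y \<in> carrier Q\<rbrakk> \<Longrightarrow>
    tensor_map M N f g (pureC P Q x y) = pureC M N (f x) (g y)"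
  unfolding tensor_map_def
  by (rule lift_pureC[OF sp(1,2) tensorC_space[OF sp(3,4)] tensor_map_bilin[OF sp(3,4) f g]])

lemma tensor_map_linear: "tensor_map M N f g \<in> linear_maps (tensorC P Q) (tensorC M N)"
  unfolding tensor_map_def
  by (rule lift_linear[OF sp(1,2) tensorC_space[OF sp(3,4)] tensor_map_bilin[OF sp(3,4) f g]])

lemma bilin_precomp:
  assumes "bilin M N K \<phi>" shows "bilin P Q K (\<lambda>x y. \<phi> (f x) (g y))"
proof (rule bilinI)
  show "(\<lambda>y. \<phi> (f x) (g y)) \<in> linear_maps Q K" if "x \<in> carrier P" for x
    by (rule lin_comp[OF bilin_right[OF assms module_homs_closed[OF f that]] g])
  show "(\<lambda>x. \<phi> (f x) (g y)) \<in> linear_maps P K" if "y \<in> carrier Q" for y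
    by (rule lin_comp[OF bilin_left[OF assms module_homs_closed[OF g that]] f])
qed

lemma lift_tensor_map:
  assumes K: "complex_space K" and \<phi>: "bilin M N K \<phi>" and t: "t \<in> carrier (tensorC P Q)"
  shows "tensor_lift K \<phi> (tensor_map M N f g t) = tensor_lift K (\<lambda>x y. \<phi> (f x) (g y)) t"
  by (rule tensorC_ext[OF sp(1,2) K lin_comp[OF lift_linear[OF sp(3,4) K \<phi>] tensor_map_linear]
        lift_linear[OF sp(1,2) K bilin_precomp[OF \<phi>]] _ t])
    (simp add: tensor_map_pure lift_pureC[OF sp(3,4) K \<phi>] module_homs_closed[OF f] module_homs_closed[OF g]
      lift_pureC[OF sp(1,2) K bilin_precomp[OF \<phi>]])

end

lemma lin_id: "id \<in> linear_maps M M"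
  using module_homs_id[of complex_ring M] by (simp add: id_def)

context
  fixes L :: "(complex, 'l, 'b) module_scheme" and M :: "(complex, 'm, 'c) module_scheme"
    and N :: "(complex, 'n, 'd) module_scheme"
  assumes sp: "complex_space L" "complex_space M" "complex_space N"
begin

lemma assoc_inner_bilin:
  assumes "z \<in> carrier N"
  shows "bilin L M (tensorC L (tensorC M N)) (\<lambda>x y. pureC L (tensorC M N) x (pureC M N y z))"
  using assms by (intro bilinI lin_pure_right lin_pure_left sp tensorC_space module_homs_id pureC_closed)

lemma assoc_outer_bilin:
  "bilin (tensorC L M) N (tensorC L (tensorC M N))
    (\<lambda>t z. tensor_lift (tensorC L (tensorC M N)) (\<lambda>x y. pureC L (tensorC M N) x (pureC M N y z)) t)"
proof (rule bilinI)
  fix t assume "t \<in> carrier (tensorC L M)"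
  then show "(\<lambda>z. tensor_lift (tensorC L (tensorC M N)) (\<lambda>x y. pureC L (tensorC M N) x (pureC M N y z)) t)
      \<in> linear_maps N (tensorC L (tensorC M N))"
    by (rule lin_lift_param[OF sp(1,2) _ tensorC_space[OF sp(1) tensorC_space[OF sp(2,3)]] sp(3)])
      (auto intro!: assoc_inner_bilin lin_pure_right sp tensorC_space module_homs_id)
qed (rule lift_linear[OF sp(1,2) tensorC_space[OF sp(1) tensorC_space[OF sp(2,3)]] assoc_inner_bilin])

lemma tensor_assoc_linear:
  "tensor_assoc L M N \<in> linear_maps (tensorC (tensorC L M) N) (tensorC L (tensorC M N))"
  unfolding tensor_assoc_def Let_def
  by (intro lift_linear tensorC_space sp assoc_outer_bilin)

lemma tensor_assoc_pure:
  assumes "s \<in> carrier (tensorC L M)" "z \<in> carrier N"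
  shows "tensor_assoc L M N (pureC (tensorC L M) N s z) =
    tensor_lift (tensorC L (tensorC M N)) (\<lambda>x y. pureC L (tensorC M N) x (pureC M N y z)) s"
  unfolding tensor_assoc_def Let_def
  by (rule lift_pureC) (intro tensorC_space sp assoc_outer_bilin assms)+

end

definition trilin ::
  "(complex, 'l, 'b) module_scheme \<Rightarrow> (complex, 'm, 'c) module_scheme \<Rightarrow> (complex, 'n, 'd) module_scheme \<Rightarrow>
    (complex, 'k, 'e) module_scheme \<Rightarrow> ('l \<Rightarrow> 'm \<Rightarrow> 'n \<Rightarrow> 'k) \<Rightarrow> bool"
  where "trilin L M N K \<Phi> \<longleftrightarrow> (\<forall>a\<in>carrier L. bilin M N K (\<Phi> a)) \<and>
    (\<forall>b\<in>carrier M. \<forall>c\<in>carrier N. (\<lambda>a. \<Phi> a b c) \<in> linear_maps L K)"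

lemma trilinI:
  assumes "\<And>b c. \<lbrakk>b \<in> carrier M; c \<in> carrier N\<rbrakk> \<Longrightarrow> (\<lambda>a. \<Phi> a b c) \<in> linear_maps L K"
    and "\<And>a c. \<lbrakk>a \<in> carrier L; c \<in> carrier N\<rbrakk> \<Longrightarrow> (\<lambda>b. \<Phi> a b c) \<in> linear_maps M K"
    and "\<And>a b. \<lbrakk>a \<in> carrier L; b \<in> carrier M\<rbrakk> \<Longrightarrow> (\<lambda>c. \<Phi> a b c) \<in> linear_maps N K"
  shows "trilin L M N K \<Phi>"
  using assms by (auto simp: trilin_def intro!: bilinI)

context
  fixes L :: "(complex, 'l, 'b) module_scheme" and M :: "(complex, 'm, 'c) module_scheme"
    and N :: "(complex, 'n, 'd) module_scheme" and K :: "(complex, 'k, 'e) module_scheme" and \<Phi>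
  assumes sp: "complex_space L" "complex_space M" "complex_space N" and K: "complex_space K"
    and \<Phi>: "trilin L M N K \<Phi>"
begin

lemma trilin_bilin:
  "a \<in> carrier L \<Longrightarrow> bilin M N K (\<Phi> a)" "c \<in> carrier N \<Longrightarrow> bilin L M K (\<lambda>a b. \<Phi> a b c)"
  "\<lbrakk>b \<in> carrier M; c \<in> carrier N\<rbrakk> \<Longrightarrow> (\<lambda>a. \<Phi> a b c) \<in> linear_maps L K"
  "\<lbrakk>a \<in> carrier L; b \<in> carrier M\<rbrakk> \<Longrightarrow> (\<lambda>c. \<Phi> a b c) \<in> linear_maps N K"
  using \<Phi> by (auto simp: trilin_def bilin_def)

lemma lift3_bilin: "bilin L (tensorC M N) K (\<lambda>a w. tensor_lift K (\<Phi> a) w)"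
proof (rule bilinI)
  fix w assume "w \<in> carrier (tensorC M N)"
  then show "(\<lambda>a. tensor_lift K (\<Phi> a) w) \<in> linear_maps L K"
    by (rule lin_lift_param[OF sp(2,3) _ K sp(1)]) (simp_all add: trilin_bilin)
qed (rule lift_linear[OF sp(2,3) K trilin_bilin(1)])

lemma nested_bilin:
  assumes D: "D \<in> linear_maps X (tensorC L M)"
  shows "bilin X N K (\<lambda>x c. tensor_lift K (\<lambda>a b. \<Phi> a b c) (D x))"
proof (rule bilinI)
  fix x assume "x \<in> carrier X"
  then have "D x \<in> carrier (tensorC L M)" by (rule module_homs_closed[OF D])
  then show "(\<lambda>c. tensor_lift K (\<lambda>a b. \<Phi> a b c) (D x)) \<in> linear_maps N K"
    by (rule lin_lift_param[OF sp(1,2) _ K sp(3)]) (simp_all add: trilin_bilin)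
next
  fix c assume "c \<in> carrier N"
  then show "(\<lambda>x. tensor_lift K (\<lambda>a b. \<Phi> a b c) (D x)) \<in> linear_maps X K"
    by (intro lin_comp[OF lift_linear D] sp K trilin_bilin)
qed

text \<open>
  In Sweedler notation, with \<open>t = \<Sum> x \<otimes> c\<close>, the tensor on the left is \<open>\<Sum> D(x)\<^sub>1 \<otimes> (D(x)\<^sub>2 \<otimes> c)\<close>; summing
  \<open>\<Phi>\<close> over it is an iterated sum, first over \<open>t\<close> and then over \<open>D x\<close>.
\<close>

lemma lift3_assoc_map:
  assumes X: "complex_space X" and D: "D \<in> linear_maps X (tensorC L M)" and t: "t \<in> carrier (tensorC X N)"
  shows "tensor_lift K (\<lambda>a w. tensor_lift K (\<Phi> a) w) (tensor_assoc L M N (tensor_map (tensorC L M) N D id t)) =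
    tensor_lift K (\<lambda>x c. tensor_lift K (\<lambda>a b. \<Phi> a b c) (D x)) t"
proof -
  note LM = tensorC_space[OF sp(1,2)] and MN = tensorC_space[OF sp(2,3)]
  note LMN = tensorC_space[OF sp(1) MN]
  let ?l3 = "\<lambda>u. tensor_lift K (\<lambda>a w. tensor_lift K (\<Phi> a) w) u"
  have l3: "?l3 \<in> linear_maps (tensorC L (tensorC M N)) K"
    by (rule lift_linear[OF sp(1) MN K lift3_bilin])
  note in1 = assoc_inner_bilin[OF sp] and as = tensor_assoc_linear[OF sp]
  note b = nested_bilin[OF D]
  show ?thesis
  proof (rule tensorC_ext[OF X sp(3) K _ lift_linear[OF X sp(3) K b] _ t])
    show "(\<lambda>t. ?l3 (tensor_assoc L M N (tensor_map (tensorC L M) N D id t))) \<in> linear_maps (tensorC X N) K"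
      by (intro lin_comp[OF l3] lin_comp[OF as] tensor_map_linear X sp LM D lin_id)
    fix x c assume xc: "x \<in> carrier X" "c \<in> carrier N"
    have Dx: "D x \<in> carrier (tensorC L M)" using xc(1) by (rule module_homs_closed[OF D])
    have "?l3 (tensor_assoc L M N (tensor_map (tensorC L M) N D id (pureC X N x c))) =
        ?l3 (tensor_lift (tensorC L (tensorC M N)) (\<lambda>x y. pureC L (tensorC M N) x (pureC M N y c)) (D x))"
      using xc Dx by (simp add: tensor_map_pure[OF X sp(3) LM sp(3) D lin_id] 
          tensor_assoc_pure[OF sp])
    also have "\<dots> = tensor_lift K (\<lambda>x y. ?l3 (pureC L (tensorC M N) x (pureC M N y c))) (D x)"
      by (rule lift_comp[OF sp(1,2) LMN K in1[OF xc(2)] l3 Dx])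
    also have "\<dots> = tensor_lift K (\<lambda>a b. \<Phi> a b c) (D x)"
      by (rule lift_cong[OF sp(1,2) K _ _ Dx])
        (simp_all add: xc lift_pureC[OF sp(1) MN K lift3_bilin] lift_pureC[OF sp(2,3) K] trilin_bilin
          pureC_closed[OF sp(2,3)])
    also have "\<dots> = tensor_lift K (\<lambda>x c. tensor_lift K (\<lambda>a b. \<Phi> a b c) (D x)) (pureC X N x c)"
      by (rule lift_pureC[OF X sp(3) K b xc, symmetric])
    finally show "?l3 (tensor_assoc L M N (tensor_map (tensorC L M) N D id (pureC X N x c))) =
      tensor_lift K (\<lambda>x c. tensor_lift K (\<lambda>a b. \<Phi> a b c) (D x)) (pureC X N x c)" .
  qed
qed

lemma lift3_map:
  assumes X: "complex_space X" and D: "D \<in> linear_maps X (tensorC M N)" and t: "t \<in> carrier (tensorC L X)"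
  shows "tensor_lift K (\<lambda>a w. tensor_lift K (\<Phi> a) w) (tensor_map L (tensorC M N) id D t) =
    tensor_lift K (\<lambda>a x. tensor_lift K (\<Phi> a) (D x)) t"
  using lift_tensor_map[OF sp(1) X sp(1) tensorC_space[OF sp(2,3)] lin_id D K lift3_bilin t] by simp

end

lemma lift_comp_nested:
  assumes sp: "complex_space L" "complex_space M" "complex_space N"
    and K: "complex_space K" and K': "complex_space K'" and X: "complex_space X"
    and \<Phi>: "trilin L M N K \<Phi>" and D: "D \<in> linear_maps X (tensorC L M)" and F: "F \<in> linear_maps K K'"
    and F\<Phi>: "\<And>a b c. \<lbrakk>a \<in> carrier L; b \<in> carrier M; c \<in> carrier N\<rbrakk> \<Longrightarrow> F (\<Phi> a b c) = \<Phi>' a b c"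
    and t: "t \<in> carrier (tensorC X N)"
  shows "F (tensor_lift K (\<lambda>x c. tensor_lift K (\<lambda>a b. \<Phi> a b c) (D x)) t) =
    tensor_lift K' (\<lambda>x c. tensor_lift K' (\<lambda>a b. \<Phi>' a b c) (D x)) t"
proof -
  note b = nested_bilin[OF sp K \<Phi> D] and tb = trilin_bilin[OF sp K \<Phi>]
  have "F (tensor_lift K (\<lambda>x c. tensor_lift K (\<lambda>a b. \<Phi> a b c) (D x)) t) =
      tensor_lift K' (\<lambda>x c. F (tensor_lift K (\<lambda>a b. \<Phi> a b c) (D x))) t"
    by (rule lift_comp[OF X sp(3) K K' b F t])
  also have "\<dots> = tensor_lift K' (\<lambda>x c. tensor_lift K' (\<lambda>a b. \<Phi>' a b c) (D x)) t"
  proof (rule lift_cong[OF X sp(3) K' bilin_comp[OF X sp(3) b F] _ t, symmetric])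
    fix x c assume x: "x \<in> carrier X" and c: "c \<in> carrier N"
    note Dx = module_homs_closed[OF D x]
    show "tensor_lift K' (\<lambda>a b. \<Phi>' a b c) (D x) = F (tensor_lift K (\<lambda>a b. \<Phi> a b c) (D x))"
      unfolding lift_comp[OF sp(1,2) K K' tb(2)[OF c] F Dx]
      by (rule lift_cong[OF sp(1,2) K' bilin_comp[OF sp(1,2) tb(2)[OF c] F] _ Dx]) (simp add: F\<Phi> c)
  qed
  finally show ?thesis .
qed

text \<open>
  The principle behind all Sweedler computations below.  Coassociativity of a comodule, membership in a
  cotensor product and both colinearity conditions of a strong connection are equations of the form
  \<open>(D \<otimes> id) t = (id \<otimes> D') t'\<close>.  Such an equation allows one iterated sum of an arbitrary trilinear
  expression to be replaced by the other.
\<close>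

lemma lift_coassoc:
  assumes "complex_space L" "complex_space M" "complex_space N" "complex_space K" "complex_space X" "complex_space Y"
    and "D \<in> linear_maps X (tensorC L M)" "D' \<in> linear_maps Y (tensorC M N)"
    and "t \<in> carrier (tensorC X N)" "t' \<in> carrier (tensorC L Y)"
    and eq: "tensor_assoc L M N (tensor_map (tensorC L M) N D id t) = tensor_map L (tensorC M N) id D' t'"
    and "trilin L M N K \<Phi>"
  shows "tensor_lift K (\<lambda>x c. tensor_lift K (\<lambda>a b. \<Phi> a b c) (D x)) t =
    tensor_lift K (\<lambda>a y. tensor_lift K (\<Phi> a) (D' y)) t'"
  using assms lift3_assoc_map[of L M N K \<Phi> X D t] lift3_map[of L M N K \<Phi> Y D' t'] by simp

text \<open>
  A linear map on \<open>M \<otimes> N\<close> is the lift of its values on pure tensors, so an expression in \<open>a\<close> and an element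
  of \<open>M \<otimes> N\<close> may be treated as a trilinear one.
\<close>

lemma lift_uncurry:
  assumes sp: "complex_space L" "complex_space M" "complex_space N" and K: "complex_space K"
    and g: "bilin L (tensorC M N) K g"
  shows "trilin L M N K (\<lambda>a b c. g a (pureC M N b c))"
    and "u \<in> carrier (tensorC L (tensorC M N)) \<Longrightarrow>
      tensor_lift K (\<lambda>a w. tensor_lift K (\<lambda>b c. g a (pureC M N b c)) w) u = tensor_lift K g u"
proof -
  note MN = tensorC_space[OF sp(2,3)]
  have b: "bilin M N K (\<lambda>b c. g a (pureC M N b c))" if "a \<in> carrier L" for a
    by (rule bilin_comp[OF sp(2,3) pureC_bilin[OF sp(2,3)] bilin_right[OF g that]])
  show tri: "trilin L M N K (\<lambda>a b c. g a (pureC M N b c))"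
    using b bilin_left[OF g pureC_closed[OF sp(2,3)]] by (simp add: trilin_def)
  show "tensor_lift K (\<lambda>a w. tensor_lift K (\<lambda>b c. g a (pureC M N b c)) w) u = tensor_lift K g u"
    if u: "u \<in> carrier (tensorC L (tensorC M N))"
  proof (rule lift_cong[OF sp(1) MN K g _ u])
    fix a w assume a: "a \<in> carrier L" and w: "w \<in> carrier (tensorC M N)"
    show "tensor_lift K (\<lambda>b c. g a (pureC M N b c)) w = g a w"
      using lift_comp[OF sp(2,3) MN K pureC_bilin[OF sp(2,3)] bilin_right[OF g a] w]
      by (simp add: lift_pureC_id[OF sp(2,3) w])
  qed
qed

lemma lift_assoc_map:
  assumes sp: "complex_space L" "complex_space M" "complex_space N" and K: "complex_space K"
    and X: "complex_space X" and D: "D \<in> linear_maps X (tensorC L M)" and t: "t \<in> carrier (tensorC X N)"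
    and g: "bilin L (tensorC M N) K g"
  shows "tensor_lift K g (tensor_assoc L M N (tensor_map (tensorC L M) N D id t)) =
    tensor_lift K (\<lambda>x c. tensor_lift K (\<lambda>a b. g a (pureC M N b c)) (D x)) t"
proof -
  have "tensor_assoc L M N (tensor_map (tensorC L M) N D id t) \<in> carrier (tensorC L (tensorC M N))"
    using module_homs_closed[OF tensor_assoc_linear[OF sp]
        module_homs_closed[OF tensor_map_linear[OF X sp(3) tensorC_space[OF sp(1,2)] sp(3) D lin_id] t]] .
  from lift_uncurry(2)[OF sp K g this] show ?thesis
    using lift3_assoc_map[OF sp K lift_uncurry(1)[OF sp K g] X D t] by simp
qed

lemma tensor_flip_bilin:
  assumes "complex_space M" "complex_space N" shows "bilin M N (tensorC N M) (\<lambda>x y. pureC N M y x)"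
  by (intro bilinI lin_pure_left lin_pure_right assms module_homs_id)

lemma tensor_flip_linear:
  "\<lbrakk>complex_space M; complex_space N\<rbrakk> \<Longrightarrow> tensor_flip M N \<in> linear_maps (tensorC M N) (tensorC N M)"
  unfolding tensor_flip_def by (intro lift_linear tensorC_space tensor_flip_bilin)

lemma lift_tensor_flip:
  assumes M: "complex_space M" and N: "complex_space N" and K: "complex_space K"
    and \<phi>: "bilin N M K \<phi>" and t: "t \<in> carrier (tensorC M N)"
  shows "tensor_lift K \<phi> (tensor_flip M N t) = tensor_lift K (\<lambda>x y. \<phi> y x) t"
proof -
  have \<phi>': "bilin M N K (\<lambda>x y. \<phi> y x)" using \<phi> by (auto simp: bilin_def)
  have "tensor_lift K \<phi> (tensor_flip M N t) = tensor_lift K (\<lambda>x y. tensor_lift K \<phi> (pureC N M y x)) t"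
    unfolding tensor_flip_def
    by (rule lift_comp[OF M N tensorC_space[OF N M] K tensor_flip_bilin[OF M N] lift_linear[OF N M K \<phi>] t])
  also have "\<dots> = tensor_lift K (\<lambda>x y. \<phi> y x) t"
    by (rule lift_cong[OF M N K \<phi>' _ t]) (simp add: lift_pureC[OF N M K \<phi>])
  finally show ?thesis .
qed

section \<open>Finite-rank decompositions of tensors\<close>

text \<open>
  The set \<open>X\<close> controls the first legs of \<open>t\<close>: every finite-rank operator \<open>\<Sum> \<phi>\<^sub>k x\<^sub>k\<close> that fixes \<open>X\<close>
  pointwise also fixes \<open>t\<close> when applied to the first factor.  Phrased in this way, the property passes to sums
  of tensors by taking unions.
\<close>

definition contains_left_legs ::
  "(complex, 'm, 'c) module_scheme \<Rightarrow> (complex, 'n, 'd) module_scheme \<Rightarrow> ('m, 'n) tens \<Rightarrow> 'm set \<Rightarrow> bool"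
  where "contains_left_legs M N t X \<longleftrightarrow> (\<forall>(n :: nat) x \<phi>.
    (\<forall>k<n. x k \<in> carrier M \<and> \<phi> k \<in> linear_maps M CC) \<longrightarrow>
    (\<forall>y\<in>X. (\<Oplus>\<^bsub>M\<^esub>k\<in>{..<n}. \<phi> k y \<odot>\<^bsub>M\<^esub> x k) = y) \<longrightarrow>
    (\<Oplus>\<^bsub>tensorC M N\<^esub>k\<in>{..<n}. pureC M N (x k) (tensor_lift N (\<lambda>a u. \<phi> k a \<odot>\<^bsub>N\<^esub> u) t)) = t)"

lemma contains_left_legsI:
  assumes "\<And>(n :: nat) x \<phi>. \<lbrakk>\<forall>k<n. x k \<in> carrier M \<and> \<phi> k \<in> linear_maps M CC;
      \<forall>y\<in>X. (\<Oplus>\<^bsub>M\<^esub>k\<in>{..<n}. \<phi> k y \<odot>\<^bsub>M\<^esub> x k) = y\<rbrakk> \<Longrightarrow>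
      (\<Oplus>\<^bsub>tensorC M N\<^esub>k\<in>{..<n}. pureC M N (x k) (tensor_lift N (\<lambda>a u. \<phi> k a \<odot>\<^bsub>N\<^esub> u) t)) = t"
  shows "contains_left_legs M N t X"
  unfolding contains_left_legs_def by (intro allI impI) (rule assms)

lemma contains_left_legsD:
  fixes n :: nat
  assumes "contains_left_legs M N t X" "\<forall>k<n. x k \<in> carrier M \<and> \<phi> k \<in> linear_maps M CC"
    "\<forall>y\<in>X. (\<Oplus>\<^bsub>M\<^esub>k\<in>{..<n}. \<phi> k y \<odot>\<^bsub>M\<^esub> x k) = y"
  shows "(\<Oplus>\<^bsub>tensorC M N\<^esub>k\<in>{..<n}. pureC M N (x k) (tensor_lift N (\<lambda>a u. \<phi> k a \<odot>\<^bsub>N\<^esub> u) t)) = t"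
  by (rule assms(1)[unfolded contains_left_legs_def, THEN spec, THEN spec, THEN spec, THEN mp, THEN mp, OF assms(2,3)])

lemma tensor_left_legs:
  assumes M: "complex_space M" and N: "complex_space N" and t: "t \<in> carrier (tensorC M N)"
  shows "\<exists>X. finite X \<and> X \<subseteq> carrier M \<and> contains_left_legs M N t X"
proof -
  note T = tensorC_space[OF M N]
  interpret T: module complex_ring "tensorC M N" by (rule T)
  have b: "bilin M N N (\<lambda>a u. \<phi> a \<odot>\<^bsub>N\<^esub> u)" if "\<phi> \<in> linear_maps M CC" for \<phi>
    by (intro bilinI lin_scale[OF N] lin_scalar[OF N] module_homs_id) (simp_all add: that)
  have F: "(\<lambda>t. \<Oplus>\<^bsub>tensorC M N\<^esub>k\<in>{..<n}. pureC M N (x k) (tensor_lift N (\<lambda>a u. \<phi> k a \<odot>\<^bsub>N\<^esub> u) t))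
      \<in> linear_maps (tensorC M N) (tensorC M N)"
    if "\<forall>k<n. x k \<in> carrier M \<and> \<phi> k \<in> linear_maps M CC" for n :: nat and x \<phi>
    by (intro lin_finsum[OF T] lin_pure_right[OF M N] lift_linear[OF M N N] b) (use that in auto)
  from t show ?thesis
  proof (induction rule: tensorC_induct[OF M N, consumes 1, case_names zero pure add])
    case zero
    show ?case
      by (intro exI[of _ "{}"] conjI contains_left_legsI)
        (use lin_zero[OF T T F] in auto)
  next
    case (pure a u)
    show ?case
    proof (intro exI[of _ "{a}"] conjI contains_left_legsI)
      fix n :: nat and x \<phi>
      assume x: "\<forall>k<n. x k \<in> carrier M \<and> \<phi> k \<in> linear_maps M CC"
        and a: "\<forall>y\<in>{a}. (\<Oplus>\<^bsub>M\<^esub>k\<in>{..<n}. \<phi> k y \<odot>\<^bsub>M\<^esub> x k) = y"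
      have p: "(\<lambda>m. pureC M N m u) \<in> linear_maps M (tensorC M N)"
        by (rule bilin_left[OF pureC_bilin[OF M N] pure(2)])
      have "(\<Oplus>\<^bsub>tensorC M N\<^esub>k\<in>{..<n}. pureC M N (x k) (tensor_lift N (\<lambda>a u. \<phi> k a \<odot>\<^bsub>N\<^esub> u) (pureC M N a u))) =
          (\<Oplus>\<^bsub>tensorC M N\<^esub>k\<in>{..<n}. pureC M N (\<phi> k a \<odot>\<^bsub>M\<^esub> x k) u)"
        by (rule T.finsum_cong')
          (use x pure in \<open>auto simp: lift_pureC[OF M N N b] lin_smult[OF bilin_left[OF pureC_bilin[OF M N]]]
            lin_smult[OF bilin_right[OF pureC_bilin[OF M N]]] space_smult[OF M] pureC_closed[OF M N]
            intro!: space_smult(1)[OF T]\<close>)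
      also have "\<dots> = pureC M N (\<Oplus>\<^bsub>M\<^esub>k\<in>{..<n}. \<phi> k a \<odot>\<^bsub>M\<^esub> x k) u"
        by (rule lin_of_finsum[OF M T p, symmetric])
          (use x in \<open>auto simp: space_smult[OF M]\<close>)
      finally show "(\<Oplus>\<^bsub>tensorC M N\<^esub>k\<in>{..<n}. pureC M N (x k) (tensor_lift N (\<lambda>a u. \<phi> k a \<odot>\<^bsub>N\<^esub> u) (pureC M N a u)))
        = pureC M N a u" using a by simp
    qed (use pure in auto)
  next
    case (add v w)
    then obtain X Y where XY: "finite X" "X \<subseteq> carrier M" "finite Y" "Y \<subseteq> carrier M"
      and X: "contains_left_legs M N v X" and Y: "contains_left_legs M N w Y"
      by auto
    show ?case
    proof (intro exI[of _ "X \<union> Y"] conjI contains_left_legsI)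
      fix n :: nat and x \<phi>
      assume x: "\<forall>k<n. x k \<in> carrier M \<and> \<phi> k \<in> linear_maps M CC"
        and y: "\<forall>y\<in>X \<union> Y. (\<Oplus>\<^bsub>M\<^esub>k\<in>{..<n}. \<phi> k y \<odot>\<^bsub>M\<^esub> x k) = y"
      show "(\<Oplus>\<^bsub>tensorC M N\<^esub>k\<in>{..<n}. pureC M N (x k) (tensor_lift N (\<lambda>a u. \<phi> k a \<odot>\<^bsub>N\<^esub> u) (v \<oplus>\<^bsub>tensorC M N\<^esub> w)))
        = v \<oplus>\<^bsub>tensorC M N\<^esub> w"
        using module_homs_add[OF F[OF x] add(1,2)] contains_left_legsD[OF X x] contains_left_legsD[OF Y x] y
        by simp
    qed (use XY in auto)
  qed
qed

text \<open>
  If every contraction of the first legs of the tensors in \<open>T\<close> lies in the subspace \<open>P\<close>, then \<open>T\<close> lies in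
  \<open>M \<otimes> P\<close>, with finitely many second legs \<open>q k\<close> for all of \<open>T\<close> and first legs given by contraction.  A
  finite-rank operator fixing the first legs writes each tensor as \<open>\<Sum> x\<^sub>k \<otimes> s\<^sub>k\<close> with contractions
  \<open>s\<^sub>k\<close> in \<open>P\<close>; a second one, with values in \<open>P\<close> and fixing these finitely many \<open>s\<^sub>k\<close>, produces the
  vectors \<open>q k\<close>.
\<close>

lemma finite_rank_decomposition:
  assumes M: "complex_space M" and N: "complex_space N"
    and T: "finite T" "T \<subseteq> carrier (tensorC M N)"
    and P: "P \<subseteq> carrier N" "\<zero>\<^bsub>N\<^esub> \<in> P"
      "\<And>x y. \<lbrakk>x \<in> P; y \<in> P\<rbrakk> \<Longrightarrow> x \<oplus>\<^bsub>N\<^esub> y \<in> P" "\<And>c x. x \<in> P \<Longrightarrow> c \<odot>\<^bsub>N\<^esub> x \<in> P"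
    and slice: "\<And>\<phi> t. \<lbrakk>\<phi> \<in> linear_maps M CC; t \<in> T\<rbrakk> \<Longrightarrow> tensor_lift N (\<lambda>a u. \<phi> a \<odot>\<^bsub>N\<^esub> u) t \<in> P"
  shows "\<exists>(n :: nat) q \<psi>. (\<forall>k<n. q k \<in> P \<and> \<psi> k \<in> linear_maps N CC) \<and>
    (\<forall>t\<in>T. (\<Oplus>\<^bsub>tensorC M N\<^esub>k\<in>{..<n}. pureC M N (tensor_lift M (\<lambda>a u. \<psi> k u \<odot>\<^bsub>M\<^esub> a) t) (q k)) = t)"
proof -
  note MN = tensorC_space[OF M N]
  interpret M: module complex_ring M by (rule M)
  interpret MN: module complex_ring "tensorC M N" by (rule MN)
  have "\<forall>t\<in>T. \<exists>X. finite X \<and> X \<subseteq> carrier M \<and> contains_left_legs M N t X"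
    using tensor_left_legs[OF M N] T(2) by blast
  from bchoice[OF this] obtain X where X: "\<And>t. t \<in> T \<Longrightarrow> finite (X t) \<and> X t \<subseteq> carrier M"
    and Xt: "\<And>t. t \<in> T \<Longrightarrow> contains_left_legs M N t (X t)" by blast
  have "\<exists>(n :: nat) q \<phi>. (\<forall>k<n. q k \<in> carrier M \<and> \<phi> k \<in> linear_maps M CC) \<and>
      (\<forall>y\<in>\<Union>(X ` T). (\<Oplus>\<^bsub>M\<^esub>k\<in>{..<n}. \<phi> k y \<odot>\<^bsub>M\<^esub> q k) = y)"
    by (rule finite_rank_reproducing[OF M]) (use T X in \<open>auto simp: space_smult[OF M]\<close>)
  then obtain n :: nat and x \<phi> where x: "\<forall>k<n. x k \<in> carrier M \<and> \<phi> k \<in> linear_maps M CC"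
    and xX: "\<forall>y\<in>\<Union>(X ` T). (\<Oplus>\<^bsub>M\<^esub>k\<in>{..<n}. \<phi> k y \<odot>\<^bsub>M\<^esub> x k) = y" by blast
  let ?s = "\<lambda>k t. tensor_lift N (\<lambda>a u. \<phi> k a \<odot>\<^bsub>N\<^esub> u) t"
  have dec: "(\<Oplus>\<^bsub>tensorC M N\<^esub>k\<in>{..<n}. pureC M N (x k) (?s k t)) = t" if "t \<in> T" for t
    by (rule contains_left_legsD[OF Xt[OF that] x]) (use xX that in auto)
  have sP: "?s k t \<in> P" if "k < n" "t \<in> T" for k t using slice x that by blast
  have "\<exists>(m :: nat) q \<psi>. (\<forall>j<m. q j \<in> P \<and> \<psi> j \<in> linear_maps N CC) \<and>
      (\<forall>y\<in>(\<lambda>(k, t). ?s k t) ` ({..<n} \<times> T). (\<Oplus>\<^bsub>N\<^esub>j\<in>{..<m}. \<psi> j y \<odot>\<^bsub>N\<^esub> q j) = y)"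
    by (rule finite_rank_reproducing[OF N _ _ P]) (use T sP in auto)
  then obtain m :: nat and q \<psi> where q\<psi>: "\<forall>j<m. q j \<in> P \<and> \<psi> j \<in> linear_maps N CC"
    and all_s: "\<forall>y\<in>(\<lambda>(k, t). ?s k t) ` ({..<n} \<times> T). (\<Oplus>\<^bsub>N\<^esub>j\<in>{..<m}. \<psi> j y \<odot>\<^bsub>N\<^esub> q j) = y"
    by (elim exE conjE)
  then have q: "\<And>j. j < m \<Longrightarrow> q j \<in> P" and \<psi>: "\<And>j. j < m \<Longrightarrow> \<psi> j \<in> linear_maps N CC" by auto
  have sq: "(\<Oplus>\<^bsub>N\<^esub>j\<in>{..<m}. \<psi> j (?s k t) \<odot>\<^bsub>N\<^esub> q j) = ?s k t" if "k < n" "t \<in> T" for k t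
    by (rule bspec[OF all_s], rule image_eqI[of _ _ "(k, t)"]) (simp_all add: that)
  have qN: "q j \<in> carrier N" if "j < m" for j using q[OF that] P(1) by blast
  have b: "bilin M N M (\<lambda>a u. \<psi> j u \<odot>\<^bsub>M\<^esub> a)" if "j < m" for j
    by (intro bilinI lin_scale[OF M] lin_scalar[OF M] module_homs_id) (simp_all add: \<psi>[OF that])
  let ?G = "\<lambda>t. \<Oplus>\<^bsub>tensorC M N\<^esub>j\<in>{..<m}. pureC M N (tensor_lift M (\<lambda>a u. \<psi> j u \<odot>\<^bsub>M\<^esub> a) t) (q j)"
  have G: "?G \<in> linear_maps (tensorC M N) (tensorC M N)"
    by (intro lin_finsum[OF MN] lin_pure_left[OF M N] lift_linear[OF M N M] b) (use qN in auto)
  have Gp: "?G (pureC M N (x k) (?s k t)) = pureC M N (x k) (?s k t)" if kt: "k < n" "t \<in> T" for k t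
  proof -
    have xk: "x k \<in> carrier M" using x kt by blast
    have sk: "?s k t \<in> carrier N" using sP[OF kt] P(1) by blast
    have p: "pureC M N (x k) \<in> linear_maps N (tensorC M N)"
      using bilin_right[OF pureC_bilin[OF M N] xk] by simp
    have "?G (pureC M N (x k) (?s k t)) =
        (\<Oplus>\<^bsub>tensorC M N\<^esub>j\<in>{..<m}. pureC M N (x k) (\<psi> j (?s k t) \<odot>\<^bsub>N\<^esub> q j))"
      by (rule MN.finsum_cong')
        (use xk sk qN in \<open>auto simp: lift_pureC[OF M N M b] lin_smult[OF bilin_left[OF pureC_bilin[OF M N]]]
          lin_smult[OF p] pureC_closed[OF M N] intro!: space_smult(1)[OF MN]\<close>)
    also have "\<dots> = pureC M N (x k) (\<Oplus>\<^bsub>N\<^esub>j\<in>{..<m}. \<psi> j (?s k t) \<odot>\<^bsub>N\<^esub> q j)"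
      by (rule lin_of_finsum[OF N MN p, symmetric])
        (use qN in \<open>auto simp: space_smult[OF N]\<close>)
    finally show ?thesis using sq[OF kt] by simp
  qed
  have "?G t = t" if t: "t \<in> T" for t
  proof -
    have pc: "pureC M N (x k) (?s k t) \<in> carrier (tensorC M N)" if "k < n" for k
      using x that sP[OF that t] P(1) by (intro pureC_closed[OF M N]) auto
    have "?G t = ?G (\<Oplus>\<^bsub>tensorC M N\<^esub>k\<in>{..<n}. pureC M N (x k) (?s k t))" by (simp only: dec[OF t])
    also have "\<dots> = (\<Oplus>\<^bsub>tensorC M N\<^esub>k\<in>{..<n}. ?G (pureC M N (x k) (?s k t)))"
      by (rule lin_of_finsum[OF MN MN G])
        (use pc in auto)
    also have "\<dots> = (\<Oplus>\<^bsub>tensorC M N\<^esub>k\<in>{..<n}. pureC M N (x k) (?s k t))"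
      by (rule MN.finsum_cong') (use pc Gp[OF _ t] in auto)
    finally show ?thesis by (simp only: dec[OF t])
  qed
  then show ?thesis using q\<psi> by (intro exI[of _ m] exI[of _ q] exI[of _ \<psi>]) simp
qed

section \<open>Comodule algebras and cotensor products\<close>

lemma module_homs_tensor_algebra [simp]:
  "linear_maps M (tensor_algebra A B) = linear_maps M (tensorC A B)"
  by (simp add: module_homs_def tensor_algebra_def)

lemma space_neg:
  assumes "complex_space V" "x \<in> carrier V" shows "\<ominus>\<^bsub>V\<^esub> x = (- 1) \<odot>\<^bsub>V\<^esub> x"
proof -
  interpret V: module complex_ring V by fact
  have "(- 1) \<odot>\<^bsub>V\<^esub> x \<oplus>\<^bsub>V\<^esub> x = ((- 1) + 1) \<odot>\<^bsub>V\<^esub> x"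
    using assms by (subst space_smult(2)) (simp_all add: space_smult)
  then show ?thesis using assms by (intro V.minus_equality) (simp_all add: space_smult)
qed

lemma lin_mult_left:
  assumes "complex_algebra A" "y \<in> carrier A" "(\<lambda>p. E p) \<in> linear_maps P A"
  shows "(\<lambda>p. E p \<otimes>\<^bsub>A\<^esub> y) \<in> linear_maps P A"
proof -
  interpret complex_algebra A by fact
  show ?thesis
    by (rule module_homsI) (use assms(2) in \<open>simp_all add: module_homs_closed[OF assms(3)]
      module_homs_add[OF assms(3)] lin_smult[OF assms(3)] A.l_distr smult_mult_left\<close>)
qed

lemma lin_mult_right:
  assumes "complex_algebra A" "x \<in> carrier A" "(\<lambda>p. E p) \<in> linear_maps P A"
  shows "(\<lambda>p. x \<otimes>\<^bsub>A\<^esub> E p) \<in> linear_maps P A"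
proof -
  interpret complex_algebra A by fact
  show ?thesis
    by (rule module_homsI) (use assms(2) in \<open>simp_all add: module_homs_closed[OF assms(3)]
      module_homs_add[OF assms(3)] lin_smult[OF assms(3)] A.r_distr smult_mult_right\<close>)
qed

lemma algebra_mult_closed:
  assumes "complex_algebra A" "x \<in> carrier A" "y \<in> carrier A"
  shows "x \<otimes>\<^bsub>A\<^esub> y \<in> carrier A"
proof -
  interpret complex_algebra A by fact
  show ?thesis using assms(2,3) by simp
qed

locale cotensor_data =
  fixes H :: "'h hopf" and A :: "(complex, 'a) module" and \<delta> :: "'a \<Rightarrow> ('a, 'h) tens"
    and V :: "(complex, 'v) module" and \<rho> :: "'v \<Rightarrow> ('h, 'v) tens"
  assumes hopf: "hopf_algebra H" and comod_alg: "comodule_algebra H A \<delta>" and comod: "left_comodule H V \<rho>"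
begin

abbreviation "AH \<equiv> tensorC A H"
abbreviation "AV \<equiv> tensorC A V"
abbreviation "AHV \<equiv> tensorC A (tensorC H V)"
abbreviation "lact x \<equiv> tensor_map A V (\<lambda>a. x \<otimes>\<^bsub>A\<^esub> a) id"
abbreviation "B \<equiv> coinvariants H A \<delta>"
abbreviation "P \<equiv> cotensor_module H A \<delta> V \<rho>"

sublocale H: hopf_algebra H by (rule hopf)
sublocale A: complex_algebra A using comod_alg by (simp add: comodule_algebra_def)

lemma algs: "complex_algebra A" "complex_algebra H"
  using A.complex_algebra_axioms H.complex_algebra_axioms .

lemma spaces: "complex_space A" "complex_space H" "complex_space V"
  using A.module_axioms H.module_axioms comod by (simp_all add: left_comodule_def)

lemma \<delta>_lin: "\<delta> \<in> linear_maps A AH"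
  using comod_alg by (simp add: comodule_algebra_def right_comodule_def)

lemma \<rho>_lin: "\<rho> \<in> linear_maps V (tensorC H V)"
  using comod by (simp add: left_comodule_def)

lemma \<Delta>_lin: "comul H \<in> linear_maps H (tensorC H H)"
  using H.comul_hom by (simp add: algebra_homs_def)

lemma \<epsilon>_lin: "counit H \<in> linear_maps H CC"
  using H.counit_hom by (simp add: algebra_homs_def)

lemmas S_lin = H.antipode_linear

lemmas closed = module_homs_closed[OF \<delta>_lin] module_homs_closed[OF \<rho>_lin] module_homs_closed[OF \<Delta>_lin]
  module_homs_closed[OF S_lin] algebra_mult_closed[OF algs(1)] algebra_mult_closed[OF algs(2)]
  A.A.one_closed H.A.one_closed

text \<open>
  Rules for multilinearity of an expression in one of its variables.  The outermost operation of the
  expression and the position of the variable in it determine which rule applies, so repeated resolution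
  settles these goals.  The closure rules serve the arguments that do not contain the variable.
\<close>

lemmas lins = bilinI trilinI module_homs_id lin_comp[OF \<delta>_lin] lin_comp[OF \<rho>_lin] lin_comp[OF \<Delta>_lin]
  lin_comp[OF \<epsilon>_lin] lin_comp[OF S_lin] lin_mult_left[OF algs(1)] lin_mult_left[OF algs(2)]
  lin_mult_right[OF algs(1)] lin_mult_right[OF algs(2)]
  lin_pure_left lin_pure_right lin_scale lin_scalar lin_lift lin_lift_param
  spaces tensorC_space CC_space closed pureC_closed lift_closed' space_smult(1)

lemma \<rho>_coassoc:
  assumes "complex_space K" "trilin H H V K \<Phi>" "v \<in> carrier V"
  shows "tensor_lift K (\<lambda>h w. tensor_lift K (\<lambda>a b. \<Phi> a b w) (comul H h)) (\<rho> v) =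
    tensor_lift K (\<lambda>h w. tensor_lift K (\<Phi> h) (\<rho> w)) (\<rho> v)"
  by (rule lift_coassoc[OF spaces(2,2,3) assms(1) spaces(2,3) \<Delta>_lin \<rho>_lin _ _ _ assms(2)])
    (use comod assms(3) in \<open>simp_all add: left_comodule_def closed\<close>)

lemma \<rho>_counit: "v \<in> carrier V \<Longrightarrow> tensor_lift V (\<lambda>h w. counit H h \<odot>\<^bsub>V\<^esub> w) (\<rho> v) = v"
  using comod by (simp add: left_comodule_def)

lemma \<delta>_mult: "\<lbrakk>a \<in> carrier A; b \<in> carrier A\<rbrakk> \<Longrightarrow> \<delta> (a \<otimes>\<^bsub>A\<^esub> b) =
    tensor_lift AH (\<lambda>x h. tensor_lift AH (\<lambda>y g. pureC A H (x \<otimes>\<^bsub>A\<^esub> y) (h \<otimes>\<^bsub>H\<^esub> g)) (\<delta> b)) (\<delta> a)"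
  using comod_alg ring_hom_mult[of \<delta> A "tensor_algebra A H"]
  by (simp add: comodule_algebra_def algebra_homs_def tensor_algebra_def)

lemma \<delta>_one: "\<delta> \<one>\<^bsub>A\<^esub> = pureC A H \<one>\<^bsub>A\<^esub> \<one>\<^bsub>H\<^esub>"
  using comod_alg ring_hom_one[of \<delta> A "tensor_algebra A H"]
  by (simp add: comodule_algebra_def algebra_homs_def tensor_algebra_def)

lemma carrier_B: "carrier B = {b \<in> carrier A. \<delta> b = pureC A H b \<one>\<^bsub>H\<^esub>}"
  by (simp add: coinvariants_def)

lemma B_simps [simp]:
  "mult B = mult A" "one B = one A" "add B = add A" "zero B = zero A" "smult B = smult A"
  by (simp_all add: coinvariants_def)

text \<open>
  The coaction is multiplicative and \<open>\<delta>(b) = b \<otimes> 1\<close>, so it is left linear over the invariants.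
\<close>

lemma \<delta>_coinvariant_mult:
  assumes b: "b \<in> carrier B" and a: "a \<in> carrier A"
  shows "\<delta> (b \<otimes>\<^bsub>A\<^esub> a) = tensor_map A H (\<lambda>x. b \<otimes>\<^bsub>A\<^esub> x) id (\<delta> a)"
proof -
  have bA: "b \<in> carrier A" and \<delta>b: "\<delta> b = pureC A H b \<one>\<^bsub>H\<^esub>" using b by (auto simp: carrier_B)
  have "\<delta> (b \<otimes>\<^bsub>A\<^esub> a) = tensor_lift AH (\<lambda>y g. pureC A H (b \<otimes>\<^bsub>A\<^esub> y) (\<one>\<^bsub>H\<^esub> \<otimes>\<^bsub>H\<^esub> g)) (\<delta> a)"
    unfolding \<delta>_mult[OF bA a] \<delta>b
    by (rule lift_pureC[OF spaces(1,2)]) (insert bA a, (assumption | rule lins)+)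
  also have "\<dots> = tensor_lift AH (\<lambda>y g. pureC A H (b \<otimes>\<^bsub>A\<^esub> y) g) (\<delta> a)"
    by (rule lift_cong[OF spaces(1,2)]) (insert bA a, (assumption | rule lins)+, simp, (assumption | rule lins)+)
  finally show ?thesis by (simp add: tensor_map_def)
qed

lemma subring_B: "subring (carrier B) A"
proof (rule A.A.subringI)
  show "carrier B \<subseteq> carrier A" by (auto simp: carrier_B)
  show "\<one>\<^bsub>A\<^esub> \<in> carrier B" by (simp add: carrier_B \<delta>_one)
  have l: "(\<lambda>x. pureC A H x \<one>\<^bsub>H\<^esub>) \<in> linear_maps A AH"
    by (assumption | rule lins)+
  show "\<ominus>\<^bsub>A\<^esub> b \<in> carrier B" if "b \<in> carrier B" for b
    using that by (simp add: carrier_B space_neg[OF spaces(1)] lin_smult[OF \<delta>_lin] lin_smult[OF l] space_smult[OF spaces(1)])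
  show "b \<oplus>\<^bsub>A\<^esub> b' \<in> carrier B" if "b \<in> carrier B" "b' \<in> carrier B" for b b'
    using that by (simp add: carrier_B module_homs_add[OF \<delta>_lin] module_homs_add[OF l])
  show "b \<otimes>\<^bsub>A\<^esub> b' \<in> carrier B" if "b \<in> carrier B" "b' \<in> carrier B" for b b'
  proof -
    have b: "b \<in> carrier A" "b' \<in> carrier A" "\<delta> b' = pureC A H b' \<one>\<^bsub>H\<^esub>" using that by (auto simp: carrier_B)
    have "tensor_map A H (\<lambda>x. b \<otimes>\<^bsub>A\<^esub> x) id (pureC A H b' \<one>\<^bsub>H\<^esub>) = pureC A H (b \<otimes>\<^bsub>A\<^esub> b') (id \<one>\<^bsub>H\<^esub>)"
      by (rule tensor_map_pure[OF spaces(1,2,1,2) _ lin_id]) (insert b, (assumption | rule lins)+)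
    then show ?thesis using b \<delta>_coinvariant_mult[OF that(1) b(2)] by (simp add: carrier_B)
  qed
qed

lemma ring_B: "ring B"
  using A.A.subring_is_ring[OF subring_B] by (simp add: coinvariants_def carrier_B)

lemma B_subset: "b \<in> carrier B \<Longrightarrow> b \<in> carrier A"
  by (simp add: carrier_B)

lemma P_simps [simp]:
  "carrier P = cotensor H A \<delta> V \<rho>" "add P = add AV" "zero P = zero AV"
  "b \<odot>\<^bsub>P\<^esub> p = lact b p"
  by (simp_all add: cotensor_module_def)

text \<open>
  The defining equation, with both sides written as sums over \<open>p\<close>.  These sums are visibly linear in \<open>p\<close>, and
  maps given on pure tensors can be substituted into them.
\<close>

lemma cotensor_iff:
  "p \<in> cotensor H A \<delta> V \<rho> \<longleftrightarrow> p \<in> carrier AV \<and>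
    tensor_lift AHV (\<lambda>a v. tensor_lift AHV (\<lambda>x h. pureC A (tensorC H V) x (pureC H V h v)) (\<delta> a)) p =
    tensor_lift AHV (\<lambda>a v. pureC A (tensorC H V) a (\<rho> v)) p"
proof (cases "p \<in> carrier AV")
  case True
  note HV = tensorC_space[OF spaces(2,3)]
  note AHV = tensorC_space[OF spaces(1) HV]
  note AHs = tensorC_space[OF spaces(1,2)]
  have c: "tensor_assoc A H V (tensor_map AH V \<delta> id p) \<in> carrier AHV"
    using module_homs_closed[OF tensor_assoc_linear[OF spaces]
        module_homs_closed[OF tensor_map_linear[OF spaces(1,3) AHs spaces(3) \<delta>_lin lin_id] True]] .
  have "tensor_lift AHV (pureC A (tensorC H V)) (tensor_assoc A H V (tensor_map AH V \<delta> id p)) =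
    tensor_lift AHV (\<lambda>a v. tensor_lift AHV (\<lambda>x h. pureC A (tensorC H V) x (pureC H V h v)) (\<delta> a)) p"
    by (rule lift_assoc_map[OF spaces AHV spaces(1) \<delta>_lin True pureC_bilin[OF spaces(1) HV]])
  then show ?thesis
    using True by (simp add: cotensor_def lift_pureC_id[OF spaces(1) HV c]) (simp add: tensor_map_def)
qed (simp add: cotensor_def)

lemma P_AV: "p \<in> cotensor H A \<delta> V \<rho> \<Longrightarrow> p \<in> carrier AV"
  by (simp add: cotensor_def)

text \<open>
  In Sweedler notation, with \<open>p = \<Sum> a \<otimes> v\<close>: a sum over \<open>a\<^sub>0 \<otimes> a\<^sub>1 \<otimes> v\<close> is the same sum over
  \<open>a \<otimes> v\<^sub>-\<^sub>1 \<otimes> v\<^sub>0\<close>.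
\<close>

lemma cotensor_swap:
  assumes "p \<in> cotensor H A \<delta> V \<rho>" "complex_space K" "trilin A H V K \<Phi>"
  shows "tensor_lift K (\<lambda>a v. tensor_lift K (\<lambda>x h. \<Phi> x h v) (\<delta> a)) p =
    tensor_lift K (\<lambda>a v. tensor_lift K (\<Phi> a) (\<rho> v)) p"
  by (rule lift_coassoc[OF spaces assms(2) spaces(1,3) \<delta>_lin \<rho>_lin _ _ _ assms(3)])
    (use assms(1) in \<open>simp_all add: cotensor_def\<close>)

lemma equalizer_left_bilin:
  "bilin A V AHV (\<lambda>a v. tensor_lift AHV (\<lambda>x h. pureC A (tensorC H V) x (pureC H V h v)) (\<delta> a))"
  by (assumption | rule lins)+

lemma equalizer_right_bilin: "bilin A V AHV (\<lambda>a v. pureC A (tensorC H V) a (\<rho> v))"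
  by (assumption | rule lins)+

lemma cotensor_subspace:
  "cotensor H A \<delta> V \<rho> \<subseteq> carrier AV" "\<zero>\<^bsub>AV\<^esub> \<in> cotensor H A \<delta> V \<rho>"
  "\<lbrakk>p \<in> cotensor H A \<delta> V \<rho>; q \<in> cotensor H A \<delta> V \<rho>\<rbrakk> \<Longrightarrow> p \<oplus>\<^bsub>AV\<^esub> q \<in> cotensor H A \<delta> V \<rho>"
  "p \<in> cotensor H A \<delta> V \<rho> \<Longrightarrow> c \<odot>\<^bsub>AV\<^esub> p \<in> cotensor H A \<delta> V \<rho>"
proof -
  note AVs = tensorC_space[OF spaces(1,3)]
  note AHV = tensorC_space[OF spaces(1) tensorC_space[OF spaces(2,3)]]
  interpret AV: module complex_ring AV by (rule AVs)
  note l = lift_linear[OF spaces(1,3) AHV equalizer_left_bilin] lift_linear[OF spaces(1,3) AHV equalizer_right_bilin]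
  show "cotensor H A \<delta> V \<rho> \<subseteq> carrier AV" by (auto simp: cotensor_def)
  show "\<zero>\<^bsub>AV\<^esub> \<in> cotensor H A \<delta> V \<rho>"
    by (simp add: cotensor_iff l[THEN lin_zero[OF AVs AHV]])
  show "\<lbrakk>p \<in> cotensor H A \<delta> V \<rho>; q \<in> cotensor H A \<delta> V \<rho>\<rbrakk> \<Longrightarrow> p \<oplus>\<^bsub>AV\<^esub> q \<in> cotensor H A \<delta> V \<rho>"
    by (simp add: cotensor_iff l[THEN module_homs_add])
  show "p \<in> cotensor H A \<delta> V \<rho> \<Longrightarrow> c \<odot>\<^bsub>AV\<^esub> p \<in> cotensor H A \<delta> V \<rho>"
    by (simp add: cotensor_iff l[THEN lin_smult] space_smult[OF AVs])
qed

lemma left_mult_lin: "x \<in> carrier A \<Longrightarrow> (\<lambda>a. x \<otimes>\<^bsub>A\<^esub> a) \<in> linear_maps A A"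
  by (assumption | rule lins)+

lemma left_mult_AV_lin: "x \<in> carrier A \<Longrightarrow> lact x \<in> linear_maps AV AV"
  by (rule tensor_map_linear[OF spaces(1,3,1,3) left_mult_lin lin_id])

lemma left_mult_AV_pure:
  "\<lbrakk>x \<in> carrier A; a \<in> carrier A; v \<in> carrier V\<rbrakk> \<Longrightarrow>
    lact x (pureC A V a v) = pureC A V (x \<otimes>\<^bsub>A\<^esub> a) v"
  using tensor_map_pure[OF spaces(1,3,1,3) left_mult_lin lin_id] by simp

lemma left_mult_AV_bilin: "bilin A AV AV (\<lambda>x. lact x)"
proof (rule bilinI)
  show "lact x \<in> linear_maps AV AV" if "x \<in> carrier A" for x
    using that by (rule left_mult_AV_lin)
  show "(\<lambda>x. lact x t) \<in> linear_maps A AV" if "t \<in> carrier AV" for t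
    unfolding tensor_map_def id_apply by (insert that, (assumption | rule lins)+)
qed

lemma left_mult_AV_mult:
  assumes x: "x \<in> carrier A" and y: "y \<in> carrier A" and t: "t \<in> carrier AV"
  shows "lact (x \<otimes>\<^bsub>A\<^esub> y) t =
    lact x (lact y t)"
  by (rule tensorC_ext[OF spaces(1,3) tensorC_space[OF spaces(1,3)] left_mult_AV_lin
        lin_comp[OF left_mult_AV_lin left_mult_AV_lin] _ t])
    (use x y in \<open>simp_all add: left_mult_AV_pure A.A.m_assoc\<close>)

lemma left_mult_AV_one:
  assumes t: "t \<in> carrier AV" shows "lact \<one>\<^bsub>A\<^esub> t = t"
  by (rule tensorC_ext[OF spaces(1,3) tensorC_space[OF spaces(1,3)] left_mult_AV_lin module_homs_id _ t])
    (simp_all add: left_mult_AV_pure)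

lemma cotensor_smult_closed:
  assumes b: "b \<in> carrier B" and p: "p \<in> cotensor H A \<delta> V \<rho>"
  shows "lact b p \<in> cotensor H A \<delta> V \<rho>"
proof -
  note bA = B_subset[OF b] and pA = P_AV[OF p]
  note HV = tensorC_space[OF spaces(2,3)]
  note AHV = tensorC_space[OF spaces(1) HV]
  let ?pp = "\<lambda>a h v. pureC A (tensorC H V) a (pureC H V h v)"
  have "tensor_lift AHV (\<lambda>a v. tensor_lift AHV (\<lambda>x h. ?pp x h v) (\<delta> a)) (lact b p) =
      tensor_lift AHV (\<lambda>a v. tensor_lift AHV (\<lambda>x h. ?pp x h v) (\<delta> (b \<otimes>\<^bsub>A\<^esub> a))) p"
    using lift_tensor_map[OF spaces(1,3,1,3) left_mult_lin[OF bA] lin_id AHV equalizer_left_bilin pA] by simp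
  also have "\<dots> = tensor_lift AHV (\<lambda>a v. tensor_lift AHV (\<lambda>x h. ?pp (b \<otimes>\<^bsub>A\<^esub> x) h v) (\<delta> a)) p"
  proof (rule lift_cong[OF spaces(1,3) AHV _ _ pA])
    show "bilin A V AHV (\<lambda>a v. tensor_lift AHV (\<lambda>x h. ?pp (b \<otimes>\<^bsub>A\<^esub> x) h v) (\<delta> a))"
      by (insert bA, (assumption | rule lins)+)
    fix a v assume av: "a \<in> carrier A" "v \<in> carrier V"
    have bl: "bilin A H AHV (\<lambda>x h. ?pp x h v)" by (insert av, (assumption | rule lins)+)
    show "tensor_lift AHV (\<lambda>x h. ?pp x h v) (\<delta> (b \<otimes>\<^bsub>A\<^esub> a)) = tensor_lift AHV (\<lambda>x h. ?pp (b \<otimes>\<^bsub>A\<^esub> x) h v) (\<delta> a)"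
      using lift_tensor_map[OF spaces(1,2,1,2) left_mult_lin[OF bA] lin_id AHV bl closed(1)[OF av(1)]]
      by (simp add: \<delta>_coinvariant_mult[OF b av(1)])
  qed
  also have "\<dots> = tensor_lift AHV (\<lambda>a v. tensor_lift AHV (\<lambda>h w. ?pp (b \<otimes>\<^bsub>A\<^esub> a) h w) (\<rho> v)) p"
    by (rule cotensor_swap[OF p AHV]) (insert bA, (assumption | rule lins)+)
  also have "\<dots> = tensor_lift AHV (\<lambda>a v. pureC A (tensorC H V) (b \<otimes>\<^bsub>A\<^esub> a) (\<rho> v)) p"
  proof (rule lift_cong[OF spaces(1,3) AHV _ _ pA])
    show "bilin A V AHV (\<lambda>a v. pureC A (tensorC H V) (b \<otimes>\<^bsub>A\<^esub> a) (\<rho> v))"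
      by (insert bA, (assumption | rule lins)+)
    fix a v assume av: "a \<in> carrier A" "v \<in> carrier V"
    have ba: "b \<otimes>\<^bsub>A\<^esub> a \<in> carrier A" using bA av by simp
    show "tensor_lift AHV (\<lambda>h w. ?pp (b \<otimes>\<^bsub>A\<^esub> a) h w) (\<rho> v) = pureC A (tensorC H V) (b \<otimes>\<^bsub>A\<^esub> a) (\<rho> v)"
      using lift_comp[OF spaces(2,3) HV AHV pureC_bilin[OF spaces(2,3)]
          bilin_right[OF pureC_bilin[OF spaces(1) HV] ba] closed(2)[OF av(2)]]
      by (simp add: lift_pureC_id[OF spaces(2,3) closed(2)[OF av(2)]])
  qed
  also have "\<dots> = tensor_lift AHV (\<lambda>a v. pureC A (tensorC H V) a (\<rho> v)) (lact b p)"
    using lift_tensor_map[OF spaces(1,3,1,3) left_mult_lin[OF bA] lin_id AHV equalizer_right_bilin pA] by simp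
  finally show ?thesis
    using module_homs_closed[OF left_mult_AV_lin[OF bA] pA] by (simp add: cotensor_iff)
qed

lemma P_left_module: "left_module B P"
proof (intro left_module.intro left_module_axioms.intro ring_B)
  interpret AV: module complex_ring AV by (rule tensorC_space[OF spaces(1,3)])
  note sub = cotensor_subspace(1)[THEN subsetD]
  show "abelian_group P"
  proof (rule abelian_groupI)
    fix p assume p: "p \<in> carrier P"
    then have "\<ominus>\<^bsub>AV\<^esub> p \<in> carrier P"
      by (simp add: space_neg[OF AV.module_axioms] sub cotensor_subspace)
    then show "\<exists>q\<in>carrier P. q \<oplus>\<^bsub>P\<^esub> p = \<zero>\<^bsub>P\<^esub>"
      using p by (intro bexI[of _ "\<ominus>\<^bsub>AV\<^esub> p"]) (simp_all add: sub AV.l_neg)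
  qed (simp_all add: cotensor_subspace sub AV.a_ac)
  show "(r \<oplus>\<^bsub>B\<^esub> s) \<odot>\<^bsub>P\<^esub> x = r \<odot>\<^bsub>P\<^esub> x \<oplus>\<^bsub>P\<^esub> s \<odot>\<^bsub>P\<^esub> x"
    if "r \<in> carrier B" "s \<in> carrier B" "x \<in> carrier P" for r s x
    using that module_homs_add[OF bilin_left[OF left_mult_AV_bilin]] by (simp add: B_subset sub)
qed (simp_all add: cotensor_smult_closed B_subset module_homs_add[OF left_mult_AV_lin]
    left_mult_AV_mult left_mult_AV_one cotensor_subspace(1)[THEN subsetD])

end

section \<open>Equivariant frames\<close>

context cotensor_data begin

text \<open>
  In terms of a basis \<open>e\<^sub>i\<close> of \<open>V\<close> with \<open>\<rho>(e\<^sub>i) = \<Sum>\<^sub>j c\<^sub>i\<^sub>j \<otimes> e\<^sub>j\<close>, put \<open>Z\<^sub>i\<^sub>k = z k e\<^sub>i\<close> and let the row \<open>Q\<^sub>k\<close> consist of the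
  components of \<open>q k\<close>.  The conditions say that the rows of \<open>Q\<close> belong to the cotensor product, that
  \<open>\<delta>(Z\<^sub>i\<^sub>k) = \<Sum>\<^sub>j Z\<^sub>j\<^sub>k \<otimes> S(c\<^sub>i\<^sub>j)\<close>, and that \<open>Z Q\<close> is the identity matrix.
\<close>

definition frame :: "nat \<Rightarrow> (nat \<Rightarrow> 'v \<Rightarrow> 'a) \<Rightarrow> (nat \<Rightarrow> ('a, 'v) tens) \<Rightarrow> bool"
  where "frame n z q \<longleftrightarrow>
    (\<forall>k<n. q k \<in> cotensor H A \<delta> V \<rho> \<and> z k \<in> linear_maps V A \<and>
      (\<forall>v\<in>carrier V. \<delta> (z k v) = tensor_lift AH (\<lambda>h w. pureC A H (z k w) (antipode H h)) (\<rho> v))) \<and>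
    (\<forall>v\<in>carrier V. (\<Oplus>\<^bsub>AV\<^esub>k\<in>{..<n}. lact (z k v) (q k)) = pureC A V \<one>\<^bsub>A\<^esub> v)"

lemma frameD:
  assumes "frame n z q"
  shows "k < n \<Longrightarrow> q k \<in> cotensor H A \<delta> V \<rho>" "k < n \<Longrightarrow> z k \<in> linear_maps V A"
    "\<lbrakk>k < n; v \<in> carrier V\<rbrakk> \<Longrightarrow> \<delta> (z k v) = tensor_lift AH (\<lambda>h w. pureC A H (z k w) (antipode H h)) (\<rho> v)"
    "v \<in> carrier V \<Longrightarrow> (\<Oplus>\<^bsub>AV\<^esub>k\<in>{..<n}. lact (z k v) (q k)) = pureC A V \<one>\<^bsub>A\<^esub> v"
  using assms by (simp_all add: frame_def)

lemma coefficient_bilin: "z \<in> linear_maps V A \<Longrightarrow> bilin A V A (\<lambda>a v. a \<otimes>\<^bsub>A\<^esub> z v)"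
proof -
  assume z: "z \<in> linear_maps V A"
  show ?thesis by (assumption | rule lins lin_comp[OF z] module_homs_closed[OF z])+
qed

text \<open>
  The entries of \<open>a Z\<close> are invariant for \<open>a\<close> in the cotensor product.  In Sweedler notation, with
  \<open>p = \<Sum> a \<otimes> v\<close>, the coaction of \<open>\<Sum> a z(v)\<close> is \<open>\<Sum> a\<^sub>0 z(v\<^sub>0) \<otimes> a\<^sub>1 S(v\<^sub>-\<^sub>1)\<close>.  The cotensor condition
  turns this into \<open>\<Sum> a z(v\<^sub>0) \<otimes> v\<^sub>-\<^sub>2 S(v\<^sub>-\<^sub>1)\<close>, where the antipode axiom leaves \<open>\<Sum> a z(v) \<otimes> 1\<close>.
\<close>

lemma coefficient_coinvariant:
  assumes z: "z \<in> linear_maps V A"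
    and \<delta>z: "\<And>v. v \<in> carrier V \<Longrightarrow> \<delta> (z v) = tensor_lift AH (\<lambda>h w. pureC A H (z w) (antipode H h)) (\<rho> v)"
    and p: "p \<in> cotensor H A \<delta> V \<rho>"
  shows "tensor_lift A (\<lambda>a v. a \<otimes>\<^bsub>A\<^esub> z v) p \<in> carrier B"
proof -
  note zl = lin_comp[OF z] module_homs_closed[OF z]
  note AHs = tensorC_space[OF spaces(1,2)]
  note cb = coefficient_bilin[OF z]
  note pA = P_AV[OF p]
  let ?S = "antipode H"
  \<comment> \<open>\<open>\<Phi> x h v = x z(v\<^sub>0) \<otimes> h S(v\<^sub>-\<^sub>1)\<close>\<close>
  let ?\<Phi> = "\<lambda>x h v. tensor_lift AH (\<lambda>g w. pureC A H (x \<otimes>\<^bsub>A\<^esub> z w) (h \<otimes>\<^bsub>H\<^esub> ?S g)) (\<rho> v)"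
  have tri: "trilin A H V AH ?\<Phi>" by (assumption | rule lins zl)+
  have one: "(\<lambda>a. pureC A H a \<one>\<^bsub>H\<^esub>) \<in> linear_maps A AH" by (assumption | rule lins)+
  have "\<delta> (tensor_lift A (\<lambda>a v. a \<otimes>\<^bsub>A\<^esub> z v) p) = tensor_lift AH (\<lambda>a v. \<delta> (a \<otimes>\<^bsub>A\<^esub> z v)) p"
    by (rule lift_comp[OF spaces(1,3,1) AHs cb \<delta>_lin pA])
  also have "\<dots> = tensor_lift AH (\<lambda>a v. tensor_lift AH (\<lambda>x h. ?\<Phi> x h v) (\<delta> a)) p"
  proof (rule lift_cong[OF spaces(1,3) AHs _ _ pA])
    show "bilin A V AH (\<lambda>a v. tensor_lift AH (\<lambda>x h. ?\<Phi> x h v) (\<delta> a))" by (assumption | rule lins zl)+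
    fix a v assume a: "a \<in> carrier A" and v: "v \<in> carrier V"
    have "\<delta> (a \<otimes>\<^bsub>A\<^esub> z v) = tensor_lift AH (\<lambda>x h. tensor_lift AH (\<lambda>y g. pureC A H (x \<otimes>\<^bsub>A\<^esub> y) (h \<otimes>\<^bsub>H\<^esub> g)) (\<delta> (z v))) (\<delta> a)"
      by (rule \<delta>_mult[OF a module_homs_closed[OF z v]])
    also have "\<dots> = tensor_lift AH (\<lambda>x h. ?\<Phi> x h v) (\<delta> a)"
    proof (rule lift_cong[OF spaces(1,2) AHs _ _ closed(1)[OF a]])
      show "bilin A H AH (\<lambda>x h. ?\<Phi> x h v)" by (insert v, (assumption | rule lins zl)+)
      fix x h assume xh: "x \<in> carrier A" "h \<in> carrier H"
      have b: "bilin A H AH (\<lambda>y g. pureC A H (x \<otimes>\<^bsub>A\<^esub> y) (h \<otimes>\<^bsub>H\<^esub> g))" by (insert xh, (assumption | rule lins)+)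
      have c: "bilin H V AH (\<lambda>g w. pureC A H (z w) (?S g))" by (assumption | rule lins zl)+
      have d: "bilin H V AH (\<lambda>g w. pureC A H (x \<otimes>\<^bsub>A\<^esub> z w) (h \<otimes>\<^bsub>H\<^esub> ?S g))"
        by (insert xh, (assumption | rule lins zl)+)
      have "tensor_lift AH (\<lambda>y g. pureC A H (x \<otimes>\<^bsub>A\<^esub> y) (h \<otimes>\<^bsub>H\<^esub> g)) (\<delta> (z v)) =
          tensor_lift AH (\<lambda>g w. tensor_lift AH (\<lambda>y g. pureC A H (x \<otimes>\<^bsub>A\<^esub> y) (h \<otimes>\<^bsub>H\<^esub> g)) (pureC A H (z w) (?S g))) (\<rho> v)"
        unfolding \<delta>z[OF v]
        by (rule lift_comp[OF spaces(2,3) AHs AHs c lift_linear[OF spaces(1,2) AHs b] closed(2)[OF v]])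
      also have "\<dots> = ?\<Phi> x h v"
        by (rule lift_cong[OF spaces(2,3) AHs d _ closed(2)[OF v]])
          (simp add: lift_pureC[OF spaces(1,2) AHs b] module_homs_closed[OF z] closed)
      finally show "tensor_lift AH (\<lambda>y g. pureC A H (x \<otimes>\<^bsub>A\<^esub> y) (h \<otimes>\<^bsub>H\<^esub> g)) (\<delta> (z v)) = ?\<Phi> x h v" .
    qed
    finally show "\<delta> (a \<otimes>\<^bsub>A\<^esub> z v) = tensor_lift AH (\<lambda>x h. ?\<Phi> x h v) (\<delta> a)" .
  qed
  also have "\<dots> = tensor_lift AH (\<lambda>a v. tensor_lift AH (?\<Phi> a) (\<rho> v)) p"
    by (rule cotensor_swap[OF p AHs tri])
  also have "\<dots> = tensor_lift AH (\<lambda>a v. pureC A H (a \<otimes>\<^bsub>A\<^esub> z v) \<one>\<^bsub>H\<^esub>) p"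
  proof (rule lift_cong[OF spaces(1,3) AHs _ _ pA])
    show "bilin A V AH (\<lambda>a v. pureC A H (a \<otimes>\<^bsub>A\<^esub> z v) \<one>\<^bsub>H\<^esub>)" by (assumption | rule lins zl)+
    fix a v assume a: "a \<in> carrier A" and v: "v \<in> carrier V"
    let ?\<Psi> = "\<lambda>h g w. pureC A H (a \<otimes>\<^bsub>A\<^esub> z w) (h \<otimes>\<^bsub>H\<^esub> ?S g)"
    have \<Psi>: "trilin H H V AH ?\<Psi>" by (insert a, (assumption | rule lins zl)+)
    have G: "(\<lambda>w. pureC A H (a \<otimes>\<^bsub>A\<^esub> z w) \<one>\<^bsub>H\<^esub>) \<in> linear_maps V AH" by (insert a, (assumption | rule lins zl)+)
    have cu: "bilin H V V (\<lambda>h w. counit H h \<odot>\<^bsub>V\<^esub> w)" by (assumption | rule lins)+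
    have "tensor_lift AH (?\<Phi> a) (\<rho> v) = tensor_lift AH (\<lambda>h w. tensor_lift AH (\<lambda>h g. ?\<Psi> h g w) (comul H h)) (\<rho> v)"
      by (rule \<rho>_coassoc[OF AHs \<Psi> v, symmetric])
    also have "\<dots> = tensor_lift AH (\<lambda>h w. pureC A H (a \<otimes>\<^bsub>A\<^esub> z (counit H h \<odot>\<^bsub>V\<^esub> w)) \<one>\<^bsub>H\<^esub>) (\<rho> v)"
    proof (rule lift_cong[OF spaces(2,3) AHs _ _ closed(2)[OF v]])
      show "bilin H V AH (\<lambda>h w. pureC A H (a \<otimes>\<^bsub>A\<^esub> z (counit H h \<odot>\<^bsub>V\<^esub> w)) \<one>\<^bsub>H\<^esub>)"
        by (insert a, (assumption | rule lins zl)+)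
      fix h w assume h: "h \<in> carrier H" and w: "w \<in> carrier V"
      have azw: "a \<otimes>\<^bsub>A\<^esub> z w \<in> carrier A" by (insert a w, (assumption | rule lins zl)+)
      have r: "pureC A H (a \<otimes>\<^bsub>A\<^esub> z w) \<in> linear_maps H AH"
        by (rule bilin_right[OF pureC_bilin[OF spaces(1,2)] azw])
      have hs: "bilin H H H (\<lambda>h g. h \<otimes>\<^bsub>H\<^esub> ?S g)" by (assumption | rule lins)+
      have "tensor_lift AH (\<lambda>h g. ?\<Psi> h g w) (comul H h) =
          pureC A H (a \<otimes>\<^bsub>A\<^esub> z w) (tensor_lift H (\<lambda>h g. h \<otimes>\<^bsub>H\<^esub> ?S g) (comul H h))"
        by (rule lift_comp[OF spaces(2,2,2) AHs hs r closed(3)[OF h], symmetric])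
      also have "\<dots> = counit H h \<odot>\<^bsub>AH\<^esub> pureC A H (a \<otimes>\<^bsub>A\<^esub> z w) \<one>\<^bsub>H\<^esub>"
        using H.antipode_right[OF h] by (simp add: lin_smult[OF r])
      also have "\<dots> = pureC A H (a \<otimes>\<^bsub>A\<^esub> z (counit H h \<odot>\<^bsub>V\<^esub> w)) \<one>\<^bsub>H\<^esub>"
        by (rule lin_smult[OF G w, symmetric])
      finally show "tensor_lift AH (\<lambda>h g. ?\<Psi> h g w) (comul H h) =
        pureC A H (a \<otimes>\<^bsub>A\<^esub> z (counit H h \<odot>\<^bsub>V\<^esub> w)) \<one>\<^bsub>H\<^esub>" .
    qed
    also have "\<dots> = pureC A H (a \<otimes>\<^bsub>A\<^esub> z (tensor_lift V (\<lambda>h w. counit H h \<odot>\<^bsub>V\<^esub> w) (\<rho> v))) \<one>\<^bsub>H\<^esub>"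
      by (rule lift_comp[OF spaces(2,3,3) AHs cu G closed(2)[OF v], symmetric])
    finally show "tensor_lift AH (?\<Phi> a) (\<rho> v) = pureC A H (a \<otimes>\<^bsub>A\<^esub> z v) \<one>\<^bsub>H\<^esub>"
      by (simp add: \<rho>_counit[OF v])
  qed
  also have "\<dots> = pureC A H (tensor_lift A (\<lambda>a v. a \<otimes>\<^bsub>A\<^esub> z v) p) \<one>\<^bsub>H\<^esub>"
    by (rule lift_comp[OF spaces(1,3,1) AHs cb one pA, symmetric])
  finally show ?thesis
    using lift_closed[OF spaces(1,3,1) cb pA] by (simp add: carrier_B)
qed

lemma finsum_P:
  assumes "finite I" "\<And>i. i \<in> I \<Longrightarrow> g i \<in> carrier P"
  shows "(\<Oplus>\<^bsub>P\<^esub>i\<in>I. g i) = (\<Oplus>\<^bsub>AV\<^esub>i\<in>I. g i)"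
proof -
  have "(\<lambda>x. x) \<in> add_homs P AV"
    using cotensor_subspace(1) by (auto simp: add_homs_def)
  from add_homs_finsum[OF left_module_abelian[OF P_left_module] space_group[OF tensorC_space[OF spaces(1,3)]] this assms]
  show ?thesis .
qed

text \<open>
  On all of \<open>A \<otimes> V\<close> the expansion \<open>a \<otimes> v = a (1 \<otimes> v) = \<Sum>\<^sub>k (a z\<^sub>k(v)) q\<^sub>k\<close> holds by the last frame
  condition; on the cotensor product its coefficients are invariant.
\<close>

lemma frame_dual_basis:
  assumes fr: "frame n z q"
  shows "dual_basis B P n q (\<lambda>k p. tensor_lift A (\<lambda>a v. a \<otimes>\<^bsub>A\<^esub> z k v) p)"
proof -
  note AVs = tensorC_space[OF spaces(1,3)]
  interpret AV: module complex_ring AV by (rule AVs)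
  interpret PM: left_module B P by (rule P_left_module)
  let ?\<kappa> = "\<lambda>k p. tensor_lift A (\<lambda>a v. a \<otimes>\<^bsub>A\<^esub> z k v) p"
  note qP = frameD(1)[OF fr]
  note z = frameD(2)[OF fr]
  note cb = coefficient_bilin[OF z]
  note cl = lift_linear[OF spaces(1,3,1) cb]
  have \<kappa>B: "?\<kappa> k p \<in> carrier B" if "k < n" "p \<in> cotensor H A \<delta> V \<rho>" for k p
    by (rule coefficient_coinvariant[OF z[OF that(1)] frameD(3)[OF fr that(1)] that(2)])
  have \<kappa>mult: "?\<kappa> k (lact b t) = b \<otimes>\<^bsub>A\<^esub> ?\<kappa> k t"
    if k: "k < n" and b: "b \<in> carrier A" and t: "t \<in> carrier AV" for k b t
    by (rule tensorC_ext[OF spaces(1,3,1) lin_comp[OF cl[OF k] left_mult_AV_lin[OF b]]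
          lin_comp[OF left_mult_lin[OF b] cl[OF k]] _ t])
      (use b in \<open>simp_all add: left_mult_AV_pure lift_pureC[OF spaces(1,3,1) cb[OF k]]
        module_homs_closed[OF z[OF k]] A.A.m_assoc\<close>)
  have \<kappa>: "?\<kappa> k \<in> module_homs B P (regular_module B)" if k: "k < n" for k
    by (rule module_homsI)
      (use k in \<open>simp_all add: \<kappa>B P_AV module_homs_add[OF cl[OF k]] \<kappa>mult B_subset\<close>)
  have sum: "(\<Oplus>\<^bsub>AV\<^esub>k\<in>{..<n}. lact (?\<kappa> k t) (q k)) = t" if t: "t \<in> carrier AV" for t
  proof (rule tensorC_ext[OF spaces(1,3) AVs _ module_homs_id _ t])
    show "(\<lambda>t. \<Oplus>\<^bsub>AV\<^esub>k\<in>{..<n}. lact (?\<kappa> k t) (q k)) \<in> linear_maps AV AV"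
      by (rule lin_finsum[OF AVs])
        (auto intro!: lin_comp[OF bilin_left[OF left_mult_AV_bilin]] cl P_AV[OF qP])
    fix a v assume a: "a \<in> carrier A" and v: "v \<in> carrier V"
    have qA: "q k \<in> carrier AV" if "k < n" for k using P_AV[OF qP[OF that]] .
    have "(\<Oplus>\<^bsub>AV\<^esub>k\<in>{..<n}. lact (?\<kappa> k (pureC A V a v)) (q k)) =
        (\<Oplus>\<^bsub>AV\<^esub>k\<in>{..<n}. lact a (lact (z k v) (q k)))"
      by (rule AV.finsum_cong')
        (use a v in \<open>auto simp: lift_pureC[OF spaces(1,3,1) cb] left_mult_AV_mult module_homs_closed[OF z] qA
          intro!: module_homs_closed[OF left_mult_AV_lin]\<close>)
    also have "\<dots> = lact a (\<Oplus>\<^bsub>AV\<^esub>k\<in>{..<n}. lact (z k v) (q k))"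
      by (rule lin_of_finsum[OF AVs AVs
            left_mult_AV_lin[OF a], symmetric])
        (use v in \<open>auto intro!: module_homs_closed[OF left_mult_AV_lin] module_homs_closed[OF z] qA\<close>)
    also have "\<dots> = pureC A V a v"
      using a v by (simp add: frameD(4)[OF fr v] left_mult_AV_pure)
    finally show "(\<Oplus>\<^bsub>AV\<^esub>k\<in>{..<n}. lact (?\<kappa> k (pureC A V a v)) (q k)) = pureC A V a v" .
  qed
  have "p = (\<Oplus>\<^bsub>P\<^esub>k\<in>{..<n}. ?\<kappa> k p \<odot>\<^bsub>P\<^esub> q k)" if p: "p \<in> carrier P" for p
  proof -
    have "(\<Oplus>\<^bsub>P\<^esub>k\<in>{..<n}. ?\<kappa> k p \<odot>\<^bsub>P\<^esub> q k) = (\<Oplus>\<^bsub>AV\<^esub>k\<in>{..<n}. ?\<kappa> k p \<odot>\<^bsub>P\<^esub> q k)"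
      by (rule finsum_P) (use p \<kappa>B qP in \<open>auto intro: cotensor_smult_closed\<close>)
    also have "\<dots> = p" using sum[of p] p by (simp add: P_AV)
    finally show ?thesis by simp
  qed
  then show ?thesis using \<kappa> qP by (simp add: dual_basis_def)
qed

end

locale cotensor_map = dom: cotensor_data H A \<delta> V \<rho> + cod: cotensor_data H A' \<delta>' V \<rho>
  for H :: "'h hopf" and A :: "(complex, 'a) module" and \<delta> and V :: "(complex, 'v) module" and \<rho>
    and A' :: "(complex, 'b) module" and \<delta>' +
  fixes f :: "'a \<Rightarrow> 'b"
  assumes f_alg: "f \<in> algebra_homs A A'" and f_colin: "f \<in> colinear_maps H A \<delta> A' \<delta>'"
begin

lemma f_lin: "f \<in> linear_maps A A'"
  using f_alg by (simp add: algebra_homs_def)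

lemma fA_closed: "a \<in> carrier A \<Longrightarrow> f a \<in> carrier A'"
  by (rule module_homs_closed[OF f_lin])

lemma fA_mult: "\<lbrakk>a \<in> carrier A; b \<in> carrier A\<rbrakk> \<Longrightarrow> f (a \<otimes>\<^bsub>A\<^esub> b) = f a \<otimes>\<^bsub>A'\<^esub> f b"
  using f_alg by (simp add: algebra_homs_def ring_hom_mult)

lemma fA_one: "f \<one>\<^bsub>A\<^esub> = \<one>\<^bsub>A'\<^esub>"
  using f_alg by (simp add: algebra_homs_def ring_hom_one)

lemma \<delta>'_f: "a \<in> carrier A \<Longrightarrow> \<delta>' (f a) = tensor_map A' H f id (\<delta> a)"
  using f_colin by (simp add: colinear_maps_def)

lemma f_B: "b \<in> carrier dom.B \<Longrightarrow> f b \<in> carrier cod.B"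
  by (simp add: dom.carrier_B cod.carrier_B \<delta>'_f fA_closed
      tensor_map_pure[OF dom.spaces(1,2) cod.spaces(1,2) f_lin lin_id])

lemma f_ring_hom: "f \<in> ring_hom dom.B cod.B"
  by (rule ring_hom_memI) (simp_all add: f_B fA_mult fA_one module_homs_add[OF f_lin] dom.B_subset)

lemma f_algebra_hom: "f \<in> algebra_homs dom.B cod.B"
  using f_ring_hom
  by (auto simp: algebra_homs_def f_B dom.B_subset module_homs_add[OF f_lin] lin_smult[OF f_lin] intro!: module_homsI)

sublocale base_ring_hom dom.B cod.B f
  by (intro base_ring_hom.intro base_ring_hom_axioms.intro dom.ring_B cod.ring_B f_ring_hom)

abbreviation "fV \<equiv> tensor_map A' V f id"

lemma fV_lin: "fV \<in> linear_maps dom.AV cod.AV"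
  by (rule tensor_map_linear[OF dom.spaces(1,3) cod.spaces(1,3) f_lin lin_id])

lemma fV_pure: "\<lbrakk>a \<in> carrier A; v \<in> carrier V\<rbrakk> \<Longrightarrow> fV (pureC A V a v) = pureC A' V (f a) v"
  using tensor_map_pure[OF dom.spaces(1,3) cod.spaces(1,3) f_lin lin_id] by simp

lemma fV_mult:
  assumes x: "x \<in> carrier A" and t: "t \<in> carrier dom.AV"
  shows "fV (dom.lact x t) = cod.lact (f x) (fV t)"
  by (rule tensorC_ext[OF dom.spaces(1,3) tensorC_space[OF cod.spaces(1,3)] lin_comp[OF fV_lin dom.left_mult_AV_lin[OF x]]
        lin_comp[OF cod.left_mult_AV_lin[OF fA_closed[OF x]] fV_lin] _ t])
    (use x in \<open>simp_all add: dom.left_mult_AV_pure cod.left_mult_AV_pure fV_pure fA_mult fA_closed\<close>)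

lemma fV_cotensor:
  assumes p: "p \<in> cotensor H A \<delta> V \<rho>" shows "fV p \<in> cotensor H A' \<delta>' V \<rho>"
proof -
  note HV = tensorC_space[OF dom.spaces(2,3)]
  note AHV = tensorC_space[OF cod.spaces(1) HV]
  note pA = dom.P_AV[OF p]
  note fl = lin_comp[OF f_lin] fA_closed
  let ?pp = "\<lambda>a h v. pureC A' (tensorC H V) a (pureC H V h v)"
  have "tensor_lift cod.AHV (\<lambda>a v. tensor_lift cod.AHV (\<lambda>x h. ?pp x h v) (\<delta>' a)) (fV p) =
      tensor_lift cod.AHV (\<lambda>a v. tensor_lift cod.AHV (\<lambda>x h. ?pp x h v) (\<delta>' (f a))) p"
    using lift_tensor_map[OF dom.spaces(1,3) cod.spaces(1,3) f_lin lin_id AHV cod.equalizer_left_bilin pA] by simp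
  also have "\<dots> = tensor_lift cod.AHV (\<lambda>a v. tensor_lift cod.AHV (\<lambda>x h. ?pp (f x) h v) (\<delta> a)) p"
  proof (rule lift_cong[OF dom.spaces(1,3) AHV _ _ pA])
    show "bilin A V cod.AHV (\<lambda>a v. tensor_lift cod.AHV (\<lambda>x h. ?pp (f x) h v) (\<delta> a))"
      by (assumption | rule dom.lins cod.lins fl)+
    fix a v assume av: "a \<in> carrier A" "v \<in> carrier V"
    have bl: "bilin A' H cod.AHV (\<lambda>x h. ?pp x h v)" by (insert av, (assumption | rule cod.lins)+)
    show "tensor_lift cod.AHV (\<lambda>x h. ?pp x h v) (\<delta>' (f a)) = tensor_lift cod.AHV (\<lambda>x h. ?pp (f x) h v) (\<delta> a)"
      using lift_tensor_map[OF dom.spaces(1,2) cod.spaces(1,2) f_lin lin_id AHV bl dom.closed(1)[OF av(1)]]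
      by (simp add: \<delta>'_f[OF av(1)])
  qed
  also have "\<dots> = tensor_lift cod.AHV (\<lambda>a v. tensor_lift cod.AHV (\<lambda>h w. ?pp (f a) h w) (\<rho> v)) p"
    by (rule dom.cotensor_swap[OF p AHV]) (assumption | rule dom.lins cod.lins fl)+
  also have "\<dots> = tensor_lift cod.AHV (\<lambda>a v. pureC A' (tensorC H V) (f a) (\<rho> v)) p"
  proof (rule lift_cong[OF dom.spaces(1,3) AHV _ _ pA])
    show "bilin A V cod.AHV (\<lambda>a v. pureC A' (tensorC H V) (f a) (\<rho> v))"
      by (assumption | rule dom.lins cod.lins fl)+
    fix a v assume av: "a \<in> carrier A" "v \<in> carrier V"
    show "tensor_lift cod.AHV (\<lambda>h w. ?pp (f a) h w) (\<rho> v) = pureC A' (tensorC H V) (f a) (\<rho> v)"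
      using lift_comp[OF dom.spaces(2,3) HV AHV pureC_bilin[OF dom.spaces(2,3)]
          bilin_right[OF pureC_bilin[OF cod.spaces(1) HV] fA_closed[OF av(1)]] dom.closed(2)[OF av(2)]]
      by (simp add: lift_pureC_id[OF dom.spaces(2,3) dom.closed(2)[OF av(2)]])
  qed
  also have "\<dots> = tensor_lift cod.AHV (\<lambda>a v. pureC A' (tensorC H V) a (\<rho> v)) (fV p)"
    using lift_tensor_map[OF dom.spaces(1,3) cod.spaces(1,3) f_lin lin_id AHV cod.equalizer_right_bilin pA] by simp
  finally show ?thesis
    using module_homs_closed[OF fV_lin pA] by (simp add: cod.cotensor_iff)
qed

text \<open>
  Every frame condition is an equation between expressions built from the algebra structure and the
  coaction, both of which \<open>f\<close> respects.
\<close>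

lemma frame_push:
  assumes fr: "dom.frame n z q"
  shows "cod.frame n (\<lambda>k v. f (z k v)) (\<lambda>k. fV (q k))"
  unfolding cod.frame_def
proof (intro conjI allI impI ballI)
  note AHs = tensorC_space[OF dom.spaces(1,2)] and AHs' = tensorC_space[OF cod.spaces(1,2)]
  note AVs = tensorC_space[OF dom.spaces(1,3)] and AVs' = tensorC_space[OF cod.spaces(1,3)]
  interpret AV': module complex_ring cod.AV by (rule AVs')
  fix k assume k: "k < n"
  note z = dom.frameD(2)[OF fr k]
  note zl = lin_comp[OF z] module_homs_closed[OF z] lin_comp[OF f_lin] fA_closed
  show "fV (q k) \<in> cotensor H A' \<delta>' V \<rho>" by (rule fV_cotensor[OF dom.frameD(1)[OF fr k]])
  show "(\<lambda>v. f (z k v)) \<in> linear_maps V A'" by (rule lin_comp[OF f_lin z])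
  fix v assume v: "v \<in> carrier V"
  have b: "bilin H V dom.AH (\<lambda>h w. pureC A H (z k w) (antipode H h))" by (assumption | rule dom.lins zl)+
  have b': "bilin H V cod.AH (\<lambda>h w. pureC A' H (f (z k w)) (antipode H h))"
    by (assumption | rule dom.lins cod.lins zl)+
  have "\<delta>' (f (z k v)) = tensor_map A' H f id (tensor_lift dom.AH (\<lambda>h w. pureC A H (z k w) (antipode H h)) (\<rho> v))"
    using \<delta>'_f[OF module_homs_closed[OF z v]] dom.frameD(3)[OF fr k v] by simp
  also have "\<dots> = tensor_lift cod.AH (\<lambda>h w. tensor_map A' H f id (pureC A H (z k w) (antipode H h))) (\<rho> v)"
    by (rule lift_comp[OF dom.spaces(2,3) AHs AHs' b
          tensor_map_linear[OF dom.spaces(1,2) cod.spaces(1,2) f_lin lin_id] dom.closed(2)[OF v]])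
  also have "\<dots> = tensor_lift cod.AH (\<lambda>h w. pureC A' H (f (z k w)) (antipode H h)) (\<rho> v)"
    by (rule lift_cong[OF dom.spaces(2,3) AHs' b' _ dom.closed(2)[OF v]])
      (simp add: tensor_map_pure[OF dom.spaces(1,2) cod.spaces(1,2) f_lin lin_id] module_homs_closed[OF z] dom.closed)
  finally show "\<delta>' (f (z k v)) = tensor_lift cod.AH (\<lambda>h w. pureC A' H (f (z k w)) (antipode H h)) (\<rho> v)" .
next
  note AVs = tensorC_space[OF dom.spaces(1,3)] and AVs' = tensorC_space[OF cod.spaces(1,3)]
  interpret AV': module complex_ring cod.AV by (rule AVs')
  fix v assume v: "v \<in> carrier V"
  have qA: "q k \<in> carrier dom.AV" if "k < n" for k using dom.P_AV[OF dom.frameD(1)[OF fr that]] .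
  note z = dom.frameD(2)[OF fr]
  have "(\<Oplus>\<^bsub>cod.AV\<^esub>k\<in>{..<n}. cod.lact (f (z k v)) (fV (q k))) =
      (\<Oplus>\<^bsub>cod.AV\<^esub>k\<in>{..<n}. fV (dom.lact (z k v) (q k)))"
    by (rule AV'.finsum_cong') (use v in \<open>auto simp: fV_mult module_homs_closed[OF z] qA
        intro!: module_homs_closed[OF cod.left_mult_AV_lin] module_homs_closed[OF dom.left_mult_AV_lin]
        module_homs_closed[OF fV_lin] fA_closed\<close>)
  also have "\<dots> = fV (\<Oplus>\<^bsub>dom.AV\<^esub>k\<in>{..<n}. dom.lact (z k v) (q k))"
    by (rule lin_of_finsum[OF AVs AVs' fV_lin, symmetric])
      (use v in \<open>auto intro!: module_homs_closed[OF dom.left_mult_AV_lin] module_homs_closed[OF z] qA\<close>)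
  also have "\<dots> = pureC A' V \<one>\<^bsub>A'\<^esub> v"
    using v by (simp add: dom.frameD(4)[OF fr v] fV_pure fA_one)
  finally show "(\<Oplus>\<^bsub>cod.AV\<^esub>k\<in>{..<n}. cod.lact (f (z k v)) (fV (q k))) = pureC A' V \<one>\<^bsub>A'\<^esub> v" .
qed

lemma coefficient_push:
  assumes z: "z \<in> linear_maps V A" and t: "t \<in> carrier dom.AV"
  shows "tensor_lift A' (\<lambda>a v. a \<otimes>\<^bsub>A'\<^esub> f (z v)) (fV t) = f (tensor_lift A (\<lambda>a v. a \<otimes>\<^bsub>A\<^esub> z v) t)"
proof -
  note b = dom.coefficient_bilin[OF z] and b' = cod.coefficient_bilin[OF lin_comp[OF f_lin z]]
  show ?thesis
    by (rule tensorC_ext[OF dom.spaces(1,3) cod.spaces(1) lin_comp[OF lift_linear[OF cod.spaces(1,3,1) b'] fV_lin]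
          lin_comp[OF f_lin lift_linear[OF dom.spaces(1,3,1) b]] _ t])
      (simp add: fV_pure lift_pureC[OF cod.spaces(1,3,1) b'] lift_pureC[OF dom.spaces(1,3,1) b] fA_mult fA_closed
        module_homs_closed[OF z])
qed

text \<open>
  The map \<open>s \<otimes> p \<mapsto> s f(p)\<close> is inverted by \<open>p' \<mapsto> \<Sum>\<^sub>k \<kappa>'\<^sub>k(p') \<otimes> q\<^sub>k\<close>, where \<open>\<kappa>'\<close> are the coordinates for the
  pushed frame.  One composite is the expansion of \<open>p'\<close> in the pushed frame.  For the other, \<open>f\<close> intertwines
  the coordinates, and \<open>\<Sum>\<^sub>k f(\<kappa>\<^sub>k p) \<otimes> q\<^sub>k = 1 \<otimes> \<Sum>\<^sub>k \<kappa>\<^sub>k(p) q\<^sub>k = 1 \<otimes> p\<close>.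
\<close>

theorem base_change_isomorphic:
  assumes fr: "dom.frame n z q"
  shows "module_isomorphic cod.B (BC dom.P) cod.P"
proof -
  note P = dom.P_left_module and P' = cod.P_left_module
  interpret P: left_module dom.B dom.P by (rule P)
  interpret P': left_module cod.B cod.P by (rule P')
  interpret BC: left_module cod.B "BC dom.P" by (rule BC_left_module[OF P])
  let ?z = "\<lambda>k v. f (z k v)"
  let ?\<kappa> = "\<lambda>k p. tensor_lift A (\<lambda>a v. a \<otimes>\<^bsub>A\<^esub> z k v) p"
  let ?\<kappa>' = "\<lambda>k p. tensor_lift A' (\<lambda>a v. a \<otimes>\<^bsub>A'\<^esub> ?z k v) p"
  note db = dom.frame_dual_basis[OF fr] and db' = cod.frame_dual_basis[OF frame_push[OF fr]]
  obtain h where h: "h \<in> module_homs cod.B (BC dom.P) cod.P"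
    and h_pure: "\<And>s p. \<lbrakk>s \<in> carrier cod.B; p \<in> carrier dom.P\<rbrakk> \<Longrightarrow> h (pb dom.P s p) = s \<odot>\<^bsub>cod.P\<^esub> fV p"
  proof (rule BC_lift[OF P P', of fV])
  qed (simp_all add: fV_cotensor dom.P_AV module_homs_add[OF fV_lin] fV_mult dom.B_subset)
  have pbc: "pb dom.P \<one>\<^bsub>cod.B\<^esub> (q k) \<in> carrier (BC dom.P)" if "k < n" for k
    by (rule pb_closed[OF P S.one_closed dual_basisD(1)[OF db that]])
  let ?g = "\<lambda>p. \<Oplus>\<^bsub>BC dom.P\<^esub>k\<in>{..<n}. ?\<kappa>' k p \<odot>\<^bsub>BC dom.P\<^esub> pb dom.P \<one>\<^bsub>cod.B\<^esub> (q k)"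
  have g: "?g \<in> module_homs cod.B cod.P (BC dom.P)"
    by (rule module_homs_coefficient_sum[OF BC_left_module[OF P]]) (use pbc dual_basisD(2)[OF db'] in auto)
  show ?thesis
  proof (rule module_isomorphicI[OF BC_left_module[OF P] P' h g])
    fix u assume u: "u \<in> carrier (BC dom.P)"
    have "?g (h (pb dom.P \<one>\<^bsub>cod.B\<^esub> p)) = pb dom.P \<one>\<^bsub>cod.B\<^esub> p" if p: "p \<in> carrier dom.P" for p
    proof -
      have clo: "?\<kappa> k p \<odot>\<^bsub>dom.P\<^esub> q k \<in> carrier dom.P" if "k < n" for k
        by (rule P.lsmult_closed[OF dual_basisD(3)[OF db that p] dual_basisD(1)[OF db that]])
      have pb_hom: "pb dom.P \<one>\<^bsub>cod.B\<^esub> \<in> add_homs dom.P (BC dom.P)"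
        by (rule add_homsI) (rule pb_closed[OF P S.one_closed] pb_add_right[OF P S.one_closed]; assumption)+
      have hp: "h (pb dom.P \<one>\<^bsub>cod.B\<^esub> p) = fV p"
        using h_pure[OF _ p, of "\<one>\<^bsub>cod.B\<^esub>"] P'.lsmult_one[of "fV p"] fV_cotensor[of p] p S.one_closed by simp
      have "?g (fV p) = (\<Oplus>\<^bsub>BC dom.P\<^esub>k\<in>{..<n}. pb dom.P \<one>\<^bsub>cod.B\<^esub> (?\<kappa> k p \<odot>\<^bsub>dom.P\<^esub> q k))"
      proof (rule BC.finsum_cong')
        fix k assume "k \<in> {..<n}"
        then have k: "k < n" by simp
        note \<kappa>p = dual_basisD(3)[OF db k p]
        have qk: "q k \<in> carrier dom.P" by (rule dual_basisD(1)[OF db k])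
        have "?\<kappa>' k (fV p) = f (?\<kappa> k p)"
          by (rule coefficient_push[OF dom.frameD(2)[OF fr k]]) (use p in \<open>simp add: dom.P_AV\<close>)
        then have "?\<kappa>' k (fV p) \<odot>\<^bsub>BC dom.P\<^esub> pb dom.P \<one>\<^bsub>cod.B\<^esub> (q k) = pb dom.P (f (?\<kappa> k p) \<otimes>\<^bsub>cod.B\<^esub> \<one>\<^bsub>cod.B\<^esub>) (q k)"
          using BC_smult_pure[OF P f_closed[OF \<kappa>p] S.one_closed qk] by simp
        also have "\<dots> = pb dom.P (\<one>\<^bsub>cod.B\<^esub> \<otimes>\<^bsub>cod.B\<^esub> f (?\<kappa> k p)) (q k)"
          using f_closed[OF \<kappa>p] S.r_one S.l_one by metis
        also have "\<dots> = pb dom.P \<one>\<^bsub>cod.B\<^esub> (?\<kappa> k p \<odot>\<^bsub>dom.P\<^esub> q k)"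
          by (rule pb_balanced[OF P S.one_closed \<kappa>p qk])
        finally show "?\<kappa>' k (fV p) \<odot>\<^bsub>BC dom.P\<^esub> pb dom.P \<one>\<^bsub>cod.B\<^esub> (q k) = pb dom.P \<one>\<^bsub>cod.B\<^esub> (?\<kappa> k p \<odot>\<^bsub>dom.P\<^esub> q k)" .
      qed (simp, intro Pi_I pb_closed[OF P S.one_closed clo], simp)
      also have "\<dots> = pb dom.P \<one>\<^bsub>cod.B\<^esub> (\<Oplus>\<^bsub>dom.P\<^esub>k\<in>{..<n}. ?\<kappa> k p \<odot>\<^bsub>dom.P\<^esub> q k)"
        by (rule add_homs_finsum[OF left_module_abelian[OF P] BC_abelian[OF P] pb_hom, symmetric])
          (simp_all only: finite_lessThan lessThan_iff clo)
      also have "\<dots> = pb dom.P \<one>\<^bsub>cod.B\<^esub> p" by (simp only: dual_basisD(4)[OF db p])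
      finally show ?thesis unfolding hp .
    qed
    then show "?g (h u) = u"
      by (rule BC_ext[OF P BC_left_module[OF P] module_homs_comp[OF h g] module_homs_id _ u])
  next
    fix p assume p: "p \<in> carrier cod.P"
    have "h (?g p) = (\<Oplus>\<^bsub>cod.P\<^esub>k\<in>{..<n}. h (?\<kappa>' k p \<odot>\<^bsub>BC dom.P\<^esub> pb dom.P \<one>\<^bsub>cod.B\<^esub> (q k)))"
      by (rule module_homs_finsum[OF BC_left_module[OF P] P' h])
        (use p pbc dual_basisD(3)[OF db'] in \<open>auto intro!: BC.lsmult_closed\<close>)
    also have "\<dots> = (\<Oplus>\<^bsub>cod.P\<^esub>k\<in>{..<n}. ?\<kappa>' k p \<odot>\<^bsub>cod.P\<^esub> fV (q k))"
    proof (rule P'.finsum_cong')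
      fix k assume "k \<in> {..<n}"
      then have k: "k < n" by simp
      have qk: "q k \<in> carrier dom.P" by (rule dual_basisD(1)[OF db k])
      have "h (?\<kappa>' k p \<odot>\<^bsub>BC dom.P\<^esub> pb dom.P \<one>\<^bsub>cod.B\<^esub> (q k)) = ?\<kappa>' k p \<odot>\<^bsub>cod.P\<^esub> h (pb dom.P \<one>\<^bsub>cod.B\<^esub> (q k))"
        by (rule module_homs_smult[OF h dual_basisD(3)[OF db' k p] pbc[OF k]])
      also have "h (pb dom.P \<one>\<^bsub>cod.B\<^esub> (q k)) = fV (q k)"
        using h_pure[OF S.one_closed qk] P'.lsmult_one[OF dual_basisD(1)[OF db' k]] by simp
      finally show "h (?\<kappa>' k p \<odot>\<^bsub>BC dom.P\<^esub> pb dom.P \<one>\<^bsub>cod.B\<^esub> (q k)) = ?\<kappa>' k p \<odot>\<^bsub>cod.P\<^esub> fV (q k)" .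
    qed (simp, intro Pi_I P'.lsmult_closed dual_basisD(1,3)[OF db'] p, simp_all)
    also have "\<dots> = p" by (rule dual_basisD(4)[OF db' p])
    finally show "h (?g p) = p" .
  qed
qed

end

section \<open>Strong connections yield frames\<close>

locale strong_connection_data = cotensor_data H A \<delta> V \<rho>
  for H :: "'h hopf" and A :: "(complex, 'a) module" and \<delta> and V :: "(complex, 'v) module" and \<rho> +
  fixes l :: "'h \<Rightarrow> ('a, 'a) tens"
  assumes conn: "strong_connection H A \<delta> l" and bij_S: "bij_betw (antipode H) (carrier H) (carrier H)"
begin

lemma l_lin: "l \<in> linear_maps H (tensorC A A)"
  using conn by (simp add: strong_connection_def)

lemmas l_rules = lin_comp[OF l_lin] module_homs_closed[OF l_lin]

abbreviation "Sinv \<equiv> inv_into (carrier H) (antipode H)"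

lemma Sinv_lin: "Sinv \<in> linear_maps H H"
  by (rule module_homs_inv_into[OF spaces(2)[unfolded complex_space_iff] S_lin bij_S])

lemma S_Sinv: "h \<in> carrier H \<Longrightarrow> antipode H (Sinv h) = h"
  by (rule bij_betw_inv_into_right[OF bij_S])

text \<open>
  With \<open>l(h) = \<Sum> x \<otimes> y\<close>, right colinearity is \<open>x \<otimes> y\<^sub>0 \<otimes> y\<^sub>1 = l(h\<^sub>1) \<otimes> h\<^sub>2\<close>.
\<close>

lemma l_right_colinear:
  assumes K: "complex_space K" and \<Phi>: "trilin A A H K \<Phi>" and h: "h \<in> carrier H"
  shows "tensor_lift K (\<lambda>x y. tensor_lift K (\<Phi> x) (\<delta> y)) (l h) =
    tensor_lift K (\<lambda>h g. tensor_lift K (\<lambda>x y. \<Phi> x y g) (l h)) (comul H h)"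
  by (rule lift_coassoc[OF spaces(1,1,2) K spaces(2,1) l_lin \<delta>_lin closed(3)[OF h] module_homs_closed[OF l_lin h] _ \<Phi>, symmetric])
    (use conn h in \<open>simp add: strong_connection_def\<close>)

text \<open>
  Left colinearity is stated with the inverse of the antipode.  Applying the antipode to the leg in \<open>H\<close> gives
  the form used here: \<open>x\<^sub>0 \<otimes> x\<^sub>1 \<otimes> y\<close> equals \<open>x \<otimes> S(h\<^sub>1) \<otimes> y\<close> with \<open>x \<otimes> y\<close> running through \<open>l(h\<^sub>2)\<close>.
\<close>

lemma l_left_colinear:
  assumes K: "complex_space K" and \<Phi>: "trilin A H A K \<Phi>" and h: "h \<in> carrier H"
  shows "tensor_lift K (\<lambda>x y. tensor_lift K (\<lambda>a g. \<Phi> a g y) (\<delta> x)) (l h) =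
    tensor_lift K (\<lambda>h g. tensor_lift K (\<lambda>x y. \<Phi> x (antipode H h) y) (l g)) (comul H h)"
proof -
  let ?S = "antipode H"
  let ?D = "\<lambda>a. tensor_map H A Sinv id (tensor_flip A H (\<delta> a))"
  let ?\<Psi> = "\<lambda>h x y. \<Phi> x (?S h) y"
  note tb = trilin_bilin[OF spaces(1,2,1) K \<Phi>]
  have D: "?D \<in> linear_maps A (tensorC H A)"
    by (rule lin_comp[OF tensor_map_linear[OF spaces(2,1,2,1) Sinv_lin lin_id]
          lin_comp[OF tensor_flip_linear[OF spaces(1,2)] \<delta>_lin]])
  have \<Psi>: "trilin H A A K ?\<Psi>"
    by (rule trilinI; (rule lin_comp[OF bilin_right[OF tb(2)] S_lin] tb(3) tb(4) closed)?) (simp_all add: tb closed)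
  have eq: "tensor_assoc H A A (tensor_map (tensorC H A) A ?D id (l h)) = tensor_map H (tensorC A A) id l (comul H h)"
    using conn h by (simp add: strong_connection_def Let_def)
  have "tensor_lift K (\<lambda>x y. tensor_lift K (\<lambda>g a. ?\<Psi> g a y) (?D x)) (l h) =
      tensor_lift K (\<lambda>h g. tensor_lift K (?\<Psi> h) (l g)) (comul H h)"
    by (rule lift_coassoc[OF spaces(2,1,1) K spaces(1,2) D l_lin module_homs_closed[OF l_lin h] closed(3)[OF h] eq \<Psi>])
  moreover have "tensor_lift K (\<lambda>x y. tensor_lift K (\<lambda>g a. ?\<Psi> g a y) (?D x)) (l h) =
      tensor_lift K (\<lambda>x y. tensor_lift K (\<lambda>a g. \<Phi> a g y) (\<delta> x)) (l h)"
  proof (rule lift_cong[OF spaces(1,1) K _ _ module_homs_closed[OF l_lin h]])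
    show "bilin A A K (\<lambda>x y. tensor_lift K (\<lambda>a g. \<Phi> a g y) (\<delta> x))"
    proof (rule bilinI)
      show "(\<lambda>y. tensor_lift K (\<lambda>a g. \<Phi> a g y) (\<delta> x)) \<in> linear_maps A K" if "x \<in> carrier A" for x
        by (rule lin_lift_param[OF spaces(1,2) closed(1)[OF that] K spaces(1)]) (simp_all add: tb)
      show "(\<lambda>x. tensor_lift K (\<lambda>a g. \<Phi> a g y) (\<delta> x)) \<in> linear_maps A K" if "y \<in> carrier A" for y
        by (rule lin_comp[OF lift_linear[OF spaces(1,2) K tb(2)[OF that]] \<delta>_lin])
    qed
    fix x y assume x: "x \<in> carrier A" and y: "y \<in> carrier A"
    have b1: "bilin H A K (\<lambda>g a. ?\<Psi> g a y)"
      by (rule trilin_bilin(2)[OF spaces(2,1,1) K \<Psi> y])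
    have b2: "bilin H A K (\<lambda>g a. ?\<Psi> (Sinv g) a y)"
      using bilin_precomp[OF spaces(2,1,2,1) Sinv_lin lin_id b1] by simp
    have flip: "tensor_flip A H (\<delta> x) \<in> carrier (tensorC H A)"
      by (rule module_homs_closed[OF tensor_flip_linear[OF spaces(1,2)] closed(1)[OF x]])
    have "tensor_lift K (\<lambda>g a. ?\<Psi> g a y) (?D x) = tensor_lift K (\<lambda>g a. ?\<Psi> (Sinv g) (id a) y) (tensor_flip A H (\<delta> x))"
      by (rule lift_tensor_map[OF spaces(2,1,2,1) Sinv_lin lin_id K b1 flip])
    also have "\<dots> = tensor_lift K (\<lambda>a g. ?\<Psi> (Sinv g) a y) (\<delta> x)"
      using lift_tensor_flip[OF spaces(1,2) K b2 closed(1)[OF x]] by simp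
    also have "\<dots> = tensor_lift K (\<lambda>a g. \<Phi> a g y) (\<delta> x)"
      by (rule lift_cong[OF spaces(1,2) K tb(2)[OF y] _ closed(1)[OF x]]) (simp add: S_Sinv)
    finally show "tensor_lift K (\<lambda>g a. ?\<Psi> g a y) (?D x) = tensor_lift K (\<lambda>a g. \<Phi> a g y) (\<delta> x)" .
  qed
  ultimately show ?thesis by simp
qed

lemma l_mult: "h \<in> carrier H \<Longrightarrow> tensor_lift A (\<lambda>x y. x \<otimes>\<^bsub>A\<^esub> y) (l h) = counit H h \<odot>\<^bsub>A\<^esub> \<one>\<^bsub>A\<^esub>"
  using conn by (simp add: strong_connection_def)

text \<open>
  \<open>L v = l(v\<^sub>-\<^sub>1) \<otimes> v\<^sub>0\<close>, rebracketed so that the two factors to be separated are \<open>A\<close> and \<open>A \<otimes> V\<close>.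
\<close>

definition L :: "'v \<Rightarrow> ('a, ('a, 'v) tens) tens"
  where "L v = tensor_assoc A A V (tensor_map (tensorC A A) V l id (\<rho> v))"

lemma L_lin: "L \<in> linear_maps V (tensorC A AV)"
  unfolding L_def
  by (intro lin_comp[OF tensor_assoc_linear[OF spaces(1,1,3)]]
      lin_comp[OF tensor_map_linear[OF spaces(2,3) tensorC_space[OF spaces(1,1)] spaces(3) l_lin lin_id]] \<rho>_lin)

lemma lift_L:
  assumes K: "complex_space K" and g: "bilin A AV K g" and v: "v \<in> carrier V"
  shows "tensor_lift K g (L v) =
    tensor_lift K (\<lambda>h w. tensor_lift K (\<lambda>x y. g x (pureC A V y w)) (l h)) (\<rho> v)"
  unfolding L_def by (rule lift_assoc_map[OF spaces(1,1,3) K spaces(2) l_lin closed(2)[OF v] g])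

text \<open>
  With \<open>l(v\<^sub>-\<^sub>1) = \<Sum> x \<otimes> y\<close>, the contraction is \<open>\<Sum> \<phi>(x) y \<otimes> v\<^sub>0\<close>.  Coacting on \<open>y\<close> gives
  \<open>\<Sum> \<phi>(x) y \<otimes> v\<^sub>-\<^sub>1 \<otimes> v\<^sub>0\<close> with \<open>x \<otimes> y\<close> from \<open>l(v\<^sub>-\<^sub>2)\<close>, by right colinearity of \<open>l\<close>, and coacting
  on \<open>v\<^sub>0\<close> gives the same by coassociativity.
\<close>

lemma slice_cotensor:
  assumes \<phi>: "\<phi> \<in> linear_maps A CC" and v: "v \<in> carrier V"
  shows "tensor_lift AV (\<lambda>a u. \<phi> a \<odot>\<^bsub>AV\<^esub> u) (L v) \<in> cotensor H A \<delta> V \<rho>"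
proof -
  note AVs = tensorC_space[OF spaces(1,3)]
  note HV = tensorC_space[OF spaces(2,3)]
  note AHV = tensorC_space[OF spaces(1) HV]
  note rls = lins l_rules lin_comp[OF \<phi>]
  let ?pp = "\<lambda>a h v. pureC A (tensorC H V) a (pureC H V h v)"
  let ?p = "tensor_lift AV (\<lambda>h w. tensor_lift AV (\<lambda>x y. \<phi> x \<odot>\<^bsub>AV\<^esub> pureC A V y w) (l h)) (\<rho> v)"
  have g: "bilin A AV AV (\<lambda>a u. \<phi> a \<odot>\<^bsub>AV\<^esub> u)" by (assumption | rule rls)+
  have p: "tensor_lift AV (\<lambda>a u. \<phi> a \<odot>\<^bsub>AV\<^esub> u) (L v) = ?p" by (rule lift_L[OF AVs g v])
  have tri: "trilin A A V AV (\<lambda>x y w. \<phi> x \<odot>\<^bsub>AV\<^esub> pureC A V y w)" by (assumption | rule rls)+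
  note b0 = nested_bilin[OF spaces(1,1,3) AVs tri l_lin]
  have push: "F ?p = tensor_lift AHV (\<lambda>h w. tensor_lift AHV (\<lambda>x y. \<phi> x \<odot>\<^bsub>AHV\<^esub> F (pureC A V y w)) (l h)) (\<rho> v)"
    if F: "F \<in> linear_maps AV AHV" for F
    by (rule lift_comp_nested[OF spaces(1,1,3) AVs AHV spaces(2) tri l_lin F _ closed(2)[OF v]])
      (simp add: lin_smult[OF F] pureC_closed[OF spaces(1,3)])
  let ?F1 = "tensor_lift AHV (\<lambda>a v. tensor_lift AHV (\<lambda>x h. ?pp x h v) (\<delta> a))"
  let ?F2 = "tensor_lift AHV (\<lambda>a v. pureC A (tensorC H V) a (\<rho> v))"
  note F1 = lift_linear[OF spaces(1,3) AHV equalizer_left_bilin]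
  note F2 = lift_linear[OF spaces(1,3) AHV equalizer_right_bilin]
  \<comment> \<open>\<open>\<Sum> \<phi>(x) y \<otimes> (w\<^sub>-\<^sub>1 \<otimes> w\<^sub>0)\<close> with \<open>x \<otimes> y\<close> from \<open>l(h)\<close>, the common value of both sides\<close>
  let ?T = "\<lambda>h w. tensor_lift AHV (\<lambda>g w'. tensor_lift AHV (\<lambda>x y. \<phi> x \<odot>\<^bsub>AHV\<^esub> ?pp y g w') (l h)) (\<rho> w)"
  have T: "bilin H V AHV ?T" by (assumption | rule rls)+
  have "?F1 ?p = tensor_lift AHV (\<lambda>h w. tensor_lift AHV (\<lambda>h g. tensor_lift AHV (\<lambda>x y. \<phi> x \<odot>\<^bsub>AHV\<^esub> ?pp y g w) (l h)) (comul H h)) (\<rho> v)"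
    unfolding push[OF F1]
  proof (rule lift_cong[OF spaces(2,3) AHV _ _ closed(2)[OF v]])
    show "bilin H V AHV (\<lambda>h w. tensor_lift AHV (\<lambda>h g. tensor_lift AHV (\<lambda>x y. \<phi> x \<odot>\<^bsub>AHV\<^esub> ?pp y g w) (l h)) (comul H h))"
      by (assumption | rule rls)+
    fix h w assume h: "h \<in> carrier H" and w: "w \<in> carrier V"
    let ?\<Psi> = "\<lambda>x a g. \<phi> x \<odot>\<^bsub>AHV\<^esub> ?pp a g w"
    have \<Psi>: "trilin A A H AHV ?\<Psi>" by (insert w, (assumption | rule rls)+)
    have "tensor_lift AHV (\<lambda>x y. \<phi> x \<odot>\<^bsub>AHV\<^esub> ?F1 (pureC A V y w)) (l h) =
        tensor_lift AHV (\<lambda>x y. tensor_lift AHV (?\<Psi> x) (\<delta> y)) (l h)"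
    proof (rule lift_cong[OF spaces(1,1) AHV _ _ module_homs_closed[OF l_lin h]])
      show "bilin A A AHV (\<lambda>x y. tensor_lift AHV (?\<Psi> x) (\<delta> y))" by (insert w, (assumption | rule rls)+)
      fix x y assume x: "x \<in> carrier A" and y: "y \<in> carrier A"
      have b: "bilin A H AHV (\<lambda>a g. ?pp a g w)" by (insert w, (assumption | rule rls)+)
      show "\<phi> x \<odot>\<^bsub>AHV\<^esub> ?F1 (pureC A V y w) = tensor_lift AHV (?\<Psi> x) (\<delta> y)"
        using lift_pureC[OF spaces(1,3) AHV equalizer_left_bilin y w]
          lift_comp[OF spaces(1,2) AHV AHV b lin_scale[OF AHV module_homs_id] closed(1)[OF y]] by simp
    qed
    also have "\<dots> = tensor_lift AHV (\<lambda>h g. tensor_lift AHV (\<lambda>x y. ?\<Psi> x y g) (l h)) (comul H h)"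
      by (rule l_right_colinear[OF AHV \<Psi> h])
    finally show "tensor_lift AHV (\<lambda>x y. \<phi> x \<odot>\<^bsub>AHV\<^esub> ?F1 (pureC A V y w)) (l h) =
        tensor_lift AHV (\<lambda>h g. tensor_lift AHV (\<lambda>x y. ?\<Psi> x y g) (l h)) (comul H h)" .
  qed
  also have "\<dots> = tensor_lift AHV ?T (\<rho> v)"
    by (rule \<rho>_coassoc[OF AHV _ v]) (assumption | rule rls)+
  also have "\<dots> = ?F2 ?p"
    unfolding push[OF F2]
  proof (rule lift_cong[OF spaces(2,3) AHV T _ closed(2)[OF v], symmetric])
    fix h w assume h: "h \<in> carrier H" and w: "w \<in> carrier V"
    have "tensor_lift AHV (\<lambda>x y. \<phi> x \<odot>\<^bsub>AHV\<^esub> ?F2 (pureC A V y w)) (l h) =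
        tensor_lift AHV (\<lambda>x y. tensor_lift AHV (\<lambda>g w'. \<phi> x \<odot>\<^bsub>AHV\<^esub> ?pp y g w') (\<rho> w)) (l h)"
    proof (rule lift_cong[OF spaces(1,1) AHV _ _ module_homs_closed[OF l_lin h]])
      show "bilin A A AHV (\<lambda>x y. tensor_lift AHV (\<lambda>g w'. \<phi> x \<odot>\<^bsub>AHV\<^esub> ?pp y g w') (\<rho> w))"
        by (insert w, (assumption | rule rls)+)
      fix x y assume x: "x \<in> carrier A" and y: "y \<in> carrier A"
      have r: "(\<lambda>u. \<phi> x \<odot>\<^bsub>AHV\<^esub> pureC A (tensorC H V) y u) \<in> linear_maps (tensorC H V) AHV"
        by (insert y, (assumption | rule rls)+)
      show "\<phi> x \<odot>\<^bsub>AHV\<^esub> ?F2 (pureC A V y w) = tensor_lift AHV (\<lambda>g w'. \<phi> x \<odot>\<^bsub>AHV\<^esub> ?pp y g w') (\<rho> w)"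
        using lift_pureC[OF spaces(1,3) AHV equalizer_right_bilin y w]
          lift_comp[OF spaces(2,3) HV AHV pureC_bilin[OF spaces(2,3)] r closed(2)[OF w]]
          lift_pureC_id[OF spaces(2,3) closed(2)[OF w]] by simp
    qed
    also have "\<dots> = ?T h w"
      by (rule lift_swap[OF spaces(1,1) spaces(2,3) AHV module_homs_closed[OF l_lin h] closed(2)[OF w]])
        (assumption | rule rls)+
    finally show "tensor_lift AHV (\<lambda>x y. \<phi> x \<odot>\<^bsub>AHV\<^esub> ?F2 (pureC A V y w)) (l h) = ?T h w" .
  qed
  finally show ?thesis
    unfolding p using lift_closed[OF spaces(2,3) AVs b0 closed(2)[OF v]] by (simp add: cotensor_iff)
qed

definition coefficient :: "(('a, 'v) tens \<Rightarrow> complex) \<Rightarrow> 'v \<Rightarrow> 'a"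
  where "coefficient \<psi> v = tensor_lift A (\<lambda>a u. \<psi> u \<odot>\<^bsub>A\<^esub> a) (L v)"

context
  fixes \<psi> assumes \<psi>: "\<psi> \<in> linear_maps AV CC"
begin

lemma coefficient_inner_bilin: "bilin A AV A (\<lambda>a u. \<psi> u \<odot>\<^bsub>A\<^esub> a)"
  by (assumption | rule lins lin_comp[OF \<psi>])+

lemma coefficient_lin: "coefficient \<psi> \<in> linear_maps V A"
  unfolding coefficient_def
  by (rule lin_comp[OF lift_linear[OF spaces(1) tensorC_space[OF spaces(1,3)] spaces(1) coefficient_inner_bilin] L_lin])

lemma coefficient_eq: "v \<in> carrier V \<Longrightarrow> coefficient \<psi> v =
    tensor_lift A (\<lambda>h w. tensor_lift A (\<lambda>x y. \<psi> (pureC A V y w) \<odot>\<^bsub>A\<^esub> x) (l h)) (\<rho> v)"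
  unfolding coefficient_def by (rule lift_L[OF spaces(1) coefficient_inner_bilin])

lemma lin_coefficient:
  assumes K: "complex_space K" and g: "g \<in> linear_maps A K" and v: "v \<in> carrier V"
  shows "g (coefficient \<psi> v) =
    tensor_lift K (\<lambda>h w. tensor_lift K (\<lambda>x y. \<psi> (pureC A V y w) \<odot>\<^bsub>K\<^esub> g x) (l h)) (\<rho> v)"
  unfolding coefficient_eq[OF v]
proof (rule lift_comp_nested[OF spaces(1,1,3,1) K spaces(2) _ l_lin g _ closed(2)[OF v]])
  show "trilin A A V A (\<lambda>x y w. \<psi> (pureC A V y w) \<odot>\<^bsub>A\<^esub> x)"
    by (assumption | rule lins lin_comp[OF \<psi>])+
qed (rule lin_smult[OF g])

text \<open>
  Contraction of the second leg of \<open>L\<close> leaves the first leg \<open>x\<close> of \<open>l(v\<^sub>-\<^sub>1)\<close>.  Left colinearity of \<open>l\<close> turns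
  its coaction into \<open>x \<otimes> S(v\<^sub>-\<^sub>2)\<close> with \<open>x\<close> from \<open>l(v\<^sub>-\<^sub>1)\<close>, and coassociativity regroups the legs of \<open>v\<close>.
\<close>

lemma coefficient_covariant:
  assumes v: "v \<in> carrier V"
  shows "\<delta> (coefficient \<psi> v) = tensor_lift AH (\<lambda>h w. pureC A H (coefficient \<psi> w) (antipode H h)) (\<rho> v)"
proof -
  note AHs = tensorC_space[OF spaces(1,2)]
  note rls = lins l_rules lin_comp[OF \<psi>] lin_comp[OF coefficient_lin] module_homs_closed[OF coefficient_lin]
  let ?c = "\<lambda>y w. \<psi> (pureC A V y w)"
  let ?T = "\<lambda>h g w. tensor_lift AH (\<lambda>x y. ?c y w \<odot>\<^bsub>AH\<^esub> pureC A H x (antipode H h)) (l g)"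
  have T: "trilin H H V AH ?T" by (assumption | rule rls)+
  have "\<delta> (coefficient \<psi> v) = tensor_lift AH (\<lambda>h w. tensor_lift AH (\<lambda>x y. ?c y w \<odot>\<^bsub>AH\<^esub> \<delta> x) (l h)) (\<rho> v)"
    by (rule lin_coefficient[OF AHs \<delta>_lin v])
  also have "\<dots> = tensor_lift AH (\<lambda>h w. tensor_lift AH (\<lambda>h g. ?T h g w) (comul H h)) (\<rho> v)"
  proof (rule lift_cong[OF spaces(2,3) AHs _ _ closed(2)[OF v]])
    show "bilin H V AH (\<lambda>h w. tensor_lift AH (\<lambda>h g. ?T h g w) (comul H h))" by (assumption | rule rls)+
    fix h w assume h: "h \<in> carrier H" and w: "w \<in> carrier V"
    let ?\<Phi> = "\<lambda>a g y. ?c y w \<odot>\<^bsub>AH\<^esub> pureC A H a g"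
    have \<Phi>: "trilin A H A AH ?\<Phi>" by (insert w, (assumption | rule rls)+)
    have "tensor_lift AH (\<lambda>x y. ?c y w \<odot>\<^bsub>AH\<^esub> \<delta> x) (l h) =
        tensor_lift AH (\<lambda>x y. tensor_lift AH (\<lambda>a g. ?\<Phi> a g y) (\<delta> x)) (l h)"
    proof (rule lift_cong[OF spaces(1,1) AHs _ _ module_homs_closed[OF l_lin h]])
      show "bilin A A AH (\<lambda>x y. tensor_lift AH (\<lambda>a g. ?\<Phi> a g y) (\<delta> x))" by (insert w, (assumption | rule rls)+)
      fix x y assume x: "x \<in> carrier A" and y: "y \<in> carrier A"
      show "?c y w \<odot>\<^bsub>AH\<^esub> \<delta> x = tensor_lift AH (\<lambda>a g. ?\<Phi> a g y) (\<delta> x)"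
        using lift_comp[OF spaces(1,2) AHs AHs pureC_bilin[OF spaces(1,2)] lin_scale[OF AHs module_homs_id] closed(1)[OF x]]
          lift_pureC_id[OF spaces(1,2) closed(1)[OF x]] by simp
    qed
    also have "\<dots> = tensor_lift AH (\<lambda>h g. ?T h g w) (comul H h)"
      by (rule l_left_colinear[OF AHs \<Phi> h])
    finally show "tensor_lift AH (\<lambda>x y. ?c y w \<odot>\<^bsub>AH\<^esub> \<delta> x) (l h) = tensor_lift AH (\<lambda>h g. ?T h g w) (comul H h)" .
  qed
  also have "\<dots> = tensor_lift AH (\<lambda>h w. tensor_lift AH (?T h) (\<rho> w)) (\<rho> v)"
    by (rule \<rho>_coassoc[OF AHs T v])
  also have "\<dots> = tensor_lift AH (\<lambda>h w. pureC A H (coefficient \<psi> w) (antipode H h)) (\<rho> v)"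
  proof (rule lift_cong[OF spaces(2,3) AHs _ _ closed(2)[OF v]])
    show "bilin H V AH (\<lambda>h w. pureC A H (coefficient \<psi> w) (antipode H h))" by (assumption | rule rls)+
    fix h w assume h: "h \<in> carrier H" and w: "w \<in> carrier V"
    show "tensor_lift AH (?T h) (\<rho> w) = pureC A H (coefficient \<psi> w) (antipode H h)"
      by (rule lin_coefficient[OF AHs bilin_left[OF pureC_bilin[OF spaces(1,2)] closed(4)[OF h]] w, symmetric])
  qed
  finally show ?thesis .
qed

end

text \<open>
  Multiplying the first two legs of \<open>L v\<close> gives \<open>m(l(v\<^sub>-\<^sub>1)) \<otimes> v\<^sub>0 = 1 \<otimes> \<epsilon>(v\<^sub>-\<^sub>1) v\<^sub>0 = 1 \<otimes> v\<close>.
\<close>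

lemma mult_L:
  assumes v: "v \<in> carrier V"
  shows "tensor_lift AV (\<lambda>x. lact x) (L v) = pureC A V \<one>\<^bsub>A\<^esub> v"
proof -
  note AVs = tensorC_space[OF spaces(1,3)]
  note rls = lins l_rules
  have cu: "bilin H V V (\<lambda>h w. counit H h \<odot>\<^bsub>V\<^esub> w)" by (assumption | rule lins)+
  note one = bilin_right[OF pureC_bilin[OF spaces(1,3)] A.A.one_closed]
  have "tensor_lift AV (\<lambda>x. lact x) (L v) =
      tensor_lift AV (\<lambda>h w. tensor_lift AV (\<lambda>x y. lact x (pureC A V y w)) (l h)) (\<rho> v)"
    by (rule lift_L[OF AVs left_mult_AV_bilin v])
  also have "\<dots> = tensor_lift AV (\<lambda>h w. pureC A V \<one>\<^bsub>A\<^esub> (counit H h \<odot>\<^bsub>V\<^esub> w)) (\<rho> v)"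
  proof (rule lift_cong[OF spaces(2,3) AVs _ _ closed(2)[OF v]])
    show "bilin H V AV (\<lambda>h w. pureC A V \<one>\<^bsub>A\<^esub> (counit H h \<odot>\<^bsub>V\<^esub> w))" by (assumption | rule lins)+
    fix h w assume h: "h \<in> carrier H" and w: "w \<in> carrier V"
    have b: "bilin A A AV (\<lambda>x y. pureC A V (x \<otimes>\<^bsub>A\<^esub> y) w)" by (insert w, (assumption | rule lins)+)
    have m: "bilin A A A (\<lambda>x y. x \<otimes>\<^bsub>A\<^esub> y)" by (assumption | rule lins)+
    have r: "(\<lambda>a. pureC A V a w) \<in> linear_maps A AV" by (rule bilin_left[OF pureC_bilin[OF spaces(1,3)] w])
    have "tensor_lift AV (\<lambda>x y. lact x (pureC A V y w)) (l h) =
        tensor_lift AV (\<lambda>x y. pureC A V (x \<otimes>\<^bsub>A\<^esub> y) w) (l h)"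
      by (rule lift_cong[OF spaces(1,1) AVs b _ module_homs_closed[OF l_lin h]]) (simp add: left_mult_AV_pure w)
    also have "\<dots> = pureC A V (tensor_lift A (\<lambda>x y. x \<otimes>\<^bsub>A\<^esub> y) (l h)) w"
      by (rule lift_comp[OF spaces(1,1,1) AVs m r module_homs_closed[OF l_lin h], symmetric])
    also have "\<dots> = pureC A V \<one>\<^bsub>A\<^esub> (counit H h \<odot>\<^bsub>V\<^esub> w)"
      by (simp add: l_mult[OF h] lin_smult[OF r] lin_smult[OF one] w)
    finally show "tensor_lift AV (\<lambda>x y. lact x (pureC A V y w)) (l h) =
      pureC A V \<one>\<^bsub>A\<^esub> (counit H h \<odot>\<^bsub>V\<^esub> w)" .
  qed
  also have "\<dots> = pureC A V \<one>\<^bsub>A\<^esub> (tensor_lift V (\<lambda>h w. counit H h \<odot>\<^bsub>V\<^esub> w) (\<rho> v))"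
    by (rule lift_comp[OF spaces(2,3,3) AVs cu one closed(2)[OF v], symmetric])
  finally show ?thesis by (simp add: \<rho>_counit[OF v])
qed

text \<open>
  The decomposition of tensors is applied to the finitely many values of \<open>L\<close> on a basis of \<open>V\<close>.  Both sides
  of \<open>L v = \<Sum>\<^sub>k z\<^sub>k(v) \<otimes> q\<^sub>k\<close> are linear in \<open>v\<close>, so it holds on all of \<open>V\<close>.
\<close>

theorem frame_exists:
  assumes fd: "finite_dimensional V"
  shows "\<exists>n z q. frame n z q"
proof -
  note AVs = tensorC_space[OF spaces(1,3)]
  note AAV = tensorC_space[OF spaces(1) AVs]
  interpret V: module complex_ring V by (rule spaces(3))
  interpret AV: module complex_ring AV by (rule AVs)
  interpret AAV: module complex_ring "tensorC A AV" by (rule AAV)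
  obtain X where X: "finite X" "X \<subseteq> carrier V"
    and basis: "\<forall>v\<in>carrier V. \<exists>!c. c \<in> extensional X \<and> v = (\<Oplus>\<^bsub>V\<^esub>x\<in>X. c x \<odot>\<^bsub>V\<^esub> x)"
    using fd unfolding finite_dimensional_def by (elim exE conjE)
  have span: "\<exists>c. v = (\<Oplus>\<^bsub>V\<^esub>x\<in>X. c x \<odot>\<^bsub>V\<^esub> x)" if "v \<in> carrier V" for v
    using ex1_implies_ex[OF bspec[OF basis that]] by (elim exE conjE) (rule exI)
  have "\<exists>(n :: nat) q \<psi>. (\<forall>k<n. q k \<in> cotensor H A \<delta> V \<rho> \<and> \<psi> k \<in> linear_maps AV CC) \<and>
    (\<forall>t\<in>L ` X. (\<Oplus>\<^bsub>tensorC A AV\<^esub>k\<in>{..<n}. pureC A AV (tensor_lift A (\<lambda>a u. \<psi> k u \<odot>\<^bsub>A\<^esub> a) t) (q k)) = t)"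
    by (rule finite_rank_decomposition[OF spaces(1) AVs _ _ cotensor_subspace])
      (use X slice_cotensor module_homs_closed[OF L_lin] in auto)
  then obtain n :: nat and q \<psi> where q\<psi>: "\<forall>k<n. q k \<in> cotensor H A \<delta> V \<rho> \<and> \<psi> k \<in> linear_maps AV CC"
    and dec: "\<forall>t\<in>L ` X. (\<Oplus>\<^bsub>tensorC A AV\<^esub>k\<in>{..<n}. pureC A AV (tensor_lift A (\<lambda>a u. \<psi> k u \<odot>\<^bsub>A\<^esub> a) t) (q k)) = t"
    by (elim exE conjE)
  have q: "q k \<in> cotensor H A \<delta> V \<rho>" "q k \<in> carrier AV" and \<psi>: "\<psi> k \<in> linear_maps AV CC" if "k < n" for k
    using q\<psi> that P_AV by auto
  let ?z = "\<lambda>k. coefficient (\<psi> k)"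
  note z = coefficient_lin[OF \<psi>]
  let ?G = "\<lambda>v. \<Oplus>\<^bsub>tensorC A AV\<^esub>k\<in>{..<n}. pureC A AV (?z k v) (q k)"
  have G: "?G \<in> linear_maps V (tensorC A AV)"
    by (rule lin_finsum[OF AAV]) (auto intro!: lin_pure_left[OF spaces(1) AVs] z q)
  have GL: "?G v = L v" if v: "v \<in> carrier V" for v
  proof -
    obtain c where c: "v = (\<Oplus>\<^bsub>V\<^esub>x\<in>X. c x \<odot>\<^bsub>V\<^esub> x)" using span[OF v] by blast
    have cx: "c x \<odot>\<^bsub>V\<^esub> x \<in> carrier V" if "x \<in> X" for x using X that by (auto simp: space_smult[OF spaces(3)])
    have Gx: "?G x = L x" if "x \<in> X" for x using dec that by (simp add: coefficient_def)
    note sumG = lin_of_finsum[OF spaces(3) AAV]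
    have "?G v = (\<Oplus>\<^bsub>tensorC A AV\<^esub>x\<in>X. ?G (c x \<odot>\<^bsub>V\<^esub> x))"
      unfolding c by (rule sumG[OF G X(1) cx])
    also have "\<dots> = (\<Oplus>\<^bsub>tensorC A AV\<^esub>x\<in>X. L (c x \<odot>\<^bsub>V\<^esub> x))"
    proof (rule AAV.finsum_cong')
      fix x assume x: "x \<in> X"
      then have "x \<in> carrier V" using X by blast
      then show "?G (c x \<odot>\<^bsub>V\<^esub> x) = L (c x \<odot>\<^bsub>V\<^esub> x)"
        by (simp only: lin_smult[OF G] lin_smult[OF L_lin] Gx[OF x])
    qed (use cx module_homs_closed[OF L_lin] in auto)
    also have "\<dots> = L v" unfolding c by (rule sumG[OF L_lin X(1) cx, symmetric])
    finally show ?thesis .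
  qed
  have "(\<Oplus>\<^bsub>AV\<^esub>k\<in>{..<n}. lact (?z k v) (q k)) = pureC A V \<one>\<^bsub>A\<^esub> v" if v: "v \<in> carrier V" for v
  proof -
    \<comment> \<open>The action of the first leg on the second, which recovers the sum from \<open>L v\<close>.\<close>
    let ?m = "tensor_lift AV (\<lambda>x. lact x)"
    have m: "?m \<in> linear_maps (tensorC A AV) AV"
      by (rule lift_linear[OF spaces(1) AVs AVs left_mult_AV_bilin])
    have zv: "?z k v \<in> carrier A" if "k < n" for k by (rule module_homs_closed[OF z[OF that] v])
    have "(\<Oplus>\<^bsub>AV\<^esub>k\<in>{..<n}. lact (?z k v) (q k)) =
        (\<Oplus>\<^bsub>AV\<^esub>k\<in>{..<n}. ?m (pureC A AV (?z k v) (q k)))"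
      by (rule AV.finsum_cong')
        (auto simp: lift_pureC[OF spaces(1) AVs AVs left_mult_AV_bilin] zv q
          intro!: module_homs_closed[OF m] pureC_closed[OF spaces(1) AVs] module_homs_closed[OF left_mult_AV_lin])
    also have "\<dots> = ?m (?G v)"
      by (rule lin_of_finsum[OF AAV AVs m, symmetric])
        (auto intro!: pureC_closed[OF spaces(1) AVs] zv q)
    finally show ?thesis by (simp only: GL[OF v] mult_L[OF v])
  qed
  then have "frame n ?z q"
    unfolding frame_def using q z coefficient_covariant[OF \<psi>] by simp
  then show ?thesis by blast
qed

end

theorem theorem1p1:
  fixes H :: "'h hopf"
    and A :: "(complex, 'a) module" and \<delta> :: "'a \<Rightarrow> ('a, 'h) tens"
    and A' :: "(complex, 'b) module" and \<delta>' :: "'b \<Rightarrow> ('b, 'h) tens"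
    and V :: "(complex, 'v) module" and \<rho> :: "'v \<Rightarrow> ('h, 'v) tens"
    and f :: "'a \<Rightarrow> 'b"
  assumes "hopf_algebra H"
    and "bij_betw (antipode H) (carrier H) (carrier H)"
    and "comodule_algebra H A \<delta>"
    and "comodule_algebra H A' \<delta>'"
    and "left_comodule H V \<rho>" and "finite_dimensional V"
    and "principal_comodule_algebra H A \<delta>"
    and "f \<in> algebra_homs A A'" and "f \<in> colinear_maps H A \<delta> A' \<delta>'"
  shows "let B = coinvariants H A \<delta>;
             B' = coinvariants H A' \<delta>';
             P = cotensor_module H A \<delta> V \<rho>;
             P' = cotensor_module H A' \<delta>' V \<rho>
         in f \<in> algebra_homs B B' \<and>
            bimodule B' B (regular_module B') (\<lambda>b' b. b' \<otimes>\<^bsub>B'\<^esub> f b) \<and>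
            module_isomorphic B' (base_change B B' f P) P' \<and>
            fg_projective B P \<and> fg_projective B' P' \<and>
            is_K0_map B B' f (K0_map B B' f) \<and>
            K0_map B B' f (K0_class B P) = K0_class B' P'"
proof -
  interpret c: cotensor_map H A \<delta> V \<rho> A' \<delta>' f
    by (intro cotensor_map.intro cotensor_map_axioms.intro cotensor_data.intro assms)
  obtain l where l: "strong_connection H A \<delta> l"
    using assms(7) by (auto simp: principal_comodule_algebra_def)
  interpret s: strong_connection_data H A \<delta> V \<rho> l
    by (intro strong_connection_data.intro strong_connection_data_axioms.intro c.dom.cotensor_data_axioms l assms)
  obtain n z q where fr: "c.dom.frame n z q" using s.frame_exists[OF assms(6)] by blast
  have iso: "module_isomorphic c.cod.B (c.BC c.dom.P) c.cod.P" by (rule c.base_change_isomorphic[OF fr])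
  have P: "fg_projective c.dom.B c.dom.P"
    by (rule fg_projectiveI[OF c.dom.P_left_module c.dom.frame_dual_basis[OF fr]])
  have P': "fg_projective c.cod.B c.cod.P"
    by (rule fg_projectiveI[OF c.cod.P_left_module c.cod.frame_dual_basis[OF c.frame_push[OF fr]]])
  have K: "K0_map c.dom.B c.cod.B f (K0_class c.dom.B c.dom.P) = K0_class c.cod.B c.cod.P"
    using c.K0_map_K0_class[OF P] K0_class_cong[OF iso] by simp
  show ?thesis
    unfolding Let_def
    using c.f_algebra_hom c.regular_bimodule iso P P' c.is_K0_map_K0_map K by blast
qed

end
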